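(* Let $T_1,\dots,T_N\in\mathfrak G\cup\mathfrak B$ be a finite collection of good and bad maps with $\Sigma_G\neq\emptyset$ and $\Sigma_B\neq\emptyset$, and let $\Sigma=\{1,\dots,N\}$. For each $n\ge0$ let $\mathbf p_n=(p_{n,j})_{j\in\Sigma}$ be a positive probability vector such that $\sup_n\sum_{b\in\Sigma_B}p_{n,b}\ell_b<1$, and assume that $\lim_{n\to\infty}\mathbf p_n=\mathbf p$ for a positive probability vector $\mathbf p=(p_j)_{j\in\Sigma}$. For a positive probability vector $\mathbf q$ with $\sum_{b\in\Sigma_B}q_b\ell_b<1$ let $\mu_{\mathbf q}$ denote the unique stationary probability measure, for the random map with probability vector $\mathbf q$, that is absolutely continuous with respect to Lebesgue measure. Then the sequence $\mu_{\mathbf p_n}$ converges weakly to $\mu_{\mathbf p}$.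
   Context: Fix $c\in(0,1)$. $D$ denotes the derivative (one-sided at $0$ and $1$). The Schwarzian derivative is $\mathbf ST=\frac{D^3T}{DT}-\frac32\big(\frac{D^2T}{DT}\big)^2$; $T$ has non-positive Schwarzian derivative on an interval if $DT\ne0$ and $\mathbf ST\le0$ there. The class $\mathfrak G$ of good maps consists of the maps $T_g:[0,1]\to[0,1]$ such that (G1) $T_g|_{(0,c)}$ and $T_g|_{(c,1)}$ are $C^3$ diffeomorphisms onto $(0,1)$ and $T_g(\{0,c,1\})\subseteq\{0,1\}$; (G2) $T_g$ has non-positive Schwarzian derivative on $[0,c)$ and $(c,1]$; (G3) there are associated constants $r_g\ge1$, $0<K_g<1$, $M_g>r_g$ with $K_g|x-c|^{r_g-1}\le|DT_g(x)|\le M_g|x-c|^{r_g-1}$ for all $x\in[0,1]\setminus\{c\}$; (G4) $|DT_g(0)|,|DT_g(1)|>1$. The class $\mathfrak B$ of bad maps consists of the maps $T_b:[0,1]\to[0,1]$ such that (B1) $T_b|_{(0,c)}$ and $T_b|_{(c,1)}$ are $C^3$ diffeomorphisms, each onto $(0,c)$ or $(c,1)$, $T_b(\{0,1\})\subseteq\{0,1\}$ and $T_b(c)=c$; (B2) $T_b$ has non-positive Schwarzian derivative on $[0,c)$ and $(c,1]$; (B3) there are associated constants $\ell_b>1$, $0<K_b<1$, $M_b>\ell_b$ with $K_b|x-c|^{\ell_b-1}\le|DT_b(x)|\le M_b|x-c|^{\ell_b-1}$ for all $x\in[0,1]\setminus\{c\}$; (B4) $|DT_b(0)|,|DT_b(1)|>1$.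 For $T_1,\dots,T_N\in\mathfrak G\cup\mathfrak B$ put $\Sigma=\{1,\dots,N\}$, $\Sigma_G=\{j:T_j\in\mathfrak G\}$, $\Sigma_B=\{j:T_j\in\mathfrak B\}$. For a probability vector $\mathbf q=(q_j)_{j\in\Sigma}$, a Borel measure $\mu$ on $[0,1]$ is stationary (for the random map with probability vector $\mathbf q$) if $\sum_{j\in\Sigma}q_j\mu(T_j^{-1}A)=\mu(A)$ for all Borel $A\subseteq[0,1]$. A probability vector is positive if all its entries are positive. It is a fact (other theorems of the paper) that when $\mathbf q$ is positive and $\sum_{b\in\Sigma_B}q_b\ell_b<1$ there is exactly one absolutely continuous stationary probability measure $\mu_{\mathbf q}$. *)

theory Defs
  imports "HOL-Probability.Probability"
begin

text \<open>Maps of the unit interval are functions \<open>real \<Rightarrow> real\<close> whose values outside \<open>[0,1]\<close> play no role.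
  Derivatives are therefore taken within \<open>[0,1]\<close>: this is the ordinary derivative
  at interior points and the one-sided derivative at \<open>0\<close> and \<open>1\<close>.\<close>

definition D01 :: "(real \<Rightarrow> real) \<Rightarrow> real \<Rightarrow> real" where
  "D01 f x = vector_derivative f (at x within {0..1})"

definition thrice_differentiable_on01 :: "(real \<Rightarrow> real) \<Rightarrow> real set \<Rightarrow> bool" where
  "thrice_differentiable_on01 f S \<longleftrightarrow>
     (\<forall>i<3. \<forall>x\<in>S. (D01 ^^ i) f differentiable (at x within {0..1}))"

definition C3_on01 :: "(real \<Rightarrow> real) \<Rightarrow> real set \<Rightarrow> bool" where
  "C3_on01 f S \<longleftrightarrow> thrice_differentiable_on01 f S \<and> continuous_on S ((D01 ^^ 3) f)"

text \<open>Only used for open intervals \<open>I, J \<subseteq> (0,1)\<close>, where \<^const>\<open>D01\<close> is the ordinary derivative.\<close>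

definition C3_diffeo01 :: "(real \<Rightarrow> real) \<Rightarrow> real set \<Rightarrow> real set \<Rightarrow> bool" where
  "C3_diffeo01 f I J \<longleftrightarrow> bij_betw f I J \<and> C3_on01 f I \<and> C3_on01 (the_inv_into I f) J"

definition schwarzian :: "(real \<Rightarrow> real) \<Rightarrow> real \<Rightarrow> real" where
  "schwarzian f x = (D01 ^^ 3) f x / D01 f x - 3 / 2 * ((D01 ^^ 2) f x / D01 f x)\<^sup>2"

text \<open>The differentiability clause makes the Schwarzian meaningful; at the endpoints \<open>0\<close> and \<open>1\<close>
  it asks for one-sided derivatives up to order three, without continuity of the third.\<close>

definition nonpos_schwarzian_on :: "(real \<Rightarrow> real) \<Rightarrow> real set \<Rightarrow> bool" where
  "nonpos_schwarzian_on f S \<longleftrightarrow>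
     thrice_differentiable_on01 f S \<and> (\<forall>x\<in>S. D01 f x \<noteq> 0 \<and> schwarzian f x \<le> 0)"

definition good_map :: "real \<Rightarrow> (real \<Rightarrow> real) \<Rightarrow> bool" where
  "good_map c T \<longleftrightarrow>
     T \<in> {0..1} \<rightarrow> {0..1} \<and>
     C3_diffeo01 T {0<..<c} {0<..<1} \<and> C3_diffeo01 T {c<..<1} {0<..<1} \<and>
     T ` {0, c, 1} \<subseteq> {0, 1} \<and>
     nonpos_schwarzian_on T {0..<c} \<and> nonpos_schwarzian_on T {c<..1} \<and>
     (\<exists>r K M. r \<ge> 1 \<and> 0 < K \<and> K < 1 \<and> M > r \<and>
        (\<forall>x\<in>{0..1} - {c}. K * \<bar>x - c\<bar> powr (r - 1) \<le> \<bar>D01 T x\<bar> \<and>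
                           \<bar>D01 T x\<bar> \<le> M * \<bar>x - c\<bar> powr (r - 1))) \<and>
     \<bar>D01 T 0\<bar> > 1 \<and> \<bar>D01 T 1\<bar> > 1"

text \<open>The exponent \<open>l\<close> is kept as an argument because it enters the averaging condition
  on the probability vectors. It is determined by \<open>T\<close> through the growth of the derivative near \<open>c\<close>.\<close>

definition bad_map_exponent :: "real \<Rightarrow> (real \<Rightarrow> real) \<Rightarrow> real \<Rightarrow> bool" where
  "bad_map_exponent c T l \<longleftrightarrow>
     T \<in> {0..1} \<rightarrow> {0..1} \<and>
     (C3_diffeo01 T {0<..<c} {0<..<c} \<or> C3_diffeo01 T {0<..<c} {c<..<1}) \<and>
     (C3_diffeo01 T {c<..<1} {0<..<c} \<or> C3_diffeo01 T {c<..<1} {c<..<1}) \<and>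
     T ` {0, 1} \<subseteq> {0, 1} \<and> T c = c \<and>
     nonpos_schwarzian_on T {0..<c} \<and> nonpos_schwarzian_on T {c<..1} \<and>
     l > 1 \<and>
     (\<exists>K M. 0 < K \<and> K < 1 \<and> M > l \<and>
        (\<forall>x\<in>{0..1} - {c}. K * \<bar>x - c\<bar> powr (l - 1) \<le> \<bar>D01 T x\<bar> \<and>
                           \<bar>D01 T x\<bar> \<le> M * \<bar>x - c\<bar> powr (l - 1))) \<and>
     \<bar>D01 T 0\<bar> > 1 \<and> \<bar>D01 T 1\<bar> > 1"

definition bad_map :: "real \<Rightarrow> (real \<Rightarrow> real) \<Rightarrow> bool" where
  "bad_map c T \<longleftrightarrow> (\<exists>l. bad_map_exponent c T l)"

definition good_indices :: "real \<Rightarrow> nat \<Rightarrow> (nat \<Rightarrow> real \<Rightarrow> real) \<Rightarrow> nat set" where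
  "good_indices c N T = {j \<in> {1..N}. good_map c (T j)}"

definition bad_indices :: "real \<Rightarrow> nat \<Rightarrow> (nat \<Rightarrow> real \<Rightarrow> real) \<Rightarrow> nat set" where
  "bad_indices c N T = {j \<in> {1..N}. bad_map c (T j)}"

definition positive_prob_vector :: "nat \<Rightarrow> (nat \<Rightarrow> real) \<Rightarrow> bool" where
  "positive_prob_vector N q \<longleftrightarrow> (\<forall>j\<in>{1..N}. q j > 0) \<and> (\<Sum>j=1..N. q j) = 1"

abbreviation borel01 :: "real measure" where
  "borel01 \<equiv> restrict_space borel {0..1}"

definition stationary ::
    "nat \<Rightarrow> (nat \<Rightarrow> real \<Rightarrow> real) \<Rightarrow> (nat \<Rightarrow> real) \<Rightarrow> real measure \<Rightarrow> bool" where
  "stationary N T q \<mu> \<longleftrightarrow>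
     sets \<mu> = sets borel01 \<and>
     (\<forall>A\<in>sets borel01.
        (\<Sum>j=1..N. ennreal (q j) * emeasure \<mu> (T j -` A \<inter> {0..1})) = emeasure \<mu> A)"

definition ac_stationary_prob ::
    "nat \<Rightarrow> (nat \<Rightarrow> real \<Rightarrow> real) \<Rightarrow> (nat \<Rightarrow> real) \<Rightarrow> real measure \<Rightarrow> bool" where
  "ac_stationary_prob N T q \<mu> \<longleftrightarrow>
     prob_space \<mu> \<and> stationary N T q \<mu> \<and>
     absolutely_continuous (restrict_space lborel {0..1}) \<mu>"

text \<open>Weak convergence of Borel measures on the compact space \<open>[0,1]\<close>. The distribution-function notion
  \<^const>\<open>weak_conv_m\<close> is for measures on the whole Borel algebra of the real line.\<close>

definition weak_conv01 :: "(nat \<Rightarrow> real measure) \<Rightarrow> real measure \<Rightarrow> bool" where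
  "weak_conv01 \<mu> \<nu> \<longleftrightarrow>
     (\<forall>f :: real \<Rightarrow> real. continuous_on {0..1} f \<longrightarrow>
        (\<lambda>n. \<integral>x. f x \<partial>\<mu> n) \<longlonglongrightarrow> (\<integral>x. f x \<partial>\<nu>))"

end

theory Submission
  imports Defs "HOL-Real_Asymp.Real_Asymp" "HOL-Library.Diagonal_Subsequence"
begin

text \<open>
  If \<open>T\<close> has non-positive Schwarzian derivative, then \<open>(T y - T w)\<^sup>2 / (\<bar>T' y\<bar> (y - w)\<^sup>2)\<close> grows as \<open>y\<close>
  moves away from \<open>w\<close>. Hence the functions \<open>u \<ge> 0\<close> on \<open>(0,c)\<close> and \<open>(c,1)\<close> for which \<open>(y - w)\<^sup>2 u y\<close>
  grows as \<open>y\<close> moves away from \<open>w\<close>, for every \<open>w\<close> in the same interval, form a convex cone that the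
  transfer operator of the random map preserves. Its elements are locally bounded by their integral and locally
  Lipschitz, so bounded subsets are compact for pointwise convergence.

  Mass can escape only to \<open>0\<close>, \<open>c\<close> or \<open>1\<close>. With \<open>s > 1\<close> so small that the averaged \<open>s\<close>-th
  powers of the exponents of the bad maps stay below one, the Lyapunov functions \<open>(D - ln \<bar>x - c\<bar>)\<^sup>s\<close>
  and \<open>(- ln (min x (1 - x)))\<^sup>s\<close> exclude this, uniformly over the probability vectors in question. Cesaro means
  therefore accumulate at fixed densities in the cone.

  Such a fixed density is unique. If \<open>\<phi> - t \<xi>\<close>, for two of them, takes both signs, then the two sign
  regions are carried into themselves by all maps. Every orbit of a bad map tends to \<open>c\<close>, so both regions accumulate
  at \<open>c\<close>, and pulling back by a good map shows \<open>\<phi> y = t \<xi> y\<close> at a preimage \<open>y\<close> of \<open>c\<close>. This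
  determines \<open>t\<close>; for all other \<open>t\<close> the difference has one sign, and \<open>t \<rightarrow> 1\<close> gives equality.

  Polynomials are differences of cone elements and are dense in \<open>L\<^sup>1\<close>, so every absolutely continuous
  stationary measure has this density. By compactness the densities for \<open>p n\<close> converge in \<open>L\<^sup>1\<close> to the one
  for the limit vector.
\<close>

section \<open>Koebe monotonicity for maps with non-positive Schwarzian derivative\<close>

text \<open>A bad map is superattracting at \<open>c\<close>, and fixed densities may be unbounded
  at \<open>0\<close>, \<open>c\<close> and \<open>1\<close>, so no uniform bound on densities is
  available and no rate of convergence is sought: compactness and uniqueness take its place, with
  constants that depend on \<theta> but not on the individual probability vector. The hypothesis on
  the exponents is what a logarithm sees: up to an additive constant, a bad map multiplies
  \<open>- ln \<bar>x - c\<bar>\<close> by at most its exponent, so an averaged exponent below one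
  lets this weight contract in mean. The two weights form a hierarchy. Points away from
  \<open>0\<close> and \<open>1\<close> are sent close to them only from a neighbourhood of
  \<open>c\<close>; hence the weight at \<open>c\<close>, bounded along all iterates, pays for the
  weight at the endpoints, which is bounded only in Cesaro mean and only with the lower power
  \<open>s - 1\<close>. Cone elements are continuous on the two sides of \<open>c\<close>, so
  identities derived from integrals hold at single points. The uniqueness argument depends on this,
  since it compares densities at one preimage of \<open>c\<close>.\<close>

text \<open>The first function is, up to the factor \<open>(u - w)\<^sup>2\<close>, the derivative of the ratio in the second;
  the Schwarzian appears as the derivative of the former.\<close>

lemma koebe_ratio_derivatives:
  fixes T D D2 :: "real \<Rightarrow> real" and q :: real
  assumes T: "(T has_real_derivative D u) (at u)" and D: "(D has_real_derivative D2 u) (at u)"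
    and D2: "(D2 has_real_derivative d3) (at u)" and pos: "D u > 0"
  shows "((\<lambda>z. (z - w) * sqrt (D z) - (T z - T w) * (1 + (z - w) * D2 z / (2 * D z)) / sqrt (D z))
      has_real_derivative
      - (1/2) * (u - w) * (T u - T w) / sqrt (D u) * (d3 / D u - 3 / 2 * (D2 u / D u)\<^sup>2)) (at u)"
    and "u \<noteq> w \<Longrightarrow> ((\<lambda>z. (T z - T w) / ((z - w) * sqrt (D z))) has_real_derivative
      ((u - w) * sqrt (D u) - (T u - T w) * (1 + (u - w) * D2 u / (2 * D u)) / sqrt (D u)) / (u - w)\<^sup>2) (at u)"
proof -
  \<comment> \<open>In terms of \<open>q = sqrt (D u)\<close> both identities become rational, and
    clearing denominators reduces them to polynomial algebra.\<close>
  define q where "q = sqrt (D u)"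
  have q: "q > 0" "D u = q\<^sup>2" using pos by (auto simp: q_def)
  have s: "((\<lambda>z. sqrt (D z)) has_real_derivative D2 u / (2 * q)) (at u)"
    by (rule DERIV_cong[OF DERIV_chain2[OF DERIV_real_sqrt D]])
      (use pos in \<open>auto simp: q_def field_simps\<close>)
  note [derivative_intros] = T D D2 s
  have d1: "((\<lambda>z. (z - w) * sqrt (D z)) has_real_derivative q + (u - w) * (D2 u / (2 * q))) (at u)"
    by (rule derivative_eq_intros refl)+ (simp add: q_def)
  have d2: "((\<lambda>z. (T z - T w)) has_real_derivative q\<^sup>2) (at u)"
    using DERIV_diff[OF T DERIV_const[of "T w"]] q(2) by simp
  have d3: "((\<lambda>z. (1 + (z - w) * D2 z / (2 * D z))) has_real_derivative
      ((D2 u + (u - w) * d3) * (2 * q\<^sup>2) - (u - w) * D2 u * (2 * D2 u)) / (2 * q\<^sup>2)\<^sup>2) (at u)"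
    by (rule derivative_eq_intros refl)+ (use q in \<open>simp_all add: power2_eq_square\<close>)
  have M1: "((\<lambda>z. (T z - T w) * (1 + (z - w) * D2 z / (2 * D z)) / sqrt (D z)) has_real_derivative
     ((q\<^sup>2 * (1 + (u - w) * D2 u / (2 * q\<^sup>2)) + ((D2 u + (u - w) * d3) * (2 * q\<^sup>2) - (u - w) * D2 u * (2 * D2 u)) / (2 * q\<^sup>2)\<^sup>2 * (T u - T w)) * q
       - ((T u - T w) * (1 + (u - w) * D2 u / (2 * q\<^sup>2))) * (D2 u / (2 * q))) / (q * q)) (at u)"
    by (rule DERIV_cong[OF DERIV_divide[OF DERIV_mult[OF d2 d3] s]]) (use q pos in \<open>simp_all add: q_def[symmetric]\<close>)
  define a t e where "a = u - w" and "t = T u - T w" and "e = D2 u"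
  show "((\<lambda>z. (z - w) * sqrt (D z) - (T z - T w) * (1 + (z - w) * D2 z / (2 * D z)) / sqrt (D z))
      has_real_derivative
      - (1/2) * (u - w) * (T u - T w) / sqrt (D u) * (d3 / D u - 3 / 2 * (D2 u / D u)\<^sup>2)) (at u)"
    apply (rule DERIV_cong[OF DERIV_diff[OF d1 M1]])
    unfolding q_def[symmetric] q(2) a_def[symmetric] t_def[symmetric] e_def[symmetric]
    using q(1) by (simp add: divide_simps) algebra
  assume "u \<noteq> w"
  then have "a \<noteq> 0" by (simp add: a_def)
  show "((\<lambda>z. (T z - T w) / ((z - w) * sqrt (D z))) has_real_derivative
      ((u - w) * sqrt (D u) - (T u - T w) * (1 + (u - w) * D2 u / (2 * D u)) / sqrt (D u)) / (u - w)\<^sup>2) (at u)"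
    apply (rule DERIV_cong[OF DERIV_divide[OF d2 d1]])
    subgoal using \<open>u \<noteq> w\<close> q by (simp add: q_def[symmetric])
    unfolding q_def[symmetric] q(2) a_def[symmetric] t_def[symmetric] e_def[symmetric]
    using q(1) \<open>a \<noteq> 0\<close> by (simp add: divide_simps) algebra
qed

text \<open>The derivative of the ratio is \<open>M z / (z - w)\<^sup>2\<close>, where
  \<open>M\<close> vanishes at \<open>w\<close> and is nondecreasing because its own derivative
  carries the factor minus the Schwarzian. So the ratio increases, and its limit
  \<open>sqrt (D w)\<close> at \<open>w\<close> bounds it from below, which is the second
  inequality.\<close>

lemma koebe_ratio_pos:
  fixes T D D2 D3 :: "real \<Rightarrow> real"
  assumes S: "convex S"
    and T: "\<And>x. x \<in> S \<Longrightarrow> (T has_real_derivative D x) (at x within S)"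
    and D: "\<And>x. x \<in> S \<Longrightarrow> (D has_real_derivative D2 x) (at x within S)"
    and D2: "\<And>x. x \<in> S \<Longrightarrow> (D2 has_real_derivative D3 x) (at x within S)"
    and pos: "\<And>x. x \<in> S \<Longrightarrow> D x > 0"
    and schw: "\<And>x. x \<in> S \<Longrightarrow> D3 x / D x - 3 / 2 * (D2 x / D x)\<^sup>2 \<le> 0"
    and w: "w \<in> S" and y: "y \<in> S" and wx: "w < x" and xy: "x \<le> y"
  shows "(T x - T w) / ((x - w) * sqrt (D x)) \<le> (T y - T w) / ((y - w) * sqrt (D y))"
    and "sqrt (D w) * sqrt (D y) * (y - w) \<le> T y - T w"
proof -
  have sub: "{w..y} \<subseteq> S"
    using closed_segment_subset[OF w y S] wx xy by (simp add: closed_segment_eq_real_ivl1)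
  have at: "(f has_real_derivative f') (at z)"
    if "(f has_real_derivative f') (at z within S)" "z \<in> {w<..<y}" for f f' z
  proof -
    have "(f has_real_derivative f') (at z within {w<..<y})"
      by (rule DERIV_subset[OF that(1)]) (use sub in auto)
    then show ?thesis using that(2) by (simp add: at_within_open[of z "{w<..<y}"])
  qed
  have cont: "continuous_on {w..y} f"
    if "\<And>x. x \<in> S \<Longrightarrow> (f has_real_derivative f' x) (at x within S)" for f f'
    proof (rule DERIV_continuous_on)
    fix x assume "x \<in> {w..y}"
    then show "(f has_real_derivative f' x) (at x within {w..y})"
      using DERIV_subset[OF that sub] sub by blast
  qed
  have cT: "continuous_on {w..y} T" and cD: "continuous_on {w..y} D" and cD2: "continuous_on {w..y} D2"
    using cont[OF T] cont[OF D] cont[OF D2] by simp_all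
  have posI: "D z > 0" if "z \<in> {w..y}" for z using that pos sub by blast
  then have D0: "D z \<noteq> 0" "sqrt (D z) \<noteq> 0" if "z \<in> {w..y}" for z
    using that by force+
  have Tmono: "T w \<le> T z" if "z \<in> {w..y}" for z
  proof (cases "w = z")
    case False
    show ?thesis
    proof (rule DERIV_nonneg_imp_increasing_open[of w z])
      show "continuous_on {w..z} T" using cT that by (auto intro: continuous_on_subset)
      fix u assume "w < u" "u < z"
      then have uI: "u \<in> {w<..<y}" using that by auto
      moreover have "u \<in> S" using calculation sub by auto
      ultimately have "DERIV T u :> D u" using at[OF T] by blast
      then show "\<exists>y. (T has_real_derivative y) (at u) \<and> 0 \<le> y"
        using posI[of u] uI by (intro exI[of _ "D u"]) auto
    qed (use that False in auto)
  qed auto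
  define M where "M z = (z - w) * sqrt (D z) - (T z - T w) * (1 + (z - w) * D2 z / (2 * D z)) / sqrt (D z)" for z
  have cM: "continuous_on {w..y} M"
    unfolding M_def by (intro continuous_intros cT cD cD2) (simp_all add: D0 del: atLeastAtMost_iff real_sqrt_eq_zero_cancel_iff)
  have M0: "M z \<ge> 0" if z: "z \<in> {w<..y}" for z
  proof -
    have "M w \<le> M z"
    proof (rule DERIV_nonneg_imp_increasing_open[of w z])
      show "continuous_on {w..z} M" using cM that by (auto intro: continuous_on_subset)
      fix u assume u: "w < u" "u < z"
      then have uI: "u \<in> {w<..<y}" using that by auto
      have uS: "u \<in> S" using uI sub by force
      have p: "D u > 0" using pos uS by blast
      let ?M' = "- (1/2) * (u - w) * (T u - T w) / sqrt (D u) * (D3 u / D u - 3 / 2 * (D2 u / D u)\<^sup>2)"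
      have "(M has_real_derivative ?M') (at u)"
        unfolding M_def using koebe_ratio_derivatives(1)[OF at[OF T[OF uS] uI] at[OF D[OF uS] uI] at[OF D2[OF uS] uI] p] .
      moreover have "?M' \<ge> 0"
      proof -
        have "(u - w) * (T u - T w) / sqrt (D u) \<ge> 0" using u p Tmono[of u] uI by auto
        then have "- (1/2) * ((u - w) * (T u - T w) / sqrt (D u)) \<le> 0" by linarith
        from mult_nonpos_nonpos[OF this schw[OF uS]] show ?thesis by (simp add: mult.assoc)
      qed
      ultimately show "\<exists>y. (M has_real_derivative y) (at u) \<and> 0 \<le> y" by blast
    qed (use z in auto)
    then show ?thesis by (simp add: M_def)
  qed
  define R where "R z = (T z - T w) / ((z - w) * sqrt (D z))" for z
  have cR: "continuous_on {w<..y} R"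
    unfolding R_def
    by (intro continuous_intros continuous_on_subset[OF cT] continuous_on_subset[OF cD]) (use D0 in fastforce)+
  have Rmono: "R a \<le> R b" if ab: "w < a" "a \<le> b" "b \<le> y" for a b
  proof (cases "a = b")
    case False
    show ?thesis
    proof (rule DERIV_nonneg_imp_increasing_open[of a b])
      show "continuous_on {a..b} R" using cR that by (auto intro: continuous_on_subset)
      fix u assume u: "a < u" "u < b"
      then have uI: "u \<in> {w<..<y}" using that by auto
      have uS: "u \<in> S" using uI sub by force
      have p: "D u > 0" using pos uS by blast
      have uw: "u - w > 0" using uI by auto
      have "(R has_real_derivative M u / (u - w)^2) (at u)"
        unfolding R_def M_def using koebe_ratio_derivatives(2)[OF at[OF T[OF uS] uI] at[OF D[OF uS] uI] at[OF D2[OF uS] uI] p] uw by simp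
      then show "\<exists>y. (R has_real_derivative y) (at u) \<and> 0 \<le> y" using M0[of u] uI by force
    qed (use that False in auto)
  qed auto
  show "(T x - T w) / ((x - w) * sqrt (D x)) \<le> (T y - T w) / ((y - w) * sqrt (D y))"
    using Rmono[of x y] wx xy unfolding R_def by simp
  have wy: "w < y" using wx xy by simp
  \<comment> \<open>The difference quotient tends to \<open>D w\<close>, so the ratio tends to
    \<open>D w / sqrt (D w) = sqrt (D w)\<close> from the right.\<close>
  have "((\<lambda>z. (T z - T w) / (z - w) / sqrt (D z)) \<longlongrightarrow> D w / sqrt (D w)) (at_right w)"
  proof (intro tendsto_intros)
    have nb: "at w within {w..y} = at_right w" using wy by (simp add: at_within_Icc_at_right)
    have "(T has_real_derivative D w) (at_right w)"
      using DERIV_subset[OF T[OF w] sub] nb by simp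
    then show "((\<lambda>z. (T z - T w) / (z - w)) \<longlongrightarrow> D w) (at_right w)"
      by (simp add: has_field_derivative_iff)
    show "(D \<longlongrightarrow> D w) (at_right w)"
      using cD wy nb by (metis atLeastAtMost_iff continuous_on_def less_imp_le order_refl)
    show "sqrt (D w) \<noteq> 0" using pos[OF w] by simp
  qed
  then have "(R \<longlongrightarrow> sqrt (D w)) (at_right w)"
    using pos[OF w] unfolding R_def by (simp add: real_div_sqrt)
  then have "sqrt (D w) \<le> R y"
    by (rule tendsto_upperbound)
      (use wy Rmono in \<open>auto simp: eventually_at_right intro!: exI[of _ y]\<close>)
  then show "sqrt (D w) * sqrt (D y) * (y - w) \<le> T y - T w"
    using wy posI[of y] unfolding R_def by (simp add: field_simps)
qed

lemma DERIV_mirror_within: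
  fixes f :: "real \<Rightarrow> real"
  assumes "(f has_real_derivative d) (at (- x) within S)"
  shows "((\<lambda>z. f (- z)) has_real_derivative - d) (at x within uminus ` S)"
proof -
  have "uminus ` (uminus ` S) = S" by (auto simp: image_image)
  then have "(f \<circ> uminus has_real_derivative d * - 1) (at x within uminus ` S)"
    using assms by (intro DERIV_image_chain) (auto intro!: derivative_eq_intros)
  then show ?thesis by (simp add: o_def)
qed

text \<open>Squaring and clearing denominators admits the degenerate cases \<open>x = w\<close> and
  \<open>w = y\<close>, and makes the inequalities insensitive to the signs of
  \<open>T y - T w\<close> and \<open>y - w\<close>.\<close>

lemma koebe_inequalities_pos:
  fixes T D D2 D3 :: "real \<Rightarrow> real"
  assumes S: "convex S"
    and T: "\<And>x. x \<in> S \<Longrightarrow> (T has_real_derivative D x) (at x within S)"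
    and D: "\<And>x. x \<in> S \<Longrightarrow> (D has_real_derivative D2 x) (at x within S)"
    and D2: "\<And>x. x \<in> S \<Longrightarrow> (D2 has_real_derivative D3 x) (at x within S)"
    and pos: "\<And>x. x \<in> S \<Longrightarrow> D x > 0"
    and schw: "\<And>x. x \<in> S \<Longrightarrow> D3 x / D x - 3 / 2 * (D2 x / D x)\<^sup>2 \<le> 0"
    and w: "w \<in> S" and y: "y \<in> S" and wx: "w \<le> x" and xy: "x \<le> y"
  shows "(T x - T w)\<^sup>2 * (D y * (y - w)\<^sup>2) \<le> (T y - T w)\<^sup>2 * (D x * (x - w)\<^sup>2)"
    and "D w * D y * (y - w)\<^sup>2 \<le> (T y - T w)\<^sup>2"
proof -
  have xS: "x \<in> S"
    using closed_segment_subset[OF w y S] wx xy by (auto simp add: closed_segment_eq_real_ivl1)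
  have r1: "sqrt (D w) * sqrt (D b) * (b - w) \<le> T b - T w" if "b \<in> S" "w < b" for b
    by (rule koebe_ratio_pos(2)[OF S T D D2 pos schw w that]) simp_all
  show "(T x - T w)\<^sup>2 * (D y * (y - w)\<^sup>2) \<le> (T y - T w)\<^sup>2 * (D x * (x - w)\<^sup>2)"
  proof (cases "w = x")
    case False
    then have wx: "w < x" using wx by simp
    have p: "D x > 0" "D y > 0" using pos xS y by auto
    have 0: "0 \<le> (T x - T w) / ((x - w) * sqrt (D x))"
    proof -
      have "0 \<le> sqrt (D w) * sqrt (D x) * (x - w)" using wx pos[OF w] p by auto
      also have "\<dots> \<le> T x - T w" by (rule r1[OF xS wx])
      finally show ?thesis using wx p by auto
    qed
    have "((T x - T w) / ((x - w) * sqrt (D x)))\<^sup>2 \<le> ((T y - T w) / ((y - w) * sqrt (D y)))\<^sup>2"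
      by (rule power_mono[OF koebe_ratio_pos(1)[OF S T D D2 pos schw w y wx xy] 0])
    then show ?thesis using wx xy p by (simp add: power_divide power_mult_distrib divide_simps mult_ac)
  qed auto
  show "D w * D y * (y - w)\<^sup>2 \<le> (T y - T w)\<^sup>2"
  proof (cases "w = y")
    case False
    then have wy: "w < y" using wx xy by simp
    have "(sqrt (D w) * sqrt (D y) * (y - w))\<^sup>2 \<le> (T y - T w)\<^sup>2"
      by (rule power_mono[OF r1[OF y wy]]) (use wy pos[OF w] pos[OF y] in auto)
    then show ?thesis using pos[OF w] pos[OF y] by (simp add: power_mult_distrib)
  qed auto
qed

text \<open>For \<open>y < w\<close> the map \<open>\<lambda>z. - T (- z)\<close> is used on the
  reflected set: its derivative at \<open>z\<close> is \<open>D (- z)\<close>, and its Schwarzian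
  there is that of \<open>T\<close> at \<open>- z\<close>.\<close>

lemma koebe_inequalities_pos':
  fixes T D D2 D3 :: "real \<Rightarrow> real"
  assumes S: "convex S"
    and T: "\<And>x. x \<in> S \<Longrightarrow> (T has_real_derivative D x) (at x within S)"
    and D: "\<And>x. x \<in> S \<Longrightarrow> (D has_real_derivative D2 x) (at x within S)"
    and D2: "\<And>x. x \<in> S \<Longrightarrow> (D2 has_real_derivative D3 x) (at x within S)"
    and pos: "\<And>x. x \<in> S \<Longrightarrow> D x > 0"
    and schw: "\<And>x. x \<in> S \<Longrightarrow> D3 x / D x - 3 / 2 * (D2 x / D x)\<^sup>2 \<le> 0"
    and w: "w \<in> S" and y: "y \<in> S" and x: "x \<in> closed_segment w y"
  shows "(T x - T w)\<^sup>2 * (D y * (y - w)\<^sup>2) \<le> (T y - T w)\<^sup>2 * (D x * (x - w)\<^sup>2)"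
    and "D w * D y * (y - w)\<^sup>2 \<le> (T y - T w)\<^sup>2"
proof -
  have "(T x - T w)\<^sup>2 * (D y * (y - w)\<^sup>2) \<le> (T y - T w)\<^sup>2 * (D x * (x - w)\<^sup>2) \<and>
    D w * D y * (y - w)\<^sup>2 \<le> (T y - T w)\<^sup>2"
  proof (cases "w \<le> y")
    case True
    then show ?thesis
      using koebe_inequalities_pos[OF S T D D2 pos schw w y, of x] x by (simp add: closed_segment_eq_real_ivl1)
  next
    case False
    let ?S = "uminus ` S"
    have m: "(f has_real_derivative d) (at (- z) within S) \<Longrightarrow>
        ((\<lambda>z. - f (- z)) has_real_derivative d) (at z within ?S)" for f d z
      using DERIV_minus[OF DERIV_mirror_within[of f d z S]] by simp
    have S': "z \<in> ?S \<Longrightarrow> - z \<in> S" for z by auto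
    have 1: "convex ?S" using S convex_linear_image[OF linear_uminus] by blast
    have 2: "((\<lambda>z. - T (- z)) has_real_derivative D (- z)) (at z within ?S)" if "z \<in> ?S" for z
      using m[OF T] S'[OF that] by simp
    have 3: "((\<lambda>z. D (- z)) has_real_derivative - D2 (- z)) (at z within ?S)" if "z \<in> ?S" for z
      using DERIV_mirror_within[OF D] S'[OF that] by simp
    have 4: "((\<lambda>z. - D2 (- z)) has_real_derivative D3 (- z)) (at z within ?S)" if "z \<in> ?S" for z
      using m[OF D2] S'[OF that] by simp
    have 5: "D (- z) > 0" "D3 (- z) / D (- z) - 3 / 2 * (- D2 (- z) / D (- z))\<^sup>2 \<le> 0" if "z \<in> ?S" for z
      using pos schw S'[OF that] by auto
    have 6: "- w \<in> ?S" "- y \<in> ?S" "- w \<le> - x" "- x \<le> - y"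
      using w y False x by (auto simp: closed_segment_eq_real_ivl)
    have a: "(- w - - y)\<^sup>2 = (y - w)\<^sup>2" "(- x - - w)\<^sup>2 = (x - w)\<^sup>2" "(- y - - w)\<^sup>2 = (y - w)\<^sup>2"
       "(- T x - - T w)\<^sup>2 = (T x - T w)\<^sup>2" "(- T y - - T w)\<^sup>2 = (T y - T w)\<^sup>2"
      by (simp_all add: power2_eq_square algebra_simps)
    show ?thesis
      using koebe_inequalities_pos[OF 1 2 3 4 5 6] unfolding minus_minus a by blast
  qed
  then show "(T x - T w)\<^sup>2 * (D y * (y - w)\<^sup>2) \<le> (T y - T w)\<^sup>2 * (D x * (x - w)\<^sup>2)"
    and "D w * D y * (y - w)\<^sup>2 \<le> (T y - T w)\<^sup>2" by auto
qed

text \<open>The derivative is continuous and has no zero on a convex set, so it has one sign;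
  passing from \<open>T\<close> to \<open>- T\<close> changes neither the Schwarzian nor any of the
  squares.\<close>

lemma koebe_inequalities:
  fixes T D D2 D3 :: "real \<Rightarrow> real"
  assumes S: "convex S"
    and T: "\<And>x. x \<in> S \<Longrightarrow> (T has_real_derivative D x) (at x within S)"
    and D: "\<And>x. x \<in> S \<Longrightarrow> (D has_real_derivative D2 x) (at x within S)"
    and D2: "\<And>x. x \<in> S \<Longrightarrow> (D2 has_real_derivative D3 x) (at x within S)"
    and nz: "\<And>x. x \<in> S \<Longrightarrow> D x \<noteq> 0"
    and schw: "\<And>x. x \<in> S \<Longrightarrow> D3 x / D x - 3 / 2 * (D2 x / D x)\<^sup>2 \<le> 0"
    and w: "w \<in> S" and y: "y \<in> S" and x: "x \<in> closed_segment w y"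
  shows "(T x - T w)\<^sup>2 * (\<bar>D y\<bar> * (y - w)\<^sup>2) \<le> (T y - T w)\<^sup>2 * (\<bar>D x\<bar> * (x - w)\<^sup>2)"
    and "\<bar>D w\<bar> * \<bar>D y\<bar> * (y - w)\<^sup>2 \<le> (T y - T w)\<^sup>2"
proof -
  have xS: "x \<in> S" using closed_segment_subset[OF w y S] x by blast
  have cD: "continuous_on S D" by (rule DERIV_continuous_on[OF D])
  have sgn: "(\<forall>z\<in>S. D z > 0) \<or> (\<forall>z\<in>S. D z < 0)"
  proof (rule ccontr)
    assume "\<not> ?thesis"
    then obtain a b where ab: "a \<in> S" "b \<in> S" "D a \<le> 0" "D b \<ge> 0" by (force simp: not_less)
    have "connected (D ` S)" using connected_continuous_image[OF cD convex_connected[OF S]] .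
    then have "0 \<in> D ` S" using ab by (meson connectedD_interval imageI)
    then show False using nz by auto
  qed
  have "(T x - T w)\<^sup>2 * (\<bar>D y\<bar> * (y - w)\<^sup>2) \<le> (T y - T w)\<^sup>2 * (\<bar>D x\<bar> * (x - w)\<^sup>2) \<and>
    \<bar>D w\<bar> * \<bar>D y\<bar> * (y - w)\<^sup>2 \<le> (T y - T w)\<^sup>2"
    using sgn
  proof
    assume "\<forall>z\<in>S. D z > 0"
    then have p: "\<And>z. z \<in> S \<Longrightarrow> D z > 0" by blast
    show ?thesis using koebe_inequalities_pos'[OF S T D D2 p schw w y x] p[OF w] p[OF xS] p[OF y] by simp
  next
    assume n: "\<forall>z\<in>S. D z < 0"
    then have p: "\<And>z. z \<in> S \<Longrightarrow> - D z > 0" by simp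
    have q: "- D3 z / - D z - 3 / 2 * (- D2 z / - D z)\<^sup>2 \<le> 0" if "z \<in> S" for z
      using schw[OF that] by simp
    have a: "(- T x - - T w)\<^sup>2 = (T x - T w)\<^sup>2" "(- T y - - T w)\<^sup>2 = (T y - T w)\<^sup>2"
      by (simp_all add: power2_eq_square algebra_simps)
    have "\<bar>D z\<bar> = - D z" if "z \<in> S" for z using p[OF that] by simp
    then show ?thesis
      using koebe_inequalities_pos'[OF S DERIV_minus[OF T] DERIV_minus[OF D] DERIV_minus[OF D2] p q w y x] w xS y
      unfolding a by simp
  qed
  then show "(T x - T w)\<^sup>2 * (\<bar>D y\<bar> * (y - w)\<^sup>2) \<le> (T y - T w)\<^sup>2 * (\<bar>D x\<bar> * (x - w)\<^sup>2)"
    and "\<bar>D w\<bar> * \<bar>D y\<bar> * (y - w)\<^sup>2 \<le> (T y - T w)\<^sup>2" by auto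
qed

section \<open>The cone of Koebe functions\<close>

text \<open>For an inverse branch \<open>\<psi>\<close> of a map with non-positive Schwarzian derivative, \<open>\<bar>\<psi>'\<bar>\<close> has this property.
  Unlike concavity of \<open>\<bar>\<psi>'\<bar> powr (- 1 / 2)\<close>, it is visibly stable under sums.\<close>

definition koebe_on :: "real set \<Rightarrow> (real \<Rightarrow> real) \<Rightarrow> bool" where
  "koebe_on I u \<longleftrightarrow> (\<forall>x\<in>I. 0 \<le> u x) \<and>
     (\<forall>w\<in>I. \<forall>y\<in>I. \<forall>x\<in>closed_segment w y. (x - w)\<^sup>2 * u x \<le> (y - w)\<^sup>2 * u y)"

lemma koebe_on_nonneg: "koebe_on I u \<Longrightarrow> x \<in> I \<Longrightarrow> 0 \<le> u x"
  by (simp add: koebe_on_def)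

lemma koebe_onD:
  "koebe_on I u \<Longrightarrow> w \<in> I \<Longrightarrow> y \<in> I \<Longrightarrow> x \<in> closed_segment w y \<Longrightarrow> (x - w)\<^sup>2 * u x \<le> (y - w)\<^sup>2 * u y"
  by (simp add: koebe_on_def)

lemma koebe_on_subset: "koebe_on I u \<Longrightarrow> J \<subseteq> I \<Longrightarrow> koebe_on J u"
  unfolding koebe_on_def by (meson subsetD)

lemma koebe_on_cong:
  assumes I: "convex I" and u: "koebe_on I u" and uv: "\<And>x. x \<in> I \<Longrightarrow> u x = v x"
  shows "koebe_on I v"
  unfolding koebe_on_def
proof (intro conjI ballI)
  fix x assume "x \<in> I"
  then show "0 \<le> v x" using koebe_on_nonneg[OF u, of x] uv[of x] by simp
next
  fix w y x assume a: "w \<in> I" "y \<in> I" "x \<in> closed_segment w y"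
  then have "x \<in> I" using closed_segment_subset[OF a(1,2) I] by blast
  then show "(x - w)\<^sup>2 * v x \<le> (y - w)\<^sup>2 * v y"
    using koebe_onD[OF u a] uv[of x] uv[of y] a(2) by simp
qed

lemma koebe_on_zero: "koebe_on I (\<lambda>x. 0)"
  by (simp add: koebe_on_def)

lemma koebe_on_add: "koebe_on I u \<Longrightarrow> koebe_on I v \<Longrightarrow> koebe_on I (\<lambda>x. u x + v x)"
  unfolding koebe_on_def by (simp add: distrib_left add_mono)

lemma koebe_on_mult:
  assumes "koebe_on I u" "0 \<le> k"
  shows "koebe_on I (\<lambda>x. k * u x)"
proof -
  have "(x - w)\<^sup>2 * (k * u x) \<le> (y - w)\<^sup>2 * (k * u y)"
    if "w \<in> I" "y \<in> I" "x \<in> closed_segment w y" for w x y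
    using mult_left_mono[OF koebe_onD[OF assms(1) that] assms(2)] by (simp add: mult_ac)
  then show ?thesis using assms by (simp add: koebe_on_def)
qed

lemma koebe_on_sum: "(\<And>i. i \<in> A \<Longrightarrow> koebe_on I (u i)) \<Longrightarrow> koebe_on I (\<lambda>x. \<Sum>i\<in>A. u i x)"
  by (induction A rule: infinite_finite_induct) (simp_all add: koebe_on_zero koebe_on_add)

lemma koebe_on_limit:
  assumes "convex I" "\<And>n. koebe_on I (u n)" "\<And>x. x \<in> I \<Longrightarrow> (\<lambda>n. u n x) \<longlonglongrightarrow> v x"
  shows "koebe_on I v"
  unfolding koebe_on_def
proof (intro conjI ballI)
  fix x assume "x \<in> I"
  then show "0 \<le> v x"
    using LIMSEQ_le_const[OF assms(3), of x 0] koebe_on_nonneg[OF assms(2)] by blast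
next
  fix w y x assume a: "w \<in> I" "y \<in> I" "x \<in> closed_segment w y"
  then have "x \<in> I" using closed_segment_subset assms(1) by blast
  show "(x - w)\<^sup>2 * v x \<le> (y - w)\<^sup>2 * v y"
    by (rule LIMSEQ_le[OF tendsto_mult_left[OF assms(3)] tendsto_mult_left[OF assms(3)]])
      (use a \<open>x \<in> I\<close> koebe_onD[OF assms(2)] in auto)
qed

text \<open>The factor \<open>(y - w)\<^sup>2\<close> grows at a definite rate, so a large constant
  outweighs the variation of a Lipschitz function. With distances \<open>a \<le> b \<le> 1\<close>
  from \<open>w\<close>, the threshold \<open>B + L\<close> leaves the surplus
  \<open>L * (b - a) * (b + a - a\<^sup>2) \<ge> 0\<close>. This is how polynomials become
  differences of cone elements.\<close>

lemma koebe_on_add_const: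
  fixes v :: "real \<Rightarrow> real"
  assumes I: "I \<subseteq> {0..1}" and lip: "\<And>x y. x \<in> {0..1} \<Longrightarrow> y \<in> {0..1} \<Longrightarrow> \<bar>v x - v y\<bar> \<le> L * \<bar>x - y\<bar>"
    and bd: "\<And>x. x \<in> {0..1} \<Longrightarrow> \<bar>v x\<bar> \<le> B" and C: "B + L \<le> C" and L: "0 \<le> L"
  shows "koebe_on I (\<lambda>x. C + v x)"
  unfolding koebe_on_def
proof (intro conjI ballI)
  fix x assume "x \<in> I"
  then show "0 \<le> C + v x" using I bd[of x] C L by force
next
  fix w y x assume w: "w \<in> I" and y: "y \<in> I" and x: "x \<in> closed_segment w y"
  define a b where "a = \<bar>x - w\<bar>" and "b = \<bar>y - w\<bar>"
  have wy: "0 \<le> w" "w \<le> 1" "0 \<le> y" "y \<le> 1" using w y I by auto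
  have ab: "0 \<le> a" "a \<le> b" "b \<le> 1" "\<bar>x - y\<bar> = b - a" and x01: "x \<in> {0..1}"
    using x wy by (auto simp: a_def b_def closed_segment_eq_real_ivl split: if_splits)
  have "0 \<le> (b - a) * ((b + a) * L - a\<^sup>2 * L)"
  proof -
    have "a\<^sup>2 * L \<le> a * L" using ab L by (intro mult_right_mono) (auto simp: power2_eq_square mult_left_le)
    moreover have "a * L \<le> (b + a) * L" using ab L by (intro mult_right_mono) auto
    ultimately show ?thesis using ab by (intro mult_nonneg_nonneg) auto
  qed
  also have "\<dots> = (b\<^sup>2 - a\<^sup>2) * L - a\<^sup>2 * (L * (b - a))" by (simp add: algebra_simps power2_eq_square)
  also have "\<dots> \<le> (b\<^sup>2 - a\<^sup>2) * (C + v y) - a\<^sup>2 * (v x - v y)"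
  proof (intro diff_mono mult_left_mono)
    show "L \<le> C + v y" using bd[of y] wy C by auto
    show "v x - v y \<le> L * (b - a)" using lip[of x y] x01 wy ab(4) by auto
    show "0 \<le> b\<^sup>2 - a\<^sup>2" using ab by (simp add: power_mono)
  qed simp
  finally show "(x - w)\<^sup>2 * (C + v x) \<le> (y - w)\<^sup>2 * (C + v y)"
    by (simp add: a_def b_def algebra_simps)
qed

text \<open>A Harnack inequality. The two ends of the interval serve as \<open>w\<close>: seen from
  the end beyond \<open>y\<close>, the point \<open>x\<close> is the farther one; seen from the
  opposite end, \<open>y\<close> is.\<close>

lemma koebe_on_local:
  assumes k: "koebe_on I u" and sub: "{x-\<rho>..x+\<rho>} \<subseteq> I" and y: "\<bar>y - x\<bar> \<le> \<rho>"
  shows "(\<rho> - \<bar>y - x\<bar>)\<^sup>2 * u y \<le> \<rho>\<^sup>2 * u x" "\<rho>\<^sup>2 * u x \<le> (\<rho> + \<bar>y - x\<bar>)\<^sup>2 * u y"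
proof -
  have "{x, y, x - \<rho>, x + \<rho>} \<subseteq> {x-\<rho>..x+\<rho>}" using y by auto
  then have I: "x \<in> I" "y \<in> I" "x - \<rho> \<in> I" "x + \<rho> \<in> I" using sub by auto
  have "(\<rho> - \<bar>y - x\<bar>)\<^sup>2 * u y \<le> \<rho>\<^sup>2 * u x \<and> \<rho>\<^sup>2 * u x \<le> (\<rho> + \<bar>y - x\<bar>)\<^sup>2 * u y"
  proof (cases "x \<le> y")
    case True
    have 1: "(y - (x + \<rho>))\<^sup>2 * u y \<le> (x - (x + \<rho>))\<^sup>2 * u x"
      by (rule koebe_onD[OF k I(4,1)]) (use True y in \<open>auto simp: closed_segment_eq_real_ivl\<close>)
    have 2: "(x - (x - \<rho>))\<^sup>2 * u x \<le> (y - (x - \<rho>))\<^sup>2 * u y"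
      by (rule koebe_onD[OF k I(3,2)]) (use True y in \<open>auto simp: closed_segment_eq_real_ivl\<close>)
    have "(y - (x + \<rho>))\<^sup>2 = (\<rho> - \<bar>y - x\<bar>)\<^sup>2" "(y - (x - \<rho>))\<^sup>2 = (\<rho> + \<bar>y - x\<bar>)\<^sup>2"
      using True by (simp_all add: power2_eq_square algebra_simps)
    then show ?thesis using 1 2 by simp
  next
    case False
    have 1: "(y - (x - \<rho>))\<^sup>2 * u y \<le> (x - (x - \<rho>))\<^sup>2 * u x"
      by (rule koebe_onD[OF k I(3,1)]) (use False y in \<open>auto simp: closed_segment_eq_real_ivl\<close>)
    have 2: "(x - (x + \<rho>))\<^sup>2 * u x \<le> (y - (x + \<rho>))\<^sup>2 * u y"
      by (rule koebe_onD[OF k I(4,2)]) (use False y in \<open>auto simp: closed_segment_eq_real_ivl\<close>)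
    have "(y - (x - \<rho>))\<^sup>2 = (\<rho> - \<bar>y - x\<bar>)\<^sup>2" "(y - (x + \<rho>))\<^sup>2 = (\<rho> + \<bar>y - x\<bar>)\<^sup>2"
      using False by (simp_all add: power2_eq_square algebra_simps)
    then show ?thesis using 1 2 by simp
  qed
  then show "(\<rho> - \<bar>y - x\<bar>)\<^sup>2 * u y \<le> \<rho>\<^sup>2 * u x" "\<rho>\<^sup>2 * u x \<le> (\<rho> + \<bar>y - x\<bar>)\<^sup>2 * u y" by auto
qed

text \<open>A Lipschitz bound relative to the value at the centre. With
  \<open>s = \<bar>y - x\<bar> / \<rho> \<le> 1/2\<close> the Harnack factors give
  \<open>u y \<le> 4 * u x\<close> and \<open>\<bar>u y - u x\<bar> \<le> 4 * s * u y\<close>; the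
  constant 16 is their product.\<close>

lemma koebe_on_local_diff:
  assumes k: "koebe_on I u" and sub: "{x-\<rho>..x+\<rho>} \<subseteq> I" and \<rho>: "0 < \<rho>" and y: "\<bar>y - x\<bar> \<le> \<rho> / 2"
  shows "\<bar>u y - u x\<bar> \<le> 16 * (\<bar>y - x\<bar> / \<rho>) * u x"
proof -
  define s where "s = \<bar>y - x\<bar> / \<rho>"
  have s: "0 \<le> s" "s \<le> 1/2" and ys: "\<bar>y - x\<bar> = \<rho> * s" using \<rho> y by (auto simp: s_def field_simps)
  have "\<bar>y - x\<bar> \<le> \<rho>" using y \<rho> by linarith
  then have "{x, y} \<subseteq> {x-\<rho>..x+\<rho>}" using \<rho> by auto
  then have yI: "y \<in> I" and xI: "x \<in> I" using sub by auto
  have u0: "0 \<le> u x" "0 \<le> u y" using koebe_on_nonneg[OF k] xI yI by auto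
  have 1: "(1 - s)\<^sup>2 * u y \<le> u x"
  proof -
    have "(\<rho> - \<rho> * s)\<^sup>2 * u y \<le> \<rho>\<^sup>2 * u x"
      using koebe_on_local(1)[OF k sub, of y] y \<rho> ys by simp
    also have "\<rho> - \<rho> * s = \<rho> * (1 - s)" by (simp add: algebra_simps)
    finally show ?thesis using \<rho> by (simp add: power_mult_distrib mult.assoc)
  qed
  have 2: "u x \<le> (1 + s)\<^sup>2 * u y"
  proof -
    have "\<rho>\<^sup>2 * u x \<le> (\<rho> + \<rho> * s)\<^sup>2 * u y"
      using koebe_on_local(2)[OF k sub, of y] y \<rho> ys by simp
    also have "\<rho> + \<rho> * s = \<rho> * (1 + s)" by (simp add: algebra_simps)
    finally show ?thesis using \<rho> by (simp add: power_mult_distrib mult.assoc)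
  qed
  have 3: "u y \<le> 4 * u x"
  proof -
    have "(1/2)\<^sup>2 * u y \<le> (1 - s)\<^sup>2 * u y" using s u0 by (intro mult_right_mono power_mono) auto
    then show ?thesis using 1 by (simp add: power2_eq_square)
  qed
  have "u y - u x \<le> 4 * s * u y"
  proof -
    have "(1 - 4 * s) * u y \<le> (1 - s)\<^sup>2 * u y"
      using s u0 by (intro mult_right_mono) (auto simp: power2_eq_square algebra_simps)
    then show ?thesis using 1 by (simp add: algebra_simps)
  qed
  moreover have "u x - u y \<le> 4 * s * u y"
  proof -
    have "s * s \<le> s" using s by (simp add: mult_left_le)
    then have "(1 + s)\<^sup>2 * u y \<le> (1 + 4 * s) * u y"
      using s u0 by (intro mult_right_mono) (auto simp: power2_eq_square algebra_simps)
    then show ?thesis using 2 by (simp add: algebra_simps)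
  qed
  moreover have "4 * s * u y \<le> 16 * s * u x" using mult_left_mono[OF 3, of "4 * s"] s by simp
  ultimately show ?thesis unfolding s_def by (simp add: abs_le_iff)
qed

lemma open_contains_symmetric_interval:
  fixes x :: real
  assumes "open I" "x \<in> I"
  obtains \<rho> where "\<rho> > 0" "{x-\<rho>..x+\<rho>} \<subseteq> I"
  using assms by (auto simp: open_contains_cball cball_eq_atLeastAtMost)

lemma koebe_on_continuous:
  assumes k: "koebe_on I u" and I: "open I"
  shows "continuous_on I u"
proof -
  have "isCont u x" if x: "x \<in> I" for x
  proof -
    obtain \<rho> where \<rho>: "\<rho> > 0" "{x-\<rho>..x+\<rho>} \<subseteq> I" using open_contains_symmetric_interval[OF I x] .
    have "((\<lambda>y. u y - u x) \<longlongrightarrow> 0) (at x)"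
    proof (rule Lim_null_comparison)
      show "\<forall>\<^sub>F y in at x. norm (u y - u x) \<le> 16 * (\<bar>y - x\<bar> / \<rho>) * u x"
        unfolding eventually_at using koebe_on_local_diff[OF k \<rho>(2,1)] \<rho>(1)
        by (intro exI[of _ "\<rho> / 2"]) (auto simp: dist_real_def)
      show "((\<lambda>y. 16 * (\<bar>y - x\<bar> / \<rho>) * u x) \<longlongrightarrow> 0) (at x)"
        by (rule tendsto_eq_intros refl | use \<rho>(1) in simp)+
    qed
    then show ?thesis by (simp add: isCont_def LIM_zero_iff)
  qed
  then show ?thesis by (simp add: continuous_at_imp_continuous_on)
qed

text \<open>As the interval is open, there is a \<open>w\<close> in it beyond \<open>x\<close> as
  seen from \<open>y\<close>; growth away from this \<open>w\<close> carries positivity from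
  \<open>x\<close> to \<open>y\<close>.\<close>

lemma koebe_on_pos:
  assumes k: "koebe_on {a<..<b} u" and x: "x \<in> {a<..<b}" "u x > 0" and y: "y \<in> {a<..<b}"
  shows "u y > 0"
proof -
  obtain w where w: "w \<in> {a<..<b}" "x \<in> closed_segment w y" "w \<noteq> x"
  proof (cases "x \<le> y")
    case True
    then show ?thesis using x by (intro that[of "(a + x) / 2"]) (auto simp: closed_segment_eq_real_ivl)
  next
    case False
    then show ?thesis using x by (intro that[of "(x + b) / 2"]) (auto simp: closed_segment_eq_real_ivl)
  qed
  have "0 < (x - w)\<^sup>2 * u x" using w x by simp
  also have "\<dots> \<le> (y - w)\<^sup>2 * u y" by (rule koebe_onD[OF k w(1) y w(2)])
  finally show ?thesis by (metis zero_less_mult_pos zero_le_power2 mult_zero_left less_irrefl order_le_less)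
qed

section \<open>Transfer of densities along a single branch\<close>

lemma thrice_differentiable_on01_derivs:
  assumes d: "thrice_differentiable_on01 T S" and S: "S \<subseteq> {0..1}" and x: "x \<in> S"
  shows "(T has_real_derivative D01 T x) (at x within S)"
    and "(D01 T has_real_derivative (D01 ^^ 2) T x) (at x within S)"
    and "((D01 ^^ 2) T has_real_derivative (D01 ^^ 3) T x) (at x within S)"
proof -
  have *: "((D01 ^^ i) T has_real_derivative (D01 ^^ Suc i) T x) (at x within S)" if "i < 3" for i
  proof -
    have "(D01 ^^ i) T differentiable (at x within {0..1})"
      using d x that by (auto simp: thrice_differentiable_on01_def)
    then have "((D01 ^^ i) T has_vector_derivative (D01 ^^ Suc i) T x) (at x within {0..1})"
      by (simp add: vector_derivative_works D01_def[abs_def])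
    then show ?thesis
      by (meson DERIV_subset S has_real_derivative_iff_has_vector_derivative)
  qed
  show "(T has_real_derivative D01 T x) (at x within S)" using *[of 0] by simp
  show "(D01 T has_real_derivative (D01 ^^ 2) T x) (at x within S)"
    using *[of 1] by (simp add: eval_nat_numeral)
  show "((D01 ^^ 2) T has_real_derivative (D01 ^^ 3) T x) (at x within S)"
    using *[of 2] by (simp add: eval_nat_numeral)
qed

lemma nonpos_schwarzian_on_derivs:
  assumes d: "nonpos_schwarzian_on T S" and S: "S \<subseteq> {0..1}"
  shows "\<And>x. x \<in> S \<Longrightarrow> (T has_real_derivative D01 T x) (at x within S)"
    and "continuous_on S (D01 T)" and "\<And>x. x \<in> S \<Longrightarrow> D01 T x \<noteq> 0" and "continuous_on S T"
proof -
  note * = thrice_differentiable_on01_derivs[OF _ S]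
  show 1: "\<And>x. x \<in> S \<Longrightarrow> (T has_real_derivative D01 T x) (at x within S)"
    and "\<And>x. x \<in> S \<Longrightarrow> D01 T x \<noteq> 0"
    using * d by (auto simp: nonpos_schwarzian_on_def)
  show "continuous_on S (D01 T)"
    by (rule DERIV_continuous_on[OF *(2)]) (use d in \<open>auto simp: nonpos_schwarzian_on_def\<close>)
  show "continuous_on S T" by (rule DERIV_continuous_on[OF 1])
qed

lemma nonpos_schwarzian_on_subset: "nonpos_schwarzian_on T S \<Longrightarrow> S' \<subseteq> S \<Longrightarrow> nonpos_schwarzian_on T S'"
  unfolding nonpos_schwarzian_on_def thrice_differentiable_on01_def by blast

lemma nonpos_schwarzian_on_koebe:
  assumes d: "nonpos_schwarzian_on T S" and S: "S \<subseteq> {0..1}" "convex S"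
    and w: "w \<in> S" and y: "y \<in> S" and x: "x \<in> closed_segment w y"
  shows "(T x - T w)\<^sup>2 * (\<bar>D01 T y\<bar> * (y - w)\<^sup>2) \<le> (T y - T w)\<^sup>2 * (\<bar>D01 T x\<bar> * (x - w)\<^sup>2)"
    and "\<bar>D01 T w\<bar> * \<bar>D01 T y\<bar> * (y - w)\<^sup>2 \<le> (T y - T w)\<^sup>2"
proof -
  have t: "thrice_differentiable_on01 T S" and nz: "\<And>x. x \<in> S \<Longrightarrow> D01 T x \<noteq> 0"
    and s: "\<And>x. x \<in> S \<Longrightarrow> (D01 ^^ 3) T x / D01 T x - 3 / 2 * ((D01 ^^ 2) T x / D01 T x)\<^sup>2 \<le> 0"
    using d by (auto simp: nonpos_schwarzian_on_def schwarzian_def)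
  note * = thrice_differentiable_on01_derivs[OF t S(1)]
  show "(T x - T w)\<^sup>2 * (\<bar>D01 T y\<bar> * (y - w)\<^sup>2) \<le> (T y - T w)\<^sup>2 * (\<bar>D01 T x\<bar> * (x - w)\<^sup>2)"
    by (rule koebe_inequalities(1)[OF S(2) *(1) *(2) *(3) nz s w y x])
  show "\<bar>D01 T w\<bar> * \<bar>D01 T y\<bar> * (y - w)\<^sup>2 \<le> (T y - T w)\<^sup>2"
    by (rule koebe_inequalities(2)[OF S(2) *(1) *(2) *(3) nz s w y x])
qed

text \<open>One summand of the Perron-Frobenius operator: the density of the image, under the branch
  of \<open>T\<close> on \<open>I\<close>, of the measure on \<open>I\<close> with density
  \<open>u\<close>.\<close>

definition branch_transfer :: "(real \<Rightarrow> real) \<Rightarrow> real set \<Rightarrow> (real \<Rightarrow> real) \<Rightarrow> real \<Rightarrow> real" where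
  "branch_transfer T I u z =
     (if z \<in> T ` I then u (the_inv_into I T z) / \<bar>D01 T (the_inv_into I T z)\<bar> else 0)"

lemma branch_transfer_image [simp]:
  "inj_on T I \<Longrightarrow> y \<in> I \<Longrightarrow> branch_transfer T I u (T y) = u y / \<bar>D01 T y\<bar>"
  by (simp add: branch_transfer_def the_inv_into_f_f)

lemma branch_transfer_outside: "z \<notin> T ` I \<Longrightarrow> branch_transfer T I u z = 0"
  by (simp add: branch_transfer_def)

lemma branch_transfer_nonneg:
  "inj_on T I \<Longrightarrow> (\<And>y. y \<in> I \<Longrightarrow> 0 \<le> u y) \<Longrightarrow> 0 \<le> branch_transfer T I u z"
  by (cases "z \<in> T ` I") (auto simp: branch_transfer_outside)

text \<open>Along the branch \<open>(y - w)\<^sup>2 * u y\<close> grows because \<open>u\<close> is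
  Koebe, and \<open>(T y - T w)\<^sup>2 / (\<bar>D01 T y\<bar> * (y - w)\<^sup>2)\<close> grows
  because of the Schwarzian. The product of the two is exactly the quantity that must grow for the
  transferred function.\<close>

lemma koebe_on_branch_transfer:
  assumes d: "nonpos_schwarzian_on T I" and I: "I \<subseteq> {0..1}" "convex I" and inj: "inj_on T I"
    and u: "koebe_on I u"
  shows "koebe_on (T ` I) (branch_transfer T I u)"
  unfolding koebe_on_def
proof (intro conjI ballI)
  fix z assume "z \<in> T ` I"
  show "0 \<le> branch_transfer T I u z"
    by (rule branch_transfer_nonneg[OF inj koebe_on_nonneg[OF u]])
next
  fix w' y' x' assume "w' \<in> T ` I" "y' \<in> T ` I" and x': "x' \<in> closed_segment w' y'"
  then obtain w y where w: "w \<in> I" "w' = T w" and y: "y \<in> I" "y' = T y" by auto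
  have sub: "closed_segment w y \<subseteq> I" using closed_segment_subset[OF w(1) y(1) I(2)] .
  have cont: "continuous_on (closed_segment w y) T"
    using nonpos_schwarzian_on_derivs(4)[OF d I(1)] sub by (rule continuous_on_subset)
  have "connected (T ` closed_segment w y)" using connected_continuous_image[OF cont] by simp
  then have "closed_segment (T w) (T y) \<subseteq> T ` closed_segment w y"
    by (intro closed_segment_subset) (auto simp: connected_convex_1)
  then obtain x where x: "x \<in> closed_segment w y" "x' = T x" using x' w y by auto
  have xI: "x \<in> I" using x sub by auto
  have D: "D01 T x \<noteq> 0" "D01 T y \<noteq> 0" using nonpos_schwarzian_on_derivs(3)[OF d I(1)] xI y(1) by auto
  have 1: "(T x - T w)\<^sup>2 * (\<bar>D01 T y\<bar> * (y - w)\<^sup>2) \<le> (T y - T w)\<^sup>2 * (\<bar>D01 T x\<bar> * (x - w)\<^sup>2)"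
    by (rule nonpos_schwarzian_on_koebe(1)[OF d I w(1) y(1) x(1)])
  have 2: "(x - w)\<^sup>2 * u x \<le> (y - w)\<^sup>2 * u y" by (rule koebe_onD[OF u w(1) y(1) x(1)])
  have u0: "0 \<le> u x" "0 \<le> u y" using koebe_on_nonneg[OF u] xI y(1) by auto
  have "(T x - T w)\<^sup>2 * (u x / \<bar>D01 T x\<bar>) \<le> (T y - T w)\<^sup>2 * (u y / \<bar>D01 T y\<bar>)"
  \<comment> \<open>For \<open>x = w\<close> the left side vanishes; otherwise the common factor
    \<open>(y - w)\<^sup>2 * (x - w)\<^sup>2\<close> of the multiplied inequalities can be
    cancelled.\<close>
  proof (cases "x = w")
    case True
    then show ?thesis using u0 by simp
  next
    case False
    then have yw: "(y - w)\<^sup>2 > 0" and xw: "(x - w)\<^sup>2 > 0" using x(1) by auto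
    have "((T x - T w)\<^sup>2 * (\<bar>D01 T y\<bar> * (y - w)\<^sup>2)) * ((x - w)\<^sup>2 * u x)
        \<le> ((T y - T w)\<^sup>2 * (\<bar>D01 T x\<bar> * (x - w)\<^sup>2)) * ((y - w)\<^sup>2 * u y)"
      by (rule mult_mono[OF 1 2]) (use u0 in auto)
    then have "((y - w)\<^sup>2 * (x - w)\<^sup>2) * ((T x - T w)\<^sup>2 * u x * \<bar>D01 T y\<bar>)
        \<le> ((y - w)\<^sup>2 * (x - w)\<^sup>2) * ((T y - T w)\<^sup>2 * u y * \<bar>D01 T x\<bar>)"
      by (simp only: mult_ac)
    then have "(T x - T w)\<^sup>2 * u x * \<bar>D01 T y\<bar> \<le> (T y - T w)\<^sup>2 * u y * \<bar>D01 T x\<bar>"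
      using yw xw by (metis mult_le_cancel_left_pos mult_pos_pos)
    then show ?thesis using D by (simp add: divide_simps)
  qed
  then show "(x' - w')\<^sup>2 * branch_transfer T I u x' \<le> (y' - w')\<^sup>2 * branch_transfer T I u y'"
    using w y x xI inj by simp
qed

lemma continuous_on_branch_transfer:
  assumes d: "nonpos_schwarzian_on T I" and I: "I \<subseteq> {0..1}" "open I" and inj: "inj_on T I"
    and u: "continuous_on I u"
  shows "open (T ` I)" "continuous_on (T ` I) (branch_transfer T I u)"
proof -
  note D = nonpos_schwarzian_on_derivs[OF d I(1)]
  show "open (T ` I)" by (rule invariance_of_domain_gen[OF I(2) D(4) inj]) simp
  have "continuous_on (T ` I) (the_inv_into I T)"
    by (rule continuous_on_inverse_open[OF I(2) D(4)]) (auto simp: inj the_inv_into_f_f)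
  moreover have "the_inv_into I T z \<in> I" if "z \<in> T ` I" for z
    using the_inv_into_into[OF inj that] by simp
  ultimately have "continuous_on (T ` I) (\<lambda>z. u (the_inv_into I T z) / \<bar>D01 T (the_inv_into I T z)\<bar>)"
    using D(2,3) u
    by (intro continuous_intros continuous_on_compose2[OF u] continuous_on_compose2[OF D(2)]) auto
  then show "continuous_on (T ` I) (branch_transfer T I u)"
    by (rule continuous_on_eq) (simp add: branch_transfer_def)
qed

text \<open>The change of variables formula for absolutely integrable functions, carried over to
  nonnegative functions whose integral may be infinite: one side has the finite value
  \<open>r\<close> iff the other has it, and if neither is finite both are \<open>top\<close>.
  Extension by zero makes \<open>F\<close> and \<open>G\<close> Borel on the whole line.\<close>

lemma nn_integral_branch_transfer:
  assumes d: "nonpos_schwarzian_on T I" and I: "I \<subseteq> {0..1}" "open I" and inj: "inj_on T I"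
    and u: "continuous_on I u" "\<And>y. y \<in> I \<Longrightarrow> 0 \<le> u y"
    and h: "h \<in> borel_measurable borel" "\<And>z. 0 \<le> h z"
  shows "(\<integral>\<^sup>+z. ennreal (h z * branch_transfer T I u z) * indicator (T ` I) z \<partial>lborel)
       = (\<integral>\<^sup>+y. ennreal (h (T y) * u y) * indicator I y \<partial>lborel)" (is "?L = ?R")
proof -
  note D = nonpos_schwarzian_on_derivs[OF d I(1)]
  note O = continuous_on_branch_transfer[OF d I inj u(1)]
  define F where "F z = indicator (T ` I) z *\<^sub>R (h z * branch_transfer T I u z)" for z
  define G where "G y = indicator I y *\<^sub>R (h (T y) * u y)" for y
  have F0: "F z \<ge> 0" for z
    unfolding F_def using h(2) branch_transfer_nonneg[OF inj u(2)] by simp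
  have G0: "G z \<ge> 0" for z
    unfolding G_def using h(2) u(2) by (auto simp: indicator_def)
  have mF: "F \<in> borel_measurable borel"
  proof -
    have "(\<lambda>z. indicator (T ` I) z *\<^sub>R branch_transfer T I u z) \<in> borel_measurable borel"
      using borel_measurable_continuous_on_indicator[OF _ O(2)] O(1) by auto
    then have "(\<lambda>z. h z * (indicator (T ` I) z *\<^sub>R branch_transfer T I u z)) \<in> borel_measurable borel"
      using h by measurable
    then show ?thesis by (simp add: F_def[abs_def] mult_ac)
  qed
  have mG: "G \<in> borel_measurable borel"
  proof -
    have "(\<lambda>z. indicator I z *\<^sub>R T z) \<in> borel_measurable borel" "(\<lambda>z. indicator I z *\<^sub>R u z) \<in> borel_measurable borel"
      using borel_measurable_continuous_on_indicator[OF _ D(4)] borel_measurable_continuous_on_indicator[OF _ u(1)] I(2)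
      by auto
    then have "(\<lambda>z. h (indicator I z *\<^sub>R T z) * (indicator I z *\<^sub>R u z)) \<in> borel_measurable borel"
      using h by measurable
    moreover have "G z = h (indicator I z *\<^sub>R T z) * (indicator I z *\<^sub>R u z)" for z
      by (simp add: G_def indicator_def)
    ultimately show ?thesis by presburger
  qed
  have L: "?L = (\<integral>\<^sup>+z. ennreal (F z) \<partial>lborel)" and R: "?R = (\<integral>\<^sup>+z. ennreal (G z) \<partial>lborel)"
    unfolding F_def G_def by (auto intro!: nn_integral_cong simp: indicator_def)
  have FG: "\<bar>D01 T y\<bar> * F (T y) = G y" if "y \<in> I" for y
    using that D(3)[OF that] inj by (simp add: F_def G_def)
  have cov: "G absolutely_integrable_on I \<and> integral I G = b \<longleftrightarrow>
      F absolutely_integrable_on (T ` I) \<and> integral (T ` I) F = b" for b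
  proof -
    have "(\<lambda>x. \<bar>D01 T x\<bar> * F (T x)) absolutely_integrable_on I \<longleftrightarrow> G absolutely_integrable_on I"
      by (rule absolutely_integrable_spike_eq[of "{}"]) (simp_all add: FG)
    moreover have "integral I (\<lambda>x. \<bar>D01 T x\<bar> * F (T x)) = integral I G"
      by (rule integral_cong) (simp add: FG)
    ultimately show ?thesis
      using has_absolute_integral_change_of_variables_1'[OF _ D(1) inj, of F b] I(2) by simp
  qed
  have ai: "f absolutely_integrable_on S \<and> integral S f = r"
    if "f \<in> borel_measurable borel" "\<And>z. 0 \<le> f z" "\<And>z. z \<notin> S \<Longrightarrow> f z = 0" "(\<integral>\<^sup>+z. ennreal (f z) \<partial>lborel) = ennreal r" "0 \<le> r"
    for f :: "real \<Rightarrow> real" and S r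
  proof -
    have "(f has_integral r) UNIV" using that by (intro nn_integral_has_integral) auto
    moreover have "(\<lambda>x. if x \<in> S then f x else 0) = f" using that(3) by auto
    ultimately have "(f has_integral r) S"
      using has_integral_restrict_UNIV[of S f r] by simp
    then show ?thesis using that(2) by (auto intro!: nonnegative_absolutely_integrable_1)
  qed
  have nn: "(\<integral>\<^sup>+z. ennreal (f z) \<partial>lborel) = ennreal r"
    if "\<And>z. 0 \<le> f z" "\<And>z. z \<notin> S \<Longrightarrow> f z = 0" "f absolutely_integrable_on S" "integral S f = r"
    for f :: "real \<Rightarrow> real" and S r
  proof -
    have "(f has_integral r) S" using that(3,4) set_lebesgue_integral_eq_integral(1) by blast
    then have "integral\<^sup>N lborel (\<lambda>x. ennreal (f x) * indicator S x) = ennreal r"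
      by (intro nn_integral_has_integral_lebesgue' that)
    moreover have "ennreal (f x) * indicator S x = ennreal (f x)" for x
      using that(2) by (auto simp: indicator_def)
    ultimately show ?thesis by simp
  qed
  have F': "F z = 0" if "z \<notin> T ` I" for z using that by (simp add: F_def)
  have G': "G z = 0" if "z \<notin> I" for z using that by (simp add: G_def)
  have iff: "(\<integral>\<^sup>+z. ennreal (F z) \<partial>lborel) = ennreal r \<longleftrightarrow> (\<integral>\<^sup>+z. ennreal (G z) \<partial>lborel) = ennreal r" if r: "0 \<le> r" for r
  proof
    assume "(\<integral>\<^sup>+z. ennreal (F z) \<partial>lborel) = ennreal r"
    from ai[OF mF F0 F' this r] have "G absolutely_integrable_on I" "integral I G = r"
      using cov[of r] by auto
    then show "(\<integral>\<^sup>+z. ennreal (G z) \<partial>lborel) = ennreal r" by (intro nn[OF G0 G'])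
  next
    assume "(\<integral>\<^sup>+z. ennreal (G z) \<partial>lborel) = ennreal r"
    from ai[OF mG G0 G' this r] have "F absolutely_integrable_on (T ` I)" "integral (T ` I) F = r"
      using cov[of r] by auto
    then show "(\<integral>\<^sup>+z. ennreal (F z) \<partial>lborel) = ennreal r" by (intro nn[OF F0 F'])
  qed
  show ?thesis
  proof (cases "(\<integral>\<^sup>+z. ennreal (F z) \<partial>lborel)")
    case (real r)
    then show ?thesis unfolding L R using iff[of r] by simp
  next
    case top
    show ?thesis
    proof (cases "(\<integral>\<^sup>+z. ennreal (G z) \<partial>lborel)")
      case (real r)
      then show ?thesis unfolding L R using iff[of r] by simp
    qed (simp add: L R top)
  qed
qed

section \<open>Compactness of the cone\<close>

locale punctured_interval =
  fixes c :: real
  assumes c_pos: "0 < c" and c_less: "c < 1"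
begin

definition X :: "real set" where "X = {0<..<1} - {c}"

definition sides :: "real set set" where "sides = {{0<..<c}, {c<..<1}}"

definition lebX :: "real measure" where "lebX = restrict_space lborel X"

text \<open>The Koebe property is imposed on each side of \<open>c\<close> separately: a branch of a
  bad map transfers a density to one side only, and a fixed density may be singular at
  \<open>c\<close>.\<close>

definition cone :: "(real \<Rightarrow> real) \<Rightarrow> bool" where
  "cone u \<longleftrightarrow> (\<forall>I\<in>sides. koebe_on I u)"

lemma sides_X: "I \<in> sides \<Longrightarrow> I \<subseteq> X" and Union_sides: "\<Union>sides = X"
  and side_open: "I \<in> sides \<Longrightarrow> open I" and side_convex: "I \<in> sides \<Longrightarrow> convex I"
  and side_01: "I \<in> sides \<Longrightarrow> I \<subseteq> {0..1}" and finite_sides [simp]: "finite sides"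
  using c_pos c_less by (auto simp: sides_def X_def)

lemma X_side: "x \<in> X \<Longrightarrow> \<exists>I\<in>sides. x \<in> I"
  using Union_sides by blast

lemma open_X [simp]: "open X"
  unfolding X_def by (intro open_Diff) auto

lemma X_borel [simp, measurable]: "X \<in> sets borel"
  by simp

lemma space_lebX [simp]: "space lebX = X"
  by (simp add: lebX_def space_restrict_space)

lemma sets_lebX [simp, measurable_cong]: "sets lebX = sets (restrict_space borel X)"
  unfolding lebX_def by (intro sets_restrict_space_cong) simp

lemma emeasure_lebX: "A \<in> sets borel \<Longrightarrow> A \<subseteq> X \<Longrightarrow> emeasure lebX A = emeasure lborel A"
  unfolding lebX_def by (subst emeasure_restrict_space) auto

lemma emeasure_lebX_X: "emeasure lebX X = 1"
proof -
  have "emeasure lborel X = emeasure lborel {0<..<1::real}"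
    unfolding X_def by (rule emeasure_Diff_null_set) auto
  then show ?thesis using emeasure_lebX[OF X_borel order_refl] by simp
qed

lemma nn_integral_lebX:
  "(\<integral>\<^sup>+x. f x \<partial>lebX) = (\<integral>\<^sup>+x. f x * indicator X x \<partial>lborel)"
  unfolding lebX_def by (rule nn_integral_restrict_space) simp

lemma measurable_lebX_continuous: "continuous_on X f \<Longrightarrow> (f :: real \<Rightarrow> real) \<in> borel_measurable lebX"
  by (subst measurable_cong_sets[OF sets_lebX refl]) (rule borel_measurable_continuous_on_restrict)

lemma measurable_lebX_borel: "f \<in> borel_measurable borel \<Longrightarrow> f \<in> borel_measurable lebX"
  by (subst measurable_cong_sets[OF sets_lebX refl]) (rule measurable_restrict_space1)

lemma cone_nonneg: "cone u \<Longrightarrow> x \<in> X \<Longrightarrow> 0 \<le> u x"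
  using X_side koebe_on_nonneg unfolding cone_def by blast

lemma cone_continuous: "cone u \<Longrightarrow> continuous_on X u"
  unfolding Union_sides[symmetric]
  by (intro continuous_on_open_Union side_open koebe_on_continuous) (auto simp: cone_def)

lemma cone_measurable: "cone u \<Longrightarrow> u \<in> borel_measurable lebX"
  by (intro measurable_lebX_continuous cone_continuous)

lemma cone_mult: "cone u \<Longrightarrow> 0 \<le> k \<Longrightarrow> cone (\<lambda>x. k * u x)"
  by (simp add: cone_def koebe_on_mult)

lemma cone_sum: "(\<And>i. i \<in> A \<Longrightarrow> cone (u i)) \<Longrightarrow> cone (\<lambda>x. \<Sum>i\<in>A. u i x)"
  by (simp add: cone_def koebe_on_sum)

lemma cone_limit:
  "(\<And>n. cone (u n)) \<Longrightarrow> (\<And>x. x \<in> X \<Longrightarrow> (\<lambda>n. u n x) \<longlonglongrightarrow> v x) \<Longrightarrow> cone v"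
  unfolding cone_def using koebe_on_limit[OF side_convex] sides_X by blast

text \<open>By the Harnack inequality \<open>u\<close> is at least \<open>u x / 4\<close> on
  \<open>{x..x+\<rho>}\<close>, a set of measure \<rho>. The interval \<open>I\<close> is allowed to
  contain \<open>c\<close>, since a full branch of a good map produces Koebe functions on all of
  \<open>{0<..<1}\<close>.\<close>

lemma koebe_on_integral_bound:
  assumes k: "koebe_on I u" and sub: "{x-\<rho>..x+\<rho>} \<subseteq> I" and \<rho>: "0 < \<rho>" and I: "I \<subseteq> {0<..<1}"
  shows "ennreal (\<rho> * u x) \<le> 4 * (\<integral>\<^sup>+y. ennreal (u y) \<partial>lebX)"
proof -
  have u0: "0 \<le> u x" by (rule koebe_on_nonneg[OF k]) (use sub \<rho> in auto)
  have lb: "u x \<le> 4 * u y" if "y \<in> {x..x+\<rho>}" for y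
  proof -
    have yI: "y \<in> I" using that sub \<rho> by auto
    have "\<rho>\<^sup>2 * u x \<le> (\<rho> + \<bar>y - x\<bar>)\<^sup>2 * u y"
      by (rule koebe_on_local(2)[OF k sub]) (use that in auto)
    also have "\<dots> \<le> (2 * \<rho>)\<^sup>2 * u y"
      using that \<rho> koebe_on_nonneg[OF k yI] by (intro mult_right_mono power_mono) auto
    finally show ?thesis using \<rho> by (simp add: power_mult_distrib mult_ac)
  qed
  have "{x..x+\<rho>} \<subseteq> {x-\<rho>..x+\<rho>}" using \<rho> by auto
  then have A: "{x..x+\<rho>} - {c} \<subseteq> X" using sub I unfolding X_def by blast
  have "emeasure lborel ({x..x+\<rho>} - {c}) = emeasure lborel {x..x+\<rho>}"
    by (rule emeasure_Diff_null_set) auto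
  then have e: "emeasure lebX ({x..x+\<rho>} - {c}) = ennreal \<rho>"
    using \<rho> by (subst emeasure_lebX[OF _ A]) auto
  have "ennreal (\<rho> * u x / 4) = ennreal (u x / 4) * emeasure lebX ({x..x+\<rho>} - {c})"
    unfolding e using u0 \<rho> by (simp flip: ennreal_mult add: mult.commute)
  also have "\<dots> = (\<integral>\<^sup>+y. ennreal (u x / 4) * indicator ({x..x+\<rho>} - {c}) y \<partial>lebX)"
    using A by (intro nn_integral_cmult_indicator[symmetric]) (auto simp: sets_restrict_space_iff)
  also have "\<dots> \<le> (\<integral>\<^sup>+y. ennreal (u y) \<partial>lebX)"
  proof (rule nn_integral_mono)
    fix y
    show "ennreal (u x / 4) * indicator ({x..x+\<rho>} - {c}) y \<le> ennreal (u y)"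
      using lb[of y] by (auto simp: indicator_def intro!: ennreal_leI)
  qed
  finally have "4 * ennreal (\<rho> * u x / 4) \<le> 4 * (\<integral>\<^sup>+y. ennreal (u y) \<partial>lebX)"
    by (rule mult_left_mono) simp
  moreover have "4 * ennreal (\<rho> * u x / 4) = ennreal (\<rho> * u x)"
    using u0 \<rho> by (subst ennreal_numeral[symmetric], subst ennreal_mult[symmetric]) auto
  ultimately show ?thesis by simp
qed

lemma cone_bound:
  assumes "cone u" "I \<in> sides" "{x-\<rho>..x+\<rho>} \<subseteq> I" "0 < \<rho>" "(\<integral>\<^sup>+y. ennreal (u y) \<partial>lebX) \<le> ennreal m" "0 \<le> m"
  shows "u x \<le> 4 * m / \<rho>"
proof -
  have "ennreal (\<rho> * u x) \<le> 4 * (\<integral>\<^sup>+y. ennreal (u y) \<partial>lebX)"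
    by (rule koebe_on_integral_bound[of I]) (use assms sides_X in \<open>auto simp: cone_def X_def\<close>)
  also have "\<dots> \<le> 4 * ennreal m" using assms by (intro mult_left_mono) auto
  also have "\<dots> = ennreal (4 * m)" using assms by (simp add: ennreal_mult')
  finally have "\<rho> * u x \<le> 4 * m" using assms by (subst (asm) ennreal_le_iff) auto
  then show ?thesis using assms by (simp add: field_simps)
qed

lemma side_neighbourhood:
  assumes "x \<in> X"
  obtains I \<rho> where "I \<in> sides" "\<rho> > 0" "{x-\<rho>..x+\<rho>} \<subseteq> I"
  using X_side[OF assms] open_contains_symmetric_interval[OF side_open] by metis

text \<open>An Arzela-Ascoli argument: a diagonal sequence converges at the rational points of
  \<open>X\<close>, and the relative Lipschitz bound, uniform in \<open>n\<close> once the values at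
  \<open>x\<close> are bounded, extends convergence to every point.\<close>

lemma cone_pointwise_subsequence:
  assumes cone: "\<And>n. cone (u n)" and bdd: "\<And>x. x \<in> X \<Longrightarrow> \<exists>B. \<forall>n. u n x \<le> B"
  obtains r v where "strict_mono (r :: nat \<Rightarrow> nat)" "cone v" "\<And>x. x \<in> X \<Longrightarrow> (\<lambda>n. u (r n) x) \<longlonglongrightarrow> v x"
proof -
  define Q where "Q = \<rat> \<inter> X"
  have cQ: "countable Q" unfolding Q_def using countable_rat by auto
  have dense: "\<exists>q\<in>Q. x < q \<and> q < x + \<delta>" if x: "x \<in> X" and d: "0 < \<delta>" for x \<delta> :: real
  proof -
    obtain I \<rho> where I: "I \<in> sides" "\<rho> > 0" "{x-\<rho>..x+\<rho>} \<subseteq> I" using side_neighbourhood[OF x] .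
    obtain q where q: "q \<in> \<rat>" "x < q" "q < x + min \<delta> \<rho>"
      using Rats_dense_in_real[of x "x + min \<delta> \<rho>"] d I by auto
    moreover have "q \<in> {x-\<rho>..x+\<rho>}" using q I(2) by auto
    then have "q \<in> X" using I sides_X by blast
    ultimately show ?thesis by (auto simp: Q_def)
  qed
  have "c / 2 \<in> X" using c_pos c_less by (auto simp: X_def)
  then have Qne: "Q \<noteq> {}" using dense[of "c/2" 1] by auto
  define q where "q = from_nat_into Q"
  have q: "q n \<in> Q" "q n \<in> X" for n using from_nat_into[OF Qne] by (auto simp: q_def Q_def)
  define P where "P = (\<lambda>n s. convergent (\<lambda>k. u (s k) (q n)))"
  interpret subseqs P
  proof
    fix n and s :: "nat \<Rightarrow> nat" assume "strict_mono s"
    obtain B where B: "\<And>k. u k (q n) \<le> B" using bdd[OF q(2)[of n]] by blast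
    have "bounded (range (\<lambda>k. u (s k) (q n)))"
      by (rule boundedI[of _ "\<bar>B\<bar>"]) (use B cone_nonneg[OF cone q(2)[of n]] in \<open>fastforce intro: order_trans\<close>)
    then obtain l r where "strict_mono (r :: nat \<Rightarrow> nat)" "((\<lambda>k. u (s k) (q n)) \<circ> r) \<longlonglongrightarrow> l"
      using bounded_imp_convergent_subsequence by blast
    then show "\<exists>r'. strict_mono r' \<and> P n (s \<circ> r')"
      unfolding P_def by (intro exI[of _ r]) (auto simp: o_def convergent_def)
  qed
  have convQ: "convergent (\<lambda>k. u (diagseq k) y)" if yQ: "y \<in> Q" for y
  proof -
    obtain n where n: "y = q n" using from_nat_into_surj[OF cQ yQ] by (auto simp: q_def)
    \<comment> \<open>The diagonal sequence is a subsequence of the \<open>n\<close>-th selection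
      only after its first \<open>Suc n\<close> terms are dropped; the shift is undone
      below.\<close>
    have "P n (diagseq \<circ> ((+) (Suc n)))"
      by (rule diagseq_holds) (auto simp: P_def o_def strict_mono_o dest: convergent_subseq_convergent[of _ , unfolded o_def])
    then have "convergent (\<lambda>k. u (diagseq (k + Suc n)) y)"
      by (simp add: P_def o_def n add.commute)
    then show ?thesis
      using convergent_ignore_initial_segment[of "\<lambda>k. u (diagseq k) y" "Suc n"] by simp
  qed
  have conv: "convergent (\<lambda>k. u (diagseq k) x)" if x: "x \<in> X" for x
  proof -
    obtain I \<rho> where I: "I \<in> sides" "\<rho> > 0" "{x-\<rho>..x+\<rho>} \<subseteq> I" using side_neighbourhood[OF x] .
    obtain B0 where B0: "\<And>n. u n x \<le> B0" using bdd[OF x] by blast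
    define B where "B = max B0 1"
    have B: "u n x \<le> B" "B > 0" for n using B0[of n] by (auto simp: B_def)
    have "Cauchy (\<lambda>k. u (diagseq k) x)"
      unfolding Cauchy_def
    proof (intro allI impI)
      fix e :: real assume e: "e > 0"
      \<comment> \<open>The bound \<open>\<rho> / 2\<close> makes the local Lipschitz estimate
        applicable, and \<open>e * \<rho> / (64 * B)\<close> turns its constant 16 into an error of
        at most \<open>e / 4\<close>.\<close>
      define \<delta> where "\<delta> = min (\<rho> / 2) (e * \<rho> / (64 * B))"
      have "\<delta> > 0" using I e B by (simp add: \<delta>_def)
      then obtain y where y: "y \<in> Q" "x < y" "y < x + \<delta>" using dense[OF x] by blast
      have near: "\<bar>u n y - u n x\<bar> \<le> e / 4" for n
      proof -
        have "\<bar>u n y - u n x\<bar> \<le> 16 * (\<bar>y - x\<bar> / \<rho>) * u n x"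
          by (rule koebe_on_local_diff[OF _ I(3,2)]) (use cone I y in \<open>auto simp: cone_def \<delta>_def\<close>)
        also have "\<dots> \<le> 16 * ((e * \<rho> / (64 * B)) / \<rho>) * B"
          using y I B cone_nonneg[OF cone x] e
          by (intro mult_mono divide_right_mono) (auto simp: \<delta>_def)
        also have "\<dots> = e / 4" using I B(2) by (simp add: field_simps)
        finally show ?thesis .
      qed
      obtain M where M: "\<And>m n. m \<ge> M \<Longrightarrow> n \<ge> M \<Longrightarrow> dist (u (diagseq m) y) (u (diagseq n) y) < e / 4"
        using convQ[OF y(1)] e unfolding convergent_eq_Cauchy
        by (metis CauchyD convergent_eq_Cauchy dist_norm Cauchy_convergent_iff zero_less_divide_iff zero_less_numeral)
      have "dist (u (diagseq m) x) (u (diagseq n) x) < e" if "m \<ge> M" "n \<ge> M" for m n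
        using M[OF that] near[of "diagseq m"] near[of "diagseq n"] e unfolding dist_real_def by linarith
      then show "\<exists>M. \<forall>m\<ge>M. \<forall>n\<ge>M. dist (u (diagseq m) x) (u (diagseq n) x) < e" by blast
    qed
    then show ?thesis by (simp add: Cauchy_convergent_iff)
  qed
  define v where "v x = lim (\<lambda>k. u (diagseq k) x)" for x
  have v: "(\<lambda>k. u (diagseq k) x) \<longlonglongrightarrow> v x" if "x \<in> X" for x
    using conv[OF that] by (simp add: v_def convergent_LIMSEQ_iff)
  show ?thesis
    by (rule that[OF subseq_diagseq cone_limit[OF cone v] v])
qed

text \<open>Sublevel sets keep a fixed distance from \<open>0\<close>, \<open>c\<close> and
  \<open>1\<close>. The distance is expressed by an interval inside a side because this is the form
  in which \<open>cone_bound\<close> gives a uniform bound there.\<close>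

definition coercive :: "(real \<Rightarrow> real) \<Rightarrow> bool" where
  "coercive w \<longleftrightarrow> w \<in> borel_measurable lebX \<and> (\<forall>x\<in>X. 0 \<le> w x) \<and>
     (\<forall>R. \<exists>\<rho>>0. \<forall>x\<in>X. w x \<le> R \<longrightarrow> (\<exists>I\<in>sides. {x-\<rho>..x+\<rho>} \<subseteq> I))"

lemma integral_fatou_bound:
  fixes u :: "nat \<Rightarrow> real \<Rightarrow> real"
  assumes "\<And>n. f n \<in> borel_measurable lebX" and "\<And>x. x \<in> X \<Longrightarrow> (\<lambda>n. f n x) \<longlonglongrightarrow> g x"
    and "\<And>n. (\<integral>\<^sup>+x. ennreal (f n x) \<partial>lebX) \<le> C"
  shows "(\<integral>\<^sup>+x. ennreal (g x) \<partial>lebX) \<le> C"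
proof -
  have "(\<integral>\<^sup>+x. ennreal (g x) \<partial>lebX) = (\<integral>\<^sup>+x. liminf (\<lambda>n. ennreal (f n x)) \<partial>lebX)"
    by (intro nn_integral_cong lim_imp_Liminf[symmetric]) (auto intro!: tendsto_ennrealI assms(2))
  also have "\<dots> \<le> liminf (\<lambda>n. \<integral>\<^sup>+x. ennreal (f n x) \<partial>lebX)"
    using assms(1) by (intro nn_integral_liminf) auto
  also have "\<dots> \<le> C" using assms(3) by (intro Liminf_le) auto
  finally show ?thesis .
qed

text \<open>Fatou gives one inequality for the mass. For the other, cone elements are uniformly
  bounded where \<open>w \<le> R\<close>, so dominated convergence applies there, and by Markov's
  inequality at most \<open>C / R\<close> of the mass lies elsewhere. Pointwise convergence with
  equal masses is convergence in the mean, by Scheffe.\<close>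

lemma cone_tight_mass:
  assumes cone: "\<And>n. cone (u n)" and w: "coercive w"
    and mass: "\<And>n. (\<integral>\<^sup>+x. ennreal (u n x) \<partial>lebX) = ennreal m" and m: "0 \<le> m"
    and tight: "\<And>n. (\<integral>\<^sup>+x. ennreal (w x * u n x) \<partial>lebX) \<le> ennreal C"
    and lim: "\<And>x. x \<in> X \<Longrightarrow> (\<lambda>n. u n x) \<longlonglongrightarrow> v x"
  shows "cone v" "(\<integral>\<^sup>+x. ennreal (v x) \<partial>lebX) = ennreal m"
    and "(\<integral>\<^sup>+x. ennreal (w x * v x) \<partial>lebX) \<le> ennreal C"
    and "(\<lambda>n. \<integral>\<^sup>+x. norm (u n x - v x) \<partial>lebX) \<longlonglongrightarrow> 0"
proof -
  show cv: "cone v" by (rule cone_limit[OF cone lim])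
  have [measurable]: "w \<in> borel_measurable lebX" "v \<in> borel_measurable lebX" "\<And>n. u n \<in> borel_measurable lebX"
    using w cone_measurable cv cone by (auto simp: coercive_def)
  show "(\<integral>\<^sup>+x. ennreal (w x * v x) \<partial>lebX) \<le> ennreal C"
    by (rule integral_fatou_bound[of "\<lambda>n x. w x * u n x"]) (auto intro!: tendsto_intros lim tight)
  have le: "(\<integral>\<^sup>+x. ennreal (v x) \<partial>lebX) \<le> ennreal m"
    by (rule integral_fatou_bound[of u]) (auto intro!: lim simp: mass)
  have ge: "ennreal m \<le> (\<integral>\<^sup>+x. ennreal (v x) \<partial>lebX) + ennreal (C / R)" if R: "R > 0" for R
  proof -
    define A where "A = {x\<in>space lebX. w x \<le> R}"
    have [measurable]: "A \<in> sets lebX" unfolding A_def by measurable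
    obtain \<rho> where \<rho>: "\<rho> > 0" "\<And>x. x \<in> X \<Longrightarrow> w x \<le> R \<Longrightarrow> \<exists>I\<in>sides. {x-\<rho>..x+\<rho>} \<subseteq> I"
      using w unfolding coercive_def by metis
    have bd: "u n x \<le> 4 * m / \<rho>" if xA: "x \<in> A" for n x
    proof -
      obtain I where "I \<in> sides" "{x-\<rho>..x+\<rho>} \<subseteq> I" using \<rho>(2) xA by (auto simp: A_def)
      then show ?thesis by (intro cone_bound[OF cone _ _ \<rho>(1) _ m]) (simp_all add: mass)
    qed
    have "(\<lambda>n. \<integral>\<^sup>+x. ennreal (u n x) * indicator A x \<partial>lebX) \<longlonglongrightarrow> (\<integral>\<^sup>+x. ennreal (v x) * indicator A x \<partial>lebX)"
    proof (rule nn_integral_dominated_convergence[where w = "\<lambda>x. ennreal (4 * m / \<rho>)"])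
      show "AE x in lebX. (\<lambda>n. ennreal (u n x) * indicator A x) \<longlonglongrightarrow> ennreal (v x) * indicator A x"
        by (rule AE_I2) (auto simp: indicator_def intro!: tendsto_ennrealI lim)
      show "AE x in lebX. ennreal (u n x) * indicator A x \<le> ennreal (4 * m / \<rho>)" for n
        by (rule AE_I2) (auto simp: indicator_def intro!: ennreal_leI bd)
      show "(\<integral>\<^sup>+x. ennreal (4 * m / \<rho>) \<partial>lebX) < \<infinity>"
        by (simp add: emeasure_lebX_X)
    qed simp_all
    then have "(\<lambda>n. (\<integral>\<^sup>+x. ennreal (u n x) * indicator A x \<partial>lebX) + ennreal (C / R))
        \<longlonglongrightarrow> (\<integral>\<^sup>+x. ennreal (v x) * indicator A x \<partial>lebX) + ennreal (C / R)"
      by (intro tendsto_add) auto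
    moreover have "ennreal m \<le> (\<integral>\<^sup>+x. ennreal (u n x) * indicator A x \<partial>lebX) + ennreal (C / R)" for n
    proof -
      have "ennreal m = (\<integral>\<^sup>+x. ennreal (u n x) \<partial>lebX)" by (simp add: mass)
      also have "\<dots> \<le> (\<integral>\<^sup>+x. ennreal (u n x) * indicator A x + ennreal (w x * u n x) * ennreal (1 / R) \<partial>lebX)"
      proof (rule nn_integral_mono)
        fix x assume "x \<in> space lebX"
        show "ennreal (u n x) \<le> ennreal (u n x) * indicator A x + ennreal (w x * u n x) * ennreal (1 / R)"
        proof (cases "w x \<le> R")
          case False
          then have "1 * u n x \<le> (w x / R) * u n x"
            using R cone_nonneg[OF cone] \<open>x \<in> space lebX\<close> by (intro mult_right_mono) auto
          then have "ennreal (u n x) \<le> ennreal (w x * u n x * (1 / R))"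
            by (intro ennreal_leI) simp
          also have "\<dots> = ennreal (w x * u n x) * ennreal (1 / R)" using R by (intro ennreal_mult'') simp
          finally show ?thesis by (simp add: add_increasing)
        qed (use \<open>x \<in> space lebX\<close> in \<open>simp add: A_def\<close>)
      qed
      also have "\<dots> = (\<integral>\<^sup>+x. ennreal (u n x) * indicator A x \<partial>lebX) + (\<integral>\<^sup>+x. ennreal (w x * u n x) \<partial>lebX) * ennreal (1 / R)"
        by (subst nn_integral_add) (auto simp: nn_integral_multc)
      also have "\<dots> \<le> (\<integral>\<^sup>+x. ennreal (u n x) * indicator A x \<partial>lebX) + ennreal C * ennreal (1 / R)"
        by (intro add_mono mult_right_mono tight) auto
      also have "ennreal C * ennreal (1 / R) = ennreal (C / R)" using R by (subst ennreal_mult''[symmetric]) auto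
      finally show ?thesis .
    qed
    ultimately have "ennreal m \<le> (\<integral>\<^sup>+x. ennreal (v x) * indicator A x \<partial>lebX) + ennreal (C / R)"
      by (intro LIMSEQ_le_const) auto
    also have "\<dots> \<le> (\<integral>\<^sup>+x. ennreal (v x) \<partial>lebX) + ennreal (C / R)"
      by (intro add_mono nn_integral_mono) (auto simp: indicator_def)
    finally show ?thesis .
  qed
  have "ennreal m \<le> (\<integral>\<^sup>+x. ennreal (v x) \<partial>lebX)"
  proof (rule LIMSEQ_le_const)
    have "(\<lambda>n. C / real (Suc n)) \<longlonglongrightarrow> 0" by real_asymp
    then have "(\<lambda>n. ennreal (C / real (Suc n))) \<longlonglongrightarrow> ennreal 0" by (rule tendsto_ennrealI)
    then have "(\<lambda>n. (\<integral>\<^sup>+x. ennreal (v x) \<partial>lebX) + ennreal (C / real (Suc n))) \<longlonglongrightarrow> (\<integral>\<^sup>+x. ennreal (v x) \<partial>lebX) + ennreal 0"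
      by (intro tendsto_add) auto
    then show "(\<lambda>n. (\<integral>\<^sup>+x. ennreal (v x) \<partial>lebX) + ennreal (C / real (Suc n))) \<longlonglongrightarrow> (\<integral>\<^sup>+x. ennreal (v x) \<partial>lebX)"
      by simp
  qed (use ge in auto)
  then show eq: "(\<integral>\<^sup>+x. ennreal (v x) \<partial>lebX) = ennreal m" using le by (rule antisym[rotated])
  have n: "(\<integral>\<^sup>+x. ennreal (norm (f x)) \<partial>lebX) = (\<integral>\<^sup>+x. ennreal (f x) \<partial>lebX)" if "cone f" for f
    using cone_nonneg[OF that] by (intro nn_integral_cong) auto
  show "(\<lambda>n. \<integral>\<^sup>+x. norm (u n x - v x) \<partial>lebX) \<longlonglongrightarrow> 0"
  proof (rule Scheffe_lemma2)
    show "integrable lebX v"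
      by (subst integrable_iff_bounded) (simp_all only: n[OF cv] eq, simp_all)
    show "(\<integral>\<^sup>+x. ennreal (norm (u n x)) \<partial>lebX) \<le> (\<integral>\<^sup>+x. ennreal (norm (v x)) \<partial>lebX)" for n
      by (simp only: n[OF cv] n[OF cone] eq mass)
  qed (auto intro!: AE_I2 lim)
qed

lemma cone_compact:
  assumes cone: "\<And>n. cone (u n)" and w: "coercive w"
    and mass: "\<And>n. (\<integral>\<^sup>+x. ennreal (u n x) \<partial>lebX) = ennreal m" and m: "0 \<le> m"
    and tight: "\<And>n. (\<integral>\<^sup>+x. ennreal (w x * u n x) \<partial>lebX) \<le> ennreal C"
  obtains r v where "strict_mono (r :: nat \<Rightarrow> nat)" "cone v" "\<And>x. x \<in> X \<Longrightarrow> (\<lambda>n. u (r n) x) \<longlonglongrightarrow> v x"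
    "(\<integral>\<^sup>+x. ennreal (v x) \<partial>lebX) = ennreal m" "(\<integral>\<^sup>+x. ennreal (w x * v x) \<partial>lebX) \<le> ennreal C"
    "(\<lambda>n. \<integral>\<^sup>+x. norm (u (r n) x - v x) \<partial>lebX) \<longlonglongrightarrow> 0"
proof -
  have "\<exists>B. \<forall>n. u n x \<le> B" if xX: "x \<in> X" for x
  proof -
    obtain I \<rho> where I: "I \<in> sides" "\<rho> > 0" "{x-\<rho>..x+\<rho>} \<subseteq> I" using side_neighbourhood[OF xX] .
    have "u n x \<le> 4 * m / \<rho>" for n by (rule cone_bound[OF cone I(1,3,2) _ m]) (simp add: mass)
    then show ?thesis by blast
  qed
  from cone_pointwise_subsequence[of u, OF cone this] obtain r v
    where r: "strict_mono (r :: nat \<Rightarrow> nat)" "cone v" and lim: "\<And>x. x \<in> X \<Longrightarrow> (\<lambda>n. u (r n) x) \<longlonglongrightarrow> v x"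
    by blast
  show ?thesis
    using that[OF r lim] cone_tight_mass[of "\<lambda>n. u (r n)", OF cone w mass m tight lim] by blast
qed

end

section \<open>Branches near the critical point and the endpoints\<close>

text \<open>One branch, in terms of the distances \<open>s\<close> of the argument and \<open>f s\<close> of the value from the endpoints
  of \<open>[0,1]\<close> that correspond to each other. This treats increasing and decreasing branches on both sides of \<open>c\<close>
  at once; \<open>\<kappa>\<close> corresponds to \<open>c\<close>.\<close>

locale folded_branch =
  fixes f g :: "real \<Rightarrow> real" and \<kappa> \<kappa>' :: real
  assumes \<kappa>_pos: "0 < \<kappa>"
    and deriv: "\<And>s. s \<in> {0..<\<kappa>} \<Longrightarrow> (f has_real_derivative g s) (at s within {0..<\<kappa>})"
    and g_pos: "\<And>s. s \<in> {0..<\<kappa>} \<Longrightarrow> 0 < g s"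
    and f_0: "f 0 = 0"
    and image: "f ` {0<..<\<kappa>} = {0<..<\<kappa>'}"
begin

lemma deriv_at: "s \<in> {0<..<\<kappa>} \<Longrightarrow> (f has_real_derivative g s) (at s)"
  using DERIV_subset[OF deriv[of s], of "{0<..<\<kappa>}"] at_within_open[of s "{0<..<\<kappa>}"]
  by (simp add: greaterThanLessThan_subseteq_atLeastLessThan_iff)

lemma continuous: "continuous_on {0..<\<kappa>} f"
  by (rule DERIV_continuous_on[OF deriv])

lemma range: "s \<in> {0<..<\<kappa>} \<Longrightarrow> f s \<in> {0<..<\<kappa>'}"
  using image by blast

lemma strict_mono: "0 \<le> s \<Longrightarrow> s < t \<Longrightarrow> t < \<kappa> \<Longrightarrow> f s < f t"
  by (rule DERIV_pos_imp_increasing_open)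
    (auto intro!: exI[of _ "g _"] deriv_at g_pos continuous_on_subset[OF continuous])

lemma approach:
  assumes "s \<in> {0<..<\<kappa>}" "v < \<kappa>'"
  obtains t where "t \<in> {s<..<\<kappa>}" "v < f t"
proof -
  have "\<kappa>' > 0" "f s < \<kappa>'" "0 < f s" using range[OF assms(1)] by auto
  then have "(max (f s) v + \<kappa>') / 2 \<in> {0<..<\<kappa>'}" using assms(2) by (auto simp: max_def)
  then obtain t where t: "t \<in> {0<..<\<kappa>}" "f t = (max (f s) v + \<kappa>') / 2" using image by (metis imageE)
  then have ft: "f s < f t" "v < f t" using assms(2) \<open>f s < \<kappa>'\<close> by (simp_all add: max_def split: if_splits)
  have "s < t"
  proof (rule ccontr)
    assume "\<not> s < t"
    then have "f t \<le> f s" using strict_mono[of t s] t assms by (cases "t = s") auto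
    then show False using ft by simp
  qed
  then show ?thesis using that ft t by auto
qed

text \<open>This integrates the lower bound on \<open>g\<close> from \<open>s\<close> to \<kappa>:
  the function \<open>F\<close> is nondecreasing, and near \<kappa> it is at most
  \<open>\<kappa>' + e\<close> because \<open>f\<close> stays below \<open>\<kappa>'\<close> while
  the power tends to zero.\<close>

lemma growth:
  assumes r: "0 < r" and K: "0 \<le> K" and g: "\<And>s. s \<in> {0<..<\<kappa>} \<Longrightarrow> K * (\<kappa> - s) powr (r - 1) \<le> g s"
    and s: "s \<in> {0<..<\<kappa>}"
  shows "K / r * (\<kappa> - s) powr r \<le> \<kappa>' - f s"
proof -
  define F where "F t = f t + K / r * (\<kappa> - t) powr r" for t
  have inc: "F s \<le> F t" if t: "t \<in> {s<..<\<kappa>}" for t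
  proof (rule DERIV_nonneg_imp_nondecreasing[where f = F])
    fix y assume y: "s \<le> y" "y \<le> t"
    then have yI: "y \<in> {0<..<\<kappa>}" using s t by auto
    have "((\<lambda>t. \<kappa> - t) has_real_derivative - 1) (at y)" by (auto intro!: derivative_eq_intros)
    from DERIV_chain2[OF has_real_derivative_powr this, of r]
    have "((\<lambda>t. (\<kappa> - t) powr r) has_real_derivative - r * (\<kappa> - y) powr (r - 1)) (at y)"
      using yI by simp
    from DERIV_add[OF deriv_at[OF yI] DERIV_cmult[OF this, of "K / r"]]
    have "(F has_real_derivative g y - K * (\<kappa> - y) powr (r - 1)) (at y)"
      unfolding F_def using r by (simp add: field_simps)
    then show "\<exists>d. (F has_real_derivative d) (at y) \<and> 0 \<le> d"
      using g[OF yI] by (intro exI conjI) auto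
  qed (use t in auto)
  have "F s \<le> \<kappa>' + e" if "e > 0" for e
  proof -
    have "((\<lambda>t. K / r * (\<kappa> - t) powr r) \<longlongrightarrow> K / r * (\<kappa> - \<kappa>) powr r) (at_left \<kappa>)"
      using r by (intro tendsto_intros tendsto_powr'[OF _ _ ]) (auto simp: eventually_at_filter)
    then have "((\<lambda>t. K / r * (\<kappa> - t) powr r) \<longlongrightarrow> 0) (at_left \<kappa>)" by simp
    then have "\<forall>\<^sub>F t in at_left \<kappa>. K / r * (\<kappa> - t) powr r < e"
      using that by (rule order_tendstoD)
    moreover have "\<forall>\<^sub>F t in at_left \<kappa>. t \<in> {s<..<\<kappa>}"
      using s by (auto simp: eventually_at_left)
    ultimately have "\<forall>\<^sub>F t in at_left \<kappa>. F s \<le> \<kappa>' + e"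
    proof eventually_elim
      case (elim t)
      have "f t < \<kappa>'" using range[of t] elim(2) s by auto
      then have "F t \<le> \<kappa>' + e" using elim(1) by (simp add: F_def)
      then show ?case using inc[OF elim(2)] by simp
    qed
    then show ?thesis by simp
  qed
  then have "F s \<le> \<kappa>'" by (rule field_le_epsilon)
  then show ?thesis by (simp add: F_def)
qed

text \<open>Any \<beta> strictly between \<open>1\<close> and \<open>g 0\<close> works near
  \<open>0\<close>. The value \<open>1 / 2\<close> is where the nearer endpoint changes: below it,
  \<open>f s\<close> is the distance of the image point from the whole set
  \<open>{0, 1}\<close>.\<close>

lemma expanding_near_0:
  assumes "1 < g 0"
  obtains \<beta> \<delta> where "1 < \<beta>" "0 < \<delta>" "\<delta> \<le> \<kappa>" "\<And>s. s \<in> {0<..<\<delta>} \<Longrightarrow> \<beta> * s \<le> f s" "\<And>s. s \<in> {0<..<\<delta>} \<Longrightarrow> f s \<le> 1 / 2"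
    "\<And>s. s \<in> {0<..<\<delta>} \<Longrightarrow> \<beta> * s \<le> 1 / 2"
proof -
  define \<beta> where "\<beta> = (1 + g 0) / 2"
  have \<beta>: "1 < \<beta>" "\<beta> < g 0" using assms by (auto simp: \<beta>_def)
  have nb: "at 0 within {0..<\<kappa>} = at_right 0" using \<kappa>_pos
    by (intro at_within_nhd[of _ "{..<\<kappa>}"]) auto
  have "((\<lambda>s. f s / s) \<longlongrightarrow> g 0) (at_right 0)"
    using deriv[of 0] \<kappa>_pos nb f_0 by (simp add: has_field_derivative_iff)
  then have 1: "\<forall>\<^sub>F s in at_right 0. \<beta> < f s / s" using \<beta>(2) by (rule order_tendstoD)
  have "(f \<longlongrightarrow> f 0) (at_right 0)" using continuous \<kappa>_pos nb by (metis atLeastLessThan_iff continuous_on_def order_refl)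
  then have 2: "\<forall>\<^sub>F s in at_right 0. f s < 1 / 2" unfolding f_0 by (rule order_tendstoD) simp
  have "((\<lambda>s. \<beta> * s) \<longlongrightarrow> \<beta> * 0) (at_right 0)" by (intro tendsto_intros)
  then have 3: "\<forall>\<^sub>F s in at_right 0. \<beta> * s < 1 / 2" by (rule order_tendstoD) simp
  from eventually_conj[OF 1 eventually_conj[OF 2 3]] obtain b where b: "b > 0"
    "\<And>s. 0 < s \<Longrightarrow> s < b \<Longrightarrow> \<beta> < f s / s \<and> f s < 1 / 2 \<and> \<beta> * s < 1 / 2"
    unfolding eventually_at_right[OF zero_less_one] by auto
  show ?thesis
    by (rule that[of \<beta> "min b \<kappa>"]) (use \<beta> b \<kappa>_pos in \<open>force simp: field_simps\<close>)+
qed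

text \<open>The hypothesis on \<open>\<beta>\<close> is the infinitesimal form of the conclusion.\<close>

lemma reciprocal_contraction:
  assumes \<beta>: "0 < \<beta>" and k: "\<And>s. s \<in> {0<..<\<kappa>} \<Longrightarrow> \<beta> * g s * s\<^sup>2 \<le> (f s)\<^sup>2"
    and s: "s \<in> {0<..<\<kappa>}"
  shows "1 / f s - 1 / \<kappa>' \<le> (1 / s - 1 / \<kappa>) / \<beta>"
proof -
  have inc: "1 / f s - 1 / (\<beta> * s) \<le> 1 / f t - 1 / (\<beta> * t)" if t: "t \<in> {s<..<\<kappa>}" for t
  proof (rule DERIV_nonneg_imp_nondecreasing[where f = "\<lambda>t. 1 / f t - 1 / (\<beta> * t)"])
    fix y assume y: "s \<le> y" "y \<le> t"
    then have yI: "y \<in> {0<..<\<kappa>}" using s t by auto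
    then have p: "f y > 0" "y > 0" using range[OF yI] by auto
    have "((\<lambda>t. 1 / f t - 1 / (\<beta> * t)) has_real_derivative - g y / (f y)\<^sup>2 + 1 / (\<beta> * y\<^sup>2)) (at y)"
      by (rule derivative_eq_intros deriv_at[OF yI] refl | use p \<beta> in \<open>simp add: divide_simps power2_eq_square\<close>)+
    moreover have "g y / (f y)\<^sup>2 \<le> 1 / (\<beta> * y\<^sup>2)"
      using k[OF yI] p \<beta> by (simp add: field_simps)
    ultimately show "\<exists>d. ((\<lambda>t. 1 / f t - 1 / (\<beta> * t)) has_real_derivative d) (at y) \<and> 0 \<le> d"
      by (intro exI conjI) auto
  qed (use t in auto)
  have \<kappa>': "\<kappa>' > 0" and fs: "0 < f s" using range[OF s] by auto
  \<comment> \<open>The comparison is made as \<open>t\<close> approaches \<kappa>. It passes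
    through values \<open>v < \<kappa>'\<close> that \<open>f\<close> exceeds, since
    \<open>f\<close> is described only on the half-open interval.\<close>
  have bound: "1 / f s - 1 / (\<beta> * s) + 1 / (\<beta> * \<kappa>) \<le> 1 / v" if v: "0 < v" "v < \<kappa>'" for v
  proof -
    obtain t where t: "t \<in> {s<..<\<kappa>}" "v < f t" using approach[OF s v(2)] .
    have "1 / f t \<le> 1 / v" using t v by (simp add: frac_le)
    moreover have "1 / (\<beta> * \<kappa>) \<le> 1 / (\<beta> * t)" using t s \<beta> by (intro divide_left_mono) auto
    ultimately show ?thesis using inc[OF t(1)] by linarith
  qed
  have "1 / f s - 1 / (\<beta> * s) + 1 / (\<beta> * \<kappa>) \<le> 1 / \<kappa>'"
  proof (rule tendsto_lowerbound)
    show "((\<lambda>v. 1 / v) \<longlongrightarrow> 1 / \<kappa>') (at_left \<kappa>')" using \<kappa>' by (intro tendsto_intros) auto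
    show "\<forall>\<^sub>F v in at_left \<kappa>'. 1 / f s - 1 / (\<beta> * s) + 1 / (\<beta> * \<kappa>) \<le> 1 / v"
      using bound \<kappa>' by (auto simp: eventually_at_left intro!: exI[of _ 0])
  qed simp
  then show ?thesis using \<beta> by (simp add: diff_divide_distrib mult.commute)
qed

end

section \<open>Branches of good and bad maps in folded coordinates\<close>

context punctured_interval
begin

text \<open>A side is named after the endpoint of \<open>[0,1]\<close> that it adjoins, so that
  \<open>T e\<close> names the side hit by a branch of a bad map. Every \<open>e\<close> other than
  \<open>0\<close> yields the right side.\<close>

definition side_at :: "real \<Rightarrow> real set" where
  "side_at e = (if e = 0 then {0<..<c} else {c<..<1})"

lemma sides_eq: "sides = {side_at 0, side_at 1}"
  by (simp add: sides_def side_at_def)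

lemma side_at_in_sides: "side_at e \<in> sides"
  by (simp add: sides_def side_at_def)

lemma side_cases:
  assumes "I \<in> sides"
  obtains e where "e \<in> {0, 1}" "I = side_at e"
  using assms unfolding sides_eq by blast

lemma X_side_at:
  assumes "x \<in> X"
  obtains e where "e \<in> {0, 1}" "x \<in> side_at e"
  using X_side[OF assms] side_cases by metis

end

text \<open>The common ground of both kinds of maps: \<open>r\<close> stands for the exponent of a
  good or of a bad map, and the disjunction in \<open>image\<close> tells full branches from
  branches onto one side.\<close>

locale branch_map = punctured_interval +
  fixes T :: "real \<Rightarrow> real" and r :: real
  assumes maps: "x \<in> {0..1} \<Longrightarrow> T x \<in> {0..1}"
    and schwarzian: "nonpos_schwarzian_on T {0..<c}" "nonpos_schwarzian_on T {c<..1}"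
    and inj: "I \<in> sides \<Longrightarrow> inj_on T I"
    and image: "(\<forall>I\<in>sides. T ` I = {0<..<1}) \<or> (\<forall>I\<in>sides. T ` I \<in> sides)"
    and ends: "T ` {0, 1} \<subseteq> {0, 1}"
    and r_ge: "1 \<le> r"
    and derivative_bound: "\<exists>K>0. \<forall>x\<in>{0..1} - {c}. K * \<bar>x - c\<bar> powr (r - 1) \<le> \<bar>D01 T x\<bar>"
    and repelling: "1 < \<bar>D01 T 0\<bar>" "1 < \<bar>D01 T 1\<bar>"
begin

lemma schwarzian_side: "I \<in> sides \<Longrightarrow> nonpos_schwarzian_on T I"
  using nonpos_schwarzian_on_subset[OF schwarzian(1), of "{0<..<c}"]
    nonpos_schwarzian_on_subset[OF schwarzian(2), of "{c<..<1}"] by (auto simp: sides_def subset_iff)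

lemma image_01: "I \<in> sides \<Longrightarrow> T ` I \<subseteq> {0<..<1}"
proof -
  assume "I \<in> sides"
  then have "T ` I = {0<..<1} \<or> T ` I \<in> sides" using image by blast
  then show ?thesis using sides_X[of "T ` I"] by (auto simp: X_def)
qed

lemma in_01: "x \<in> X \<Longrightarrow> T x \<in> {0<..<1}"
  using X_side image_01 by blast

text \<open>The distances from \<open>e\<close> and from \<open>T e\<close> are affine charts with
  slopes \<sigma> and \<tau>, each \<open>1\<close> or \<open>-1\<close>. In these charts the branch
  starts at \<open>0\<close> and is nonnegative, and its derivative has no zero; were the derivative
  negative somewhere, it would be so everywhere and the branch would drop below
  \<open>0\<close>.\<close>

lemma folded_exists:
  assumes e: "e \<in> {0, 1}"
  shows "\<exists>\<kappa>'. folded_branch (\<lambda>s. \<bar>T \<bar>e - s\<bar> - T e\<bar>) (\<lambda>s. \<bar>D01 T \<bar>e - s\<bar>\<bar>) \<bar>c - e\<bar> \<kappa>' \<and>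
    (T ` side_at e = {0<..<1} \<longrightarrow> \<kappa>' = 1) \<and>
    (T ` side_at e \<in> sides \<longrightarrow> \<kappa>' = \<bar>c - T e\<bar> \<and> T ` side_at e = side_at (T e))"
proof -
  define \<sigma> :: real where "\<sigma> = (if e = 0 then 1 else -1)"
  define \<tau> :: real where "\<tau> = (if T e = 0 then 1 else -1)"
  define \<kappa> where "\<kappa> = \<bar>c - e\<bar>"
  define S where "S = (if e = 0 then {0..<c} else {c<..1})"
  have Te: "T e \<in> {0, 1}" using ends e by auto
  have \<kappa>: "\<kappa> > 0" using e c_pos c_less by (auto simp: \<kappa>_def)
  have S: "nonpos_schwarzian_on T S" "S \<subseteq> {0..1}" using schwarzian c_pos c_less by (auto simp: S_def)
  note D = nonpos_schwarzian_on_derivs[OF S]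
  have chart: "\<bar>e - s\<bar> = e + \<sigma> * s" if "s \<in> {0..<\<kappa>}" for s
    using that e c_pos c_less by (auto simp: \<sigma>_def \<kappa>_def)
  have chart_image: "(\<lambda>s. e + \<sigma> * s) ` {0..<\<kappa>} = S"
  proof (cases "e = 0")
    case False
    then have "e = 1" using e by simp
    have "x \<in> (\<lambda>s. 1 - s) ` {0..<1-c}" if "c < x" "x \<le> 1" for x
      by (rule image_eqI[of _ _ "1 - x"]) (use that in auto)
    then show ?thesis using c_less \<open>e = 1\<close> by (auto simp: S_def \<sigma>_def \<kappa>_def)
  qed (use c_pos in \<open>auto simp: S_def \<sigma>_def \<kappa>_def\<close>)
  have chart_image': "(\<lambda>s. e + \<sigma> * s) ` {0<..<\<kappa>} = side_at e"
  proof (cases "e = 0")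
    case False
    then have "e = 1" using e by simp
    have "x \<in> (\<lambda>s. 1 - s) ` {0<..<1-c}" if "c < x" "x < 1" for x
      by (rule image_eqI[of _ _ "1 - x"]) (use that in auto)
    then show ?thesis using c_less \<open>e = 1\<close> by (auto simp: side_at_def \<sigma>_def \<kappa>_def)
  qed (use c_pos in \<open>auto simp: side_at_def \<sigma>_def \<kappa>_def\<close>)
  have chart_S: "e + \<sigma> * s \<in> S" if "s \<in> {0..<\<kappa>}" for s using that chart_image by blast
  have abs: "\<bar>z - T e\<bar> = \<tau> * (z - T e)" if "z \<in> {0..1}" for z
    using Te that by (auto simp: \<tau>_def)
  define F where "F s = \<tau> * (T (e + \<sigma> * s) - T e)" for s
  define G where "G s = \<tau> * (\<sigma> * D01 T (e + \<sigma> * s))" for s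
  have Feq: "\<bar>T \<bar>e - s\<bar> - T e\<bar> = F s" if "s \<in> {0..<\<kappa>}" for s
    using abs[OF maps, of "e + \<sigma> * s"] chart[OF that] chart_S[OF that] S(2) by (auto simp: F_def)
  have dF: "(F has_real_derivative G s) (at s within {0..<\<kappa>})" if s: "s \<in> {0..<\<kappa>}" for s
  proof -
    have "(T has_real_derivative D01 T (e + \<sigma> * s)) (at (e + \<sigma> * s) within (\<lambda>s. e + \<sigma> * s) ` {0..<\<kappa>})"
      unfolding chart_image by (rule D(1)[OF chart_S[OF s]])
    moreover have "((\<lambda>s. e + \<sigma> * s) has_real_derivative \<sigma>) (at s within {0..<\<kappa>})"
      by (auto intro!: derivative_eq_intros)
    ultimately have "(T \<circ> (\<lambda>s. e + \<sigma> * s) has_real_derivative D01 T (e + \<sigma> * s) * \<sigma>) (at s within {0..<\<kappa>})"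
      by (rule DERIV_image_chain)
    then show ?thesis unfolding F_def G_def o_def
      by (auto intro!: derivative_eq_intros)
  qed
  have F0: "F 0 = 0" by (simp add: F_def)
  have Fpos: "0 \<le> F s" if "s \<in> {0..<\<kappa>}" for s using Feq[OF that] by (metis abs_ge_zero)
  have Gcont: "continuous_on {0..<\<kappa>} G"
    unfolding G_def by (intro continuous_intros continuous_on_compose2[OF D(2)]) (use chart_S in auto)
  have Gnz: "G s \<noteq> 0" if "s \<in> {0..<\<kappa>}" for s
    using D(3)[OF chart_S[OF that]] by (auto simp: G_def \<sigma>_def \<tau>_def)
  have Gpos: "G s > 0" if s: "s \<in> {0..<\<kappa>}" for s
  proof (rule ccontr)
    assume "\<not> 0 < G s"
    then have Gs: "G s < 0" using Gnz[OF s] by simp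
    have neg: "G t < 0" if t: "t \<in> {0..<\<kappa>}" for t
    proof (rule ccontr)
      assume "\<not> G t < 0"
      have "connected (G ` {0..<\<kappa>})" by (rule connected_continuous_image[OF Gcont]) simp
      then have "0 \<in> G ` {0..<\<kappa>}"
        using connectedD_interval[of "G ` {0..<\<kappa>}" "G s" "G t" 0] Gs s t \<open>\<not> G t < 0\<close> by auto
      then show False using Gnz by auto
    qed
    have "F (\<kappa> / 2) < F 0"
    proof (rule DERIV_neg_imp_decreasing_open[where f = F])
      fix x assume x: "0 < x" "x < \<kappa> / 2"
      then have xk: "x \<in> {0<..<\<kappa>}" using \<kappa> by auto
      have "(F has_real_derivative G x) (at x within {0<..<\<kappa>})"
        by (rule DERIV_subset[OF dF]) (use xk in auto)
      then have "(F has_real_derivative G x) (at x)" using xk by (simp add: at_within_open[of x "{0<..<\<kappa>}"])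
      then show "\<exists>y. (F has_real_derivative y) (at x) \<and> y < 0" using neg xk by auto
    next
      show "continuous_on {0..\<kappa> / 2} F"
        by (rule continuous_on_subset[OF DERIV_continuous_on[OF dF]]) (use \<kappa> in auto)
    qed (use \<kappa> in auto)
    moreover have "0 \<le> F (\<kappa> / 2)" using Fpos \<kappa> by auto
    ultimately show False using F0 by simp
  qed
  have Gabs: "\<bar>D01 T \<bar>e - s\<bar>\<bar> = G s" if "s \<in> {0..<\<kappa>}" for s
  proof -
    have "\<bar>D01 T \<bar>e - s\<bar>\<bar> = \<bar>G s\<bar>" unfolding chart[OF that] G_def by (simp add: \<sigma>_def \<tau>_def)
    then show ?thesis using Gpos[OF that] by simp
  qed
  have imF: "F ` {0<..<\<kappa>} = (\<lambda>z. \<tau> * (z - T e)) ` (T ` side_at e)"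
    unfolding chart_image'[symmetric] image_image F_def ..
  define \<kappa>' where "\<kappa>' = (if T ` side_at e = {0<..<1} then 1 else \<bar>c - T e\<bar>)"
  have im01: "(\<lambda>z. \<tau> * (z - T e)) ` {0<..<1} = {0<..<1}"
  proof (cases "T e = 0")
    case False
    then have "T e = 1" using Te by simp
    have "x \<in> (\<lambda>z. 1 - z) ` {0<..<1}" if "0 < x" "x < 1" for x :: real
      by (rule image_eqI[of _ _ "1 - x"]) (use that in auto)
    then show ?thesis using \<open>T e = 1\<close> by (auto simp: \<tau>_def)
  qed (auto simp: \<tau>_def)
  have ims: "(\<lambda>z. \<tau> * (z - T e)) ` side_at (T e) = {0<..<\<bar>c - T e\<bar>}"
  proof (cases "T e = 0")
    case False
    then have "T e = 1" using Te by simp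
    have "x \<in> (\<lambda>z. 1 - z) ` {c<..<1}" if "0 < x" "x < 1 - c" for x :: real
      by (rule image_eqI[of _ _ "1 - x"]) (use that in auto)
    then show ?thesis using \<open>T e = 1\<close> c_less by (auto simp: \<tau>_def side_at_def)
  qed (use c_pos in \<open>auto simp: \<tau>_def side_at_def\<close>)
  \<comment> \<open>Continuity at \<open>e\<close> decides which side is hit: values near
    \<open>T e\<close> occur near \<open>e\<close>, whereas the side not adjoining
    \<open>T e\<close> is at distance at least \<open>min c (1 - c)\<close> from it.\<close>
  have side: "T ` side_at e = side_at (T e)" if sd: "T ` side_at e \<in> sides"
  proof (rule ccontr)
    assume ne: "T ` side_at e \<noteq> side_at (T e)"
    have far: "min c (1 - c) \<le> F s" if "s \<in> {0<..<\<kappa>}" for s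
    proof -
      have "F s \<in> (\<lambda>z. \<tau> * (z - T e)) ` (T ` side_at e)" using imF that by blast
      moreover have "T ` side_at e = (if T e = 0 then {c<..<1} else {0<..<c})"
        using ne sd Te by (auto simp: sides_def side_at_def)
      ultimately show ?thesis using Te by (auto simp: \<tau>_def split: if_splits)
    qed
    have "(F \<longlongrightarrow> F 0) (at 0 within {0..<\<kappa>})"
      using DERIV_continuous_on[OF dF] \<kappa> by (auto simp: continuous_on_def)
    moreover have "at 0 within {0..<\<kappa>} = at_right (0::real)"
      using \<kappa> by (intro at_within_nhd[of _ "{..<\<kappa>}"]) auto
    ultimately have "\<forall>\<^sub>F s in at_right 0. F s < min c (1 - c)"
      using F0 c_pos c_less by (intro order_tendstoD(2)[of _ "F 0"]) auto
    moreover have "\<forall>\<^sub>F s in at_right 0. s \<in> {0<..<\<kappa>}" using \<kappa> by (auto simp: eventually_at_right_field)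
    ultimately have "\<forall>\<^sub>F s in at_right (0::real). False"
      by eventually_elim (use far in force)
    then show False by simp
  qed
  have imF': "F ` {0<..<\<kappa>} = {0<..<\<kappa>'}"
  proof (cases "T ` side_at e = {0<..<1}")
    case True
    then show ?thesis unfolding imF using im01 by (simp add: \<kappa>'_def)
  next
    case False
    then have "T ` side_at e \<in> sides" using image side_at_in_sides by blast
    then show ?thesis unfolding imF using ims side False by (simp add: \<kappa>'_def)
  qed
  have "folded_branch (\<lambda>s. \<bar>T \<bar>e - s\<bar> - T e\<bar>) (\<lambda>s. \<bar>D01 T \<bar>e - s\<bar>\<bar>) \<kappa> \<kappa>'"
  proof
    show "(\<lambda>s. \<bar>T \<bar>e - s\<bar> - T e\<bar>) ` {0<..<\<kappa>} = {0<..<\<kappa>'}"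
      unfolding imF'[symmetric] using Feq by (intro image_cong) auto
    fix s assume s: "s \<in> {0..<\<kappa>}"
    show "((\<lambda>s. \<bar>T \<bar>e - s\<bar> - T e\<bar>) has_real_derivative \<bar>D01 T \<bar>e - s\<bar>\<bar>) (at s within {0..<\<kappa>})"
      unfolding Gabs[OF s]
      by (rule has_field_derivative_transform_within[OF dF[OF s], of 1]) (use Feq s in auto)
    show "0 < \<bar>D01 T \<bar>e - s\<bar>\<bar>" using Gabs[OF s] Gpos[OF s] by simp
  qed (use \<kappa> e in auto)
  moreover have "{0<..<1} \<notin> sides" using c_pos c_less by (auto simp: sides_def greaterThanLessThan_eq_iff)
  ultimately show ?thesis
    using side by (intro exI[of _ \<kappa>']) (auto simp: \<kappa>_def \<kappa>'_def)
qed

end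

definition end_dist :: "real \<Rightarrow> real" where
  "end_dist x = min x (1 - x)"

context punctured_interval
begin

text \<open>In this coordinate \<open>reciprocal_contraction\<close> becomes a linear contraction:
  it is \<open>1 / s\<close> for the distance \<open>s\<close> to the endpoint on the same side,
  shifted so that it vanishes at \<open>c\<close>.\<close>

definition recip_dist :: "real \<Rightarrow> real" where
  "recip_dist x = (if x < c then 1 / x - 1 / c else 1 / (1 - x) - 1 / (1 - c))"

lemma side_at_coordinate:
  assumes "e \<in> {0, 1}" "x \<in> side_at e"
  shows "\<bar>x - e\<bar> \<in> {0<..<\<bar>c - e\<bar>}" "\<bar>e - \<bar>x - e\<bar>\<bar> = x" "\<bar>x - c\<bar> = \<bar>c - e\<bar> - \<bar>x - e\<bar>" "x \<in> X"
    "recip_dist x = 1 / \<bar>x - e\<bar> - 1 / \<bar>c - e\<bar>"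
  using assms c_pos c_less by (auto simp: side_at_def X_def recip_dist_def)

lemma end_dist_X: "x \<in> X \<Longrightarrow> 0 < end_dist x" "x \<in> X \<Longrightarrow> end_dist x \<le> 1 / 2"
  by (auto simp: X_def end_dist_def min_def)

lemma end_dist_side:
  assumes "e \<in> {0, 1}" "0 < x" "x < 1"
  shows "end_dist x = min \<bar>x - e\<bar> (1 - \<bar>x - e\<bar>)"
  using assms by (auto simp: end_dist_def min_def)

end

context branch_map
begin

lemma folded:
  assumes "e \<in> {0, 1}"
  obtains \<kappa>' where "folded_branch (\<lambda>s. \<bar>T \<bar>e - s\<bar> - T e\<bar>) (\<lambda>s. \<bar>D01 T \<bar>e - s\<bar>\<bar>) \<bar>c - e\<bar> \<kappa>'"
    "\<kappa>' \<le> 1"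
    "T ` side_at e \<in> sides \<Longrightarrow> \<kappa>' = \<bar>c - T e\<bar>" "T ` side_at e \<in> sides \<Longrightarrow> T ` side_at e = side_at (T e)"
proof -
  have Te: "T e \<in> {0, 1}" using ends assms by auto
  have "T ` side_at e = {0<..<1} \<or> T ` side_at e \<in> sides" using image side_at_in_sides by blast
  moreover have "\<bar>c - T e\<bar> \<le> 1" using Te c_pos c_less by auto
  ultimately show ?thesis using folded_exists[OF assms] that by (metis order_refl)
qed

lemma growth_constant:
  obtains K where "0 < K" "\<And>e s. e \<in> {0, 1} \<Longrightarrow> s \<in> {0<..<\<bar>c - e\<bar>} \<Longrightarrow> K * (\<bar>c - e\<bar> - s) powr (r - 1) \<le> \<bar>D01 T \<bar>e - s\<bar>\<bar>"
proof -
  obtain K where K: "K > 0" "\<And>x. x \<in> {0..1} - {c} \<Longrightarrow> K * \<bar>x - c\<bar> powr (r - 1) \<le> \<bar>D01 T x\<bar>"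
    using derivative_bound by blast
  have "K * (\<bar>c - e\<bar> - s) powr (r - 1) \<le> \<bar>D01 T \<bar>e - s\<bar>\<bar>" if "e \<in> {0, 1}" "s \<in> {0<..<\<bar>c - e\<bar>}" for e s
  proof -
    have "\<bar>e - s\<bar> \<in> {0..1} - {c}" "\<bar>\<bar>e - s\<bar> - c\<bar> = \<bar>c - e\<bar> - s"
      using that c_pos c_less by auto
    then show ?thesis using K(2) by metis
  qed
  then show ?thesis using that K(1) by blast
qed

text \<open>When a side is mapped onto a side, \<open>\<kappa>' - f s\<close> in the folded picture
  is the distance of the image point from \<open>c\<close>, so \<open>growth\<close>
  applies.\<close>

lemma image_dist_c_lower:
  assumes bad: "\<forall>I\<in>sides. T ` I \<in> sides"
  obtains k where "0 < k" "\<And>x. x \<in> X \<Longrightarrow> k * \<bar>x - c\<bar> powr r \<le> \<bar>T x - c\<bar>"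
proof -
  obtain K where K: "0 < K" "\<And>e s. e \<in> {0, 1} \<Longrightarrow> s \<in> {0<..<\<bar>c - e\<bar>} \<Longrightarrow> K * (\<bar>c - e\<bar> - s) powr (r - 1) \<le> \<bar>D01 T \<bar>e - s\<bar>\<bar>"
    using growth_constant by blast
  have "K / r * \<bar>x - c\<bar> powr r \<le> \<bar>T x - c\<bar>" if x: "x \<in> X" for x
  proof -
    obtain e where e: "e \<in> {0, 1}" "x \<in> side_at e" using X_side_at[OF x] .
    have sd: "T ` side_at e \<in> sides" using bad side_at_in_sides by blast
    have Te: "T e \<in> {0, 1}" using ends e by auto
    obtain \<kappa>' where f: "folded_branch (\<lambda>s. \<bar>T \<bar>e - s\<bar> - T e\<bar>) (\<lambda>s. \<bar>D01 T \<bar>e - s\<bar>\<bar>) \<bar>c - e\<bar> \<kappa>'"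
      and \<kappa>': "\<kappa>' = \<bar>c - T e\<bar>" and im: "T ` side_at e = side_at (T e)"
      using folded[OF e(1)] sd by metis
    interpret folded_branch "\<lambda>s. \<bar>T \<bar>e - s\<bar> - T e\<bar>" "\<lambda>s. \<bar>D01 T \<bar>e - s\<bar>\<bar>" "\<bar>c - e\<bar>" \<kappa>' by fact
    note co = side_at_coordinate[OF e]
    have "T x \<in> side_at (T e)" using im e by blast
    note co' = side_at_coordinate[OF Te this]
    have "K / r * (\<bar>c - e\<bar> - \<bar>x - e\<bar>) powr r \<le> \<kappa>' - \<bar>T \<bar>e - \<bar>x - e\<bar>\<bar> - T e\<bar>"
      by (rule growth[OF _ _ K(2)[OF e(1)] co(1)]) (use r_ge K in auto)
    then show ?thesis using co co' \<kappa>' by simp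
  qed
  then show ?thesis using that[of "K / r"] K r_ge by simp
qed

text \<open>Bad maps have no periodic point other than \<open>c\<close> in the open interval: repulsion at the endpoints together
  with the Schwarzian condition forces uniform attraction to \<open>c\<close> in the coordinate \<^term>\<open>recip_dist\<close>.\<close>

lemma recip_dist_contraction:
  assumes bad: "\<forall>I\<in>sides. T ` I \<in> sides"
  obtains \<beta> where "1 < \<beta>" "\<And>x. x \<in> X \<Longrightarrow> recip_dist (T x) \<le> recip_dist x / \<beta>"
proof -
  define \<beta> where "\<beta> = min \<bar>D01 T 0\<bar> \<bar>D01 T 1\<bar>"
  have \<beta>: "1 < \<beta>" using repelling by (auto simp: \<beta>_def)
  have "recip_dist (T x) \<le> recip_dist x / \<beta>" if x: "x \<in> X" for x
  proof -
    obtain e where e: "e \<in> {0, 1}" "x \<in> side_at e" using X_side_at[OF x] .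
    have sd: "T ` side_at e \<in> sides" using bad side_at_in_sides by blast
    have Te: "T e \<in> {0, 1}" using ends e by auto
    obtain \<kappa>' where f: "folded_branch (\<lambda>s. \<bar>T \<bar>e - s\<bar> - T e\<bar>) (\<lambda>s. \<bar>D01 T \<bar>e - s\<bar>\<bar>) \<bar>c - e\<bar> \<kappa>'"
      and \<kappa>': "\<kappa>' = \<bar>c - T e\<bar>" and im: "T ` side_at e = side_at (T e)"
      using folded[OF e(1)] sd by metis
    interpret folded_branch "\<lambda>s. \<bar>T \<bar>e - s\<bar> - T e\<bar>" "\<lambda>s. \<bar>D01 T \<bar>e - s\<bar>\<bar>" "\<bar>c - e\<bar>" \<kappa>' by fact
    note co = side_at_coordinate[OF e]
    have "T x \<in> side_at (T e)" using im e by blast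
    note co' = side_at_coordinate[OF Te this]
    \<comment> \<open>This is the second Koebe inequality with \<open>w = e\<close>, where the
      derivative has absolute value at least \<beta>.\<close>
    have k: "\<beta> * \<bar>D01 T \<bar>e - s\<bar>\<bar> * s\<^sup>2 \<le> \<bar>T \<bar>e - s\<bar> - T e\<bar>\<^sup>2" if s: "s \<in> {0<..<\<bar>c - e\<bar>}" for s
    proof -
      define S where "S = (if e = 0 then {0..<c} else {c<..1})"
      have S: "nonpos_schwarzian_on T S" "S \<subseteq> {0..1}" "convex S" using schwarzian c_pos c_less by (auto simp: S_def)
      have m: "e \<in> S" "\<bar>e - s\<bar> \<in> S" using e(1) s c_pos c_less by (auto simp: S_def)
      have sq: "(\<bar>e - s\<bar> - e)\<^sup>2 = s\<^sup>2" using e(1) s c_pos c_less by auto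
      have "\<bar>D01 T e\<bar> * \<bar>D01 T \<bar>e - s\<bar>\<bar> * (\<bar>e - s\<bar> - e)\<^sup>2 \<le> (T \<bar>e - s\<bar> - T e)\<^sup>2"
        by (rule nonpos_schwarzian_on_koebe(2)[OF S m, of e]) simp
      moreover have "\<beta> * \<bar>D01 T \<bar>e - s\<bar>\<bar> * s\<^sup>2 \<le> \<bar>D01 T e\<bar> * \<bar>D01 T \<bar>e - s\<bar>\<bar> * s\<^sup>2"
        using e(1) by (intro mult_right_mono) (auto simp: \<beta>_def)
      ultimately show ?thesis unfolding sq by simp
    qed
    have "1 / \<bar>T \<bar>e - \<bar>x - e\<bar>\<bar> - T e\<bar> - 1 / \<kappa>' \<le> (1 / \<bar>x - e\<bar> - 1 / \<bar>c - e\<bar>) / \<beta>"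
      by (rule reciprocal_contraction[OF _ k co(1)]) (use \<beta> in auto)
    then show ?thesis using co co' \<kappa>' by simp
  qed
  then show ?thesis using that \<beta> by blast
qed

lemma end_dist_expansion:
  obtains \<beta> \<delta> where "1 < \<beta>" "0 < \<delta>" "\<And>x. x \<in> X \<Longrightarrow> end_dist x < \<delta> \<Longrightarrow> \<beta> * end_dist x \<le> end_dist (T x)"
proof -
  have "\<exists>\<beta> \<delta>. 1 < \<beta> \<and> 0 < \<delta> \<and> (\<forall>x\<in>side_at e. end_dist x < \<delta> \<longrightarrow> \<beta> * end_dist x \<le> end_dist (T x))" if e: "e \<in> {0, 1}" for e
  proof -
    obtain \<kappa>' where f: "folded_branch (\<lambda>s. \<bar>T \<bar>e - s\<bar> - T e\<bar>) (\<lambda>s. \<bar>D01 T \<bar>e - s\<bar>\<bar>) \<bar>c - e\<bar> \<kappa>'"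
      using folded[OF e] by metis
    interpret folded_branch "\<lambda>s. \<bar>T \<bar>e - s\<bar> - T e\<bar>" "\<lambda>s. \<bar>D01 T \<bar>e - s\<bar>\<bar>" "\<bar>c - e\<bar>" \<kappa>' by fact
    have "1 < \<bar>D01 T \<bar>e - 0\<bar>\<bar>" using e repelling by auto
    then obtain \<beta> \<delta> where \<beta>: "1 < \<beta>" and \<delta>: "0 < \<delta>" "\<delta> \<le> \<bar>c - e\<bar>"
      and b: "\<And>s. s \<in> {0<..<\<delta>} \<Longrightarrow> \<beta> * s \<le> \<bar>T \<bar>e - s\<bar> - T e\<bar>" "\<And>s. s \<in> {0<..<\<delta>} \<Longrightarrow> \<bar>T \<bar>e - s\<bar> - T e\<bar> \<le> 1 / 2"
      using expanding_near_0 by metis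
    have Te: "T e \<in> {0, 1}" using ends e by auto
    \<comment> \<open>A point of the side at \<open>e\<close> is more than
      \<open>1 - \<bar>c - e\<bar>\<close> away from the other endpoint, so below this threshold
      \<open>end_dist x\<close> is the distance from \<open>e\<close>.\<close>
    have "\<beta> * end_dist x \<le> end_dist (T x)" if x: "x \<in> side_at e" and d: "end_dist x < min \<delta> (1 - \<bar>c - e\<bar>)" for x
    proof -
      note co = side_at_coordinate[OF e x]
      have x01: "0 < x" "x < 1" using co(4) by (auto simp: X_def)
      have ed: "end_dist x = min \<bar>x - e\<bar> (1 - \<bar>x - e\<bar>)" by (rule end_dist_side[OF e x01])
      then have "end_dist x = \<bar>x - e\<bar>" using d co(1) by (auto simp: min_def split: if_splits)
      then have s: "\<bar>x - e\<bar> \<in> {0<..<\<delta>}" using d co(1) by auto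
      have "end_dist (T x) = min \<bar>T x - T e\<bar> (1 - \<bar>T x - T e\<bar>)"
        using in_01[OF co(4)] Te by (intro end_dist_side) auto
      moreover have "\<bar>T x - T e\<bar> \<le> 1 / 2" "\<beta> * \<bar>x - e\<bar> \<le> \<bar>T x - T e\<bar>" using b[OF s] co(2) by auto
      ultimately show ?thesis using \<open>end_dist x = \<bar>x - e\<bar>\<close> by (simp add: min_def)
    qed
    moreover have "0 < min \<delta> (1 - \<bar>c - e\<bar>)" using \<delta> e c_pos c_less by auto
    ultimately show ?thesis using \<beta> by blast
  qed
  then obtain \<beta>0 \<delta>0 \<beta>1 \<delta>1 where 0: "1 < \<beta>0" "0 < \<delta>0" "\<And>x. x \<in> side_at 0 \<Longrightarrow> end_dist x < \<delta>0 \<Longrightarrow> \<beta>0 * end_dist x \<le> end_dist (T x)"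
    and 1: "1 < \<beta>1" "0 < \<delta>1" "\<And>x. x \<in> side_at 1 \<Longrightarrow> end_dist x < \<delta>1 \<Longrightarrow> \<beta>1 * end_dist x \<le> end_dist (T x)"
    by (metis insertCI)
  have "min \<beta>0 \<beta>1 * end_dist x \<le> end_dist (T x)" if x: "x \<in> X" and d: "end_dist x < min \<delta>0 \<delta>1" for x
  proof -
    obtain e where e: "e \<in> {0, 1}" "x \<in> side_at e" using X_side_at[OF x] .
    have "min \<beta>0 \<beta>1 * end_dist x \<le> \<beta>0 * end_dist x" "min \<beta>0 \<beta>1 * end_dist x \<le> \<beta>1 * end_dist x"
      using end_dist_X[OF x] by (auto intro: mult_right_mono)
    then show ?thesis using 0(3)[of x] 1(3)[of x] e d by auto
  qed
  then show ?thesis using that[of "min \<beta>0 \<beta>1" "min \<delta>0 \<delta>1"] 0 1 by auto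
qed

text \<open>The image can be near \<open>T e\<close> only if the argument is near \<open>e\<close>,
  which \<delta> and monotonicity exclude. It can be near the opposite endpoint only if the argument
  is near \<open>c\<close>, and then at the polynomial rate given by \<open>growth\<close>.\<close>

lemma end_dist_middle:
  assumes \<delta>: "0 < \<delta>"
  obtains k where "0 < k" "\<And>x. x \<in> X \<Longrightarrow> \<delta> \<le> end_dist x \<Longrightarrow> k * \<bar>x - c\<bar> powr r \<le> end_dist (T x)"
proof -
  obtain K where K: "0 < K" "\<And>e s. e \<in> {0, 1} \<Longrightarrow> s \<in> {0<..<\<bar>c - e\<bar>} \<Longrightarrow> K * (\<bar>c - e\<bar> - s) powr (r - 1) \<le> \<bar>D01 T \<bar>e - s\<bar>\<bar>"
    using growth_constant by blast
  have "\<exists>k>0. \<forall>x\<in>side_at e. \<delta> \<le> end_dist x \<longrightarrow> k * \<bar>x - c\<bar> powr r \<le> end_dist (T x)" if e: "e \<in> {0, 1}" for e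
  proof -
    have Te: "T e \<in> {0, 1}" using ends e by auto
    obtain \<kappa>' where f: "folded_branch (\<lambda>s. \<bar>T \<bar>e - s\<bar> - T e\<bar>) (\<lambda>s. \<bar>D01 T \<bar>e - s\<bar>\<bar>) \<bar>c - e\<bar> \<kappa>'" and \<kappa>': "\<kappa>' \<le> 1"
      using folded[OF e] by metis
    interpret folded_branch "\<lambda>s. \<bar>T \<bar>e - s\<bar> - T e\<bar>" "\<lambda>s. \<bar>D01 T \<bar>e - s\<bar>\<bar>" "\<bar>c - e\<bar>" \<kappa>' by fact
    \<comment> \<open>If \<open>\<delta> \<ge> \<bar>c - e\<bar>\<close>, no point of this side
      satisfies the condition on \<open>end_dist\<close>, and \<open>1\<close> is a harmless
      positive default.\<close>
    define m where "m = (if \<delta> < \<bar>c - e\<bar> then \<bar>T \<bar>e - \<delta>\<bar> - T e\<bar> else 1)"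
    have m: "0 < m" using range[of \<delta>] \<delta> by (auto simp: m_def)
    have "min m (K / r) * \<bar>x - c\<bar> powr r \<le> end_dist (T x)" if x: "x \<in> side_at e" and d: "\<delta> \<le> end_dist x" for x
    proof -
      note co = side_at_coordinate[OF e x]
      have x01: "0 < x" "x < 1" using co(4) by (auto simp: X_def)
      have ed: "end_dist x = min \<bar>x - e\<bar> (1 - \<bar>x - e\<bar>)" by (rule end_dist_side[OF e x01])
      then have s: "\<delta> \<le> \<bar>x - e\<bar>" using d by simp
      then have \<delta>': "\<delta> < \<bar>c - e\<bar>" using co(1) by auto
      have "\<bar>T \<bar>e - \<delta>\<bar> - T e\<bar> \<le> \<bar>T \<bar>e - \<bar>x - e\<bar>\<bar> - T e\<bar>"
        using strict_mono[of \<delta> "\<bar>x - e\<bar>"] s co(1) \<delta> by (cases "\<delta> = \<bar>x - e\<bar>") auto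
      then have 1: "m \<le> \<bar>T x - T e\<bar>" using \<delta>' co(2) by (simp add: m_def)
      have "K / r * (\<bar>c - e\<bar> - \<bar>x - e\<bar>) powr r \<le> \<kappa>' - \<bar>T \<bar>e - \<bar>x - e\<bar>\<bar> - T e\<bar>"
        by (rule growth[OF _ _ K(2)[OF e(1)] co(1)]) (use r_ge K in auto)
      then have 2: "K / r * \<bar>x - c\<bar> powr r \<le> 1 - \<bar>T x - T e\<bar>" using co \<kappa>' by simp
      have "end_dist (T x) = min \<bar>T x - T e\<bar> (1 - \<bar>T x - T e\<bar>)"
        using in_01[OF co(4)] Te by (intro end_dist_side) auto
      moreover have "\<bar>x - c\<bar> powr r \<le> 1" using co(4) c_pos c_less r_ge by (intro powr_le1) (auto simp: X_def)
      then have "min m (K / r) * \<bar>x - c\<bar> powr r \<le> m * 1" using m K r_ge by (intro mult_mono) auto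
      moreover have "min m (K / r) * \<bar>x - c\<bar> powr r \<le> K / r * \<bar>x - c\<bar> powr r" by (intro mult_right_mono) auto
      ultimately show ?thesis using 1 2 by simp
    qed
    moreover have "0 < min m (K / r)" using m K r_ge by auto
    ultimately show ?thesis by blast
  qed
  then obtain k0 k1 where 0: "0 < k0" "\<And>x. x \<in> side_at 0 \<Longrightarrow> \<delta> \<le> end_dist x \<Longrightarrow> k0 * \<bar>x - c\<bar> powr r \<le> end_dist (T x)"
    and 1: "0 < k1" "\<And>x. x \<in> side_at 1 \<Longrightarrow> \<delta> \<le> end_dist x \<Longrightarrow> k1 * \<bar>x - c\<bar> powr r \<le> end_dist (T x)"
    by (metis insertCI)
  have "min k0 k1 * \<bar>x - c\<bar> powr r \<le> end_dist (T x)" if x: "x \<in> X" and d: "\<delta> \<le> end_dist x" for x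
  proof -
    obtain e where e: "e \<in> {0, 1}" "x \<in> side_at e" using X_side_at[OF x] .
    have "min k0 k1 * \<bar>x - c\<bar> powr r \<le> k0 * \<bar>x - c\<bar> powr r" "min k0 k1 * \<bar>x - c\<bar> powr r \<le> k1 * \<bar>x - c\<bar> powr r"
      by (auto intro: mult_right_mono)
    then show ?thesis using 0(2)[of x] 1(2)[of x] e d by auto
  qed
  then show ?thesis using that[of "min k0 k1"] 0 1 by auto
qed

end

section \<open>Transfer operator of the random map\<close>

lemma branch_transfer_linear:
  "branch_transfer T I (\<lambda>x. a * u x + b * v x) z = a * branch_transfer T I u z + b * branch_transfer T I v z"
  by (simp add: branch_transfer_def add_divide_distrib)

locale random_branches = punctured_interval +
  fixes N :: nat and T :: "nat \<Rightarrow> real \<Rightarrow> real" and r :: "nat \<Rightarrow> real" and Bad :: "nat set"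
  assumes branch: "j \<in> {1..N} \<Longrightarrow> branch_map c (T j) (r j)"
    and Bad_subset: "Bad \<subseteq> {1..N}" and Bad_nonempty: "Bad \<noteq> {}" and Good_nonempty: "{1..N} - Bad \<noteq> {}"
    and bad_image: "j \<in> Bad \<Longrightarrow> I \<in> sides \<Longrightarrow> T j ` I \<in> sides"
    and good_image: "j \<in> {1..N} - Bad \<Longrightarrow> I \<in> sides \<Longrightarrow> T j ` I = {0<..<1}"
    and bad_exponent: "j \<in> Bad \<Longrightarrow> 1 < r j"
begin

text \<open>The annealed transfer operator: the Perron-Frobenius operators of the maps, averaged
  with the weights \<open>q\<close>.\<close>

definition transfer :: "(nat \<Rightarrow> real) \<Rightarrow> (real \<Rightarrow> real) \<Rightarrow> real \<Rightarrow> real" where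
  "transfer q u z = (\<Sum>j=1..N. q j * (\<Sum>I\<in>sides. branch_transfer (T j) I u z))"

text \<open>The value \<open>0\<close> outside \<^term>\<open>X\<close> keeps iterates Borel measurable: nothing is known about the maps outside
  \<open>[0,1]\<close>.\<close>

definition koopman :: "(nat \<Rightarrow> real) \<Rightarrow> (real \<Rightarrow> real) \<Rightarrow> real \<Rightarrow> real" where
  "koopman q h x = (if x \<in> X then \<Sum>j=1..N. q j * h (T j x) else 0)"

context
  fixes j I assumes j: "j \<in> {1..N}" and I: "I \<in> sides"
begin

interpretation branch_map c "T j" "r j" by (rule branch[OF j])

lemma branch_facts:
  shows "nonpos_schwarzian_on (T j) I" "I \<subseteq> {0..1}" "open I" "convex I" "inj_on (T j) I" "T j ` I \<subseteq> {0<..<1}"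
  using schwarzian_side[OF I] side_01[OF I] side_open[OF I] side_convex[OF I] inj[OF I] image_01[OF I] .

text \<open>No image of a branch ends inside a side. Hence cone membership and continuity of
  transferred functions can be checked side by side, with the zero function on sides that are
  missed.\<close>

lemma branch_image_cases:
  assumes J: "J \<in> sides"
  obtains "J \<subseteq> T j ` I" | "J \<inter> T j ` I = {}"
proof (cases "j \<in> Bad")
  case True
  then have "T j ` I \<in> sides" using bad_image I by blast
  then show ?thesis using that J by (auto simp: sides_def)
next
  case False
  then have "T j ` I = {0<..<1}" using good_image I j by blast
  then show ?thesis using that(1) sides_X[OF J] by (auto simp: X_def)
qed

lemma cone_branch_transfer: "cone u \<Longrightarrow> cone (branch_transfer (T j) I u)"
  unfolding cone_def
proof
  fix J assume u: "\<forall>I\<in>sides. koebe_on I u" and J: "J \<in> sides"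
  have k: "koebe_on (T j ` I) (branch_transfer (T j) I u)"
    using koebe_on_branch_transfer[OF branch_facts(1,2,4,5)] u I by blast
  from J show "koebe_on J (branch_transfer (T j) I u)"
  proof (cases rule: branch_image_cases)
    case 1
    then show ?thesis using koebe_on_subset[OF k] by blast
  next
    case 2
    then show ?thesis
      by (intro koebe_on_cong[OF side_convex[OF J] koebe_on_zero]) (use 2 in \<open>simp add: disjoint_iff branch_transfer_outside\<close>)
  qed
qed

lemma continuous_branch_transfer:
  assumes u: "continuous_on X u"
  shows "continuous_on X (branch_transfer (T j) I u)"
proof -
  have "continuous_on I u" using u sides_X[OF I] by (rule continuous_on_subset)
  note k = continuous_on_branch_transfer(2)[OF branch_facts(1,2,3,5) this]
  have "continuous_on J (branch_transfer (T j) I u)" if J: "J \<in> sides" for J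
    using J
  proof (cases rule: branch_image_cases)
    case 1
    then show ?thesis using continuous_on_subset[OF k] by blast
  next
    case 2
    have "continuous_on J (\<lambda>z. 0 :: real)" by simp
    then show ?thesis by (rule continuous_on_eq) (use 2 in \<open>simp add: disjoint_iff branch_transfer_outside\<close>)
  qed
  then show ?thesis
    unfolding Union_sides[symmetric] by (intro continuous_on_open_Union side_open) auto
qed

lemma measurable_branch_transfer:
  assumes u: "continuous_on X u"
  shows "branch_transfer (T j) I u \<in> borel_measurable lebX"
  by (intro measurable_lebX_continuous continuous_branch_transfer u)

lemma integral_branch_transfer:
  assumes u: "continuous_on X u" "\<And>y. y \<in> X \<Longrightarrow> 0 \<le> u y"
    and h: "h \<in> borel_measurable borel" "\<And>z. 0 \<le> h z"
  shows "(\<integral>\<^sup>+z. ennreal (h z * branch_transfer (T j) I u z) \<partial>lebX)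
       = (\<integral>\<^sup>+y. ennreal (h (T j y) * u y) * indicator I y \<partial>lebX)"
proof -
  have uI: "continuous_on I u" "\<And>y. y \<in> I \<Longrightarrow> 0 \<le> u y"
    using u sides_X[OF I] by (auto intro: continuous_on_subset)
  have "(\<integral>\<^sup>+z. ennreal (h z * branch_transfer (T j) I u z) \<partial>lebX) =
      (\<integral>\<^sup>+z. ennreal (h z * branch_transfer (T j) I u z) * indicator (T j ` I) z \<partial>lborel)"
    unfolding nn_integral_lebX
  proof (rule nn_integral_cong_AE)
    \<comment> \<open>The image of a full branch contains \<open>c\<close>, which \<open>X\<close>
      omits; the two domains of integration differ by this null set.\<close>
    have "AE z in lborel. z \<noteq> c" by (rule AE_lborel_singleton)
    then show "AE z in lborel. ennreal (h z * branch_transfer (T j) I u z) * indicator X z =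
        ennreal (h z * branch_transfer (T j) I u z) * indicator (T j ` I) z"
    proof eventually_elim
      case (elim z)
      then show ?case
        using branch_facts(6) by (cases "z \<in> T j ` I") (auto simp: X_def indicator_def branch_transfer_outside)
    qed
  qed
  also have "\<dots> = (\<integral>\<^sup>+y. ennreal (h (T j y) * u y) * indicator I y \<partial>lborel)"
    by (rule nn_integral_branch_transfer[OF branch_facts(1,2,3,5) uI h])
  also have "\<dots> = (\<integral>\<^sup>+y. ennreal (h (T j y) * u y) * indicator I y \<partial>lebX)"
    unfolding nn_integral_lebX using sides_X[OF I] by (intro nn_integral_cong) (auto simp: indicator_def)
  finally show ?thesis .
qed

end

lemma continuous_T: "j \<in> {1..N} \<Longrightarrow> continuous_on X (T j)"
proof -
  assume j: "j \<in> {1..N}"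
  have "continuous_on J (T j)" if "J \<in> sides" for J
    using nonpos_schwarzian_on_derivs(4)[OF branch_facts(1,2)[OF j that]] .
  then show ?thesis
    unfolding Union_sides[symmetric] by (intro continuous_on_open_Union side_open) auto
qed

lemma measurable_compose_T:
  "j \<in> {1..N} \<Longrightarrow> h \<in> borel_measurable borel \<Longrightarrow> (\<lambda>x. h (T j x)) \<in> borel_measurable lebX" for h :: "real \<Rightarrow> real"
  using measurable_compose[OF measurable_lebX_continuous[OF continuous_T]] by blast

lemma finite_prob: "positive_prob_vector N q \<Longrightarrow> j \<in> {1..N} \<Longrightarrow> 0 < q j"
  and sum_prob: "positive_prob_vector N q \<Longrightarrow> (\<Sum>j=1..N. q j) = 1"
  by (auto simp: positive_prob_vector_def)

lemma prob_le_1: "positive_prob_vector N q \<Longrightarrow> j \<in> {1..N} \<Longrightarrow> q j \<le> 1"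
  using member_le_sum[of j "{1..N}" q] sum_prob[of q] finite_prob[of q] by (metis DiffD1 finite_atLeastAtMost less_imp_le)

lemma transfer_linear:
  "transfer q (\<lambda>x. a * u x + b * v x) z = a * transfer q u z + b * transfer q v z"
  unfolding transfer_def
  by (simp add: branch_transfer_linear sum.distrib sum_distrib_left algebra_simps)

lemma cone_transfer:
  assumes q: "positive_prob_vector N q" and u: "cone u"
  shows "cone (transfer q u)"
  unfolding transfer_def
  by (intro cone_sum cone_mult cone_branch_transfer u less_imp_le finite_prob[OF q]) auto

lemma continuous_transfer: "continuous_on X u \<Longrightarrow> continuous_on X (transfer q u)"
  unfolding transfer_def by (intro continuous_intros continuous_branch_transfer) auto

text \<open>At a given point the operator is a finite sum of evaluations at preimages, all of which
  lie in \<open>X\<close>; pointwise convergence of functions and weights therefore passes through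
  without domination.\<close>

lemma transfer_tendsto:
  assumes "\<And>x. x \<in> X \<Longrightarrow> (\<lambda>n. u n x) \<longlonglongrightarrow> v x" "\<And>j. j \<in> {1..N} \<Longrightarrow> (\<lambda>n. q n j) \<longlonglongrightarrow> p j"
  shows "(\<lambda>n. transfer (q n) (u n) z) \<longlonglongrightarrow> transfer p v z"
  unfolding transfer_def
proof (intro tendsto_sum tendsto_mult assms(2))
  fix j I assume j: "j \<in> {1..N}" and I: "I \<in> sides"
  show "(\<lambda>n. branch_transfer (T j) I (u n) z) \<longlonglongrightarrow> branch_transfer (T j) I v z"
  proof (cases "z \<in> T j ` I")
    case True
    then have "the_inv_into I (T j) z \<in> X"
      using the_inv_into_into[OF branch_facts(5)[OF j I] True order_refl] sides_X[OF I] by blast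
    then show ?thesis using True by (auto simp: branch_transfer_def divide_inverse intro!: tendsto_mult assms(1) tendsto_const)
  qed (simp add: branch_transfer_outside)
qed

lemma koopman_nonneg:
  "positive_prob_vector N q \<Longrightarrow> (\<And>z. 0 \<le> h z) \<Longrightarrow> 0 \<le> koopman q h x"
proof -
  assume q: "positive_prob_vector N q" and h: "\<And>z. 0 \<le> h z"
  have "0 \<le> (\<Sum>j=1..N. q j * h (T j x))"
    by (intro sum_nonneg mult_nonneg_nonneg h less_imp_le[OF finite_prob[OF q]])
  then show "0 \<le> koopman q h x" by (simp add: koopman_def)
qed

lemma koopman_measurable:
  assumes "h \<in> borel_measurable borel"
  shows "koopman q h \<in> borel_measurable borel"
proof -
  have "(\<lambda>x. \<Sum>j=1..N. q j * h (T j x)) \<in> borel_measurable (restrict_space borel X)"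
    using measurable_compose_T[OF _ assms] unfolding measurable_cong_sets[OF sets_lebX refl] by measurable
  then have "(\<lambda>x. indicator X x *\<^sub>R (\<Sum>j=1..N. q j * h (T j x))) \<in> borel_measurable borel"
    by (subst (asm) borel_measurable_restrict_space_iff) auto
  moreover have "koopman q h = (\<lambda>x. indicator X x *\<^sub>R (\<Sum>j=1..N. q j * h (T j x)))"
    by (auto simp: koopman_def indicator_def)
  ultimately show ?thesis by simp
qed

text \<open>Duality of the transfer and the Koopman operator. The change of variables is applied
  branch by branch, and the two sides of \<open>c\<close> together make up \<open>X\<close>.\<close>

lemma integral_transfer:
  assumes q: "positive_prob_vector N q" and u: "continuous_on X u" "\<And>y. y \<in> X \<Longrightarrow> 0 \<le> u y"
    and h: "h \<in> borel_measurable borel" "\<And>z. 0 \<le> h z"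
  shows "(\<integral>\<^sup>+z. ennreal (h z * transfer q u z) \<partial>lebX) = (\<integral>\<^sup>+y. ennreal (koopman q h y * u y) \<partial>lebX)"
proof -
  have hm: "h \<in> borel_measurable lebX" by (rule measurable_lebX_borel[OF h(1)])
  have um: "u \<in> borel_measurable lebX" by (rule measurable_lebX_continuous[OF u(1)])
  have q0: "0 \<le> q j" if "j \<in> {1..N}" for j using finite_prob[OF q that] by simp
  have b0: "0 \<le> branch_transfer (T j) I u z" if "j \<in> {1..N}" "I \<in> sides" for j I z
    by (rule branch_transfer_nonneg[OF branch_facts(5)[OF that]]) (use u(2) sides_X that in auto)
  have mb: "(\<lambda>z. ennreal (h z * branch_transfer (T j) I u z)) \<in> borel_measurable lebX" if "j \<in> {1..N}" "I \<in> sides" for j I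
    using hm measurable_branch_transfer[OF that u(1)] by measurable
  have side_ind: "(\<Sum>I\<in>sides. f * indicator I y) = f" if "y \<in> X" for f :: ennreal and y
  proof -
    have "c / 2 \<in> {0<..<c}" "c / 2 \<notin> {c<..<1}" using c_pos by auto
    then have "{0<..<c} \<noteq> {c<..<1}" by metis
    then have "(\<Sum>I\<in>sides. f * indicator I y) = f * indicator {0<..<c} y + f * indicator {c<..<1} y"
      unfolding sides_def by (subst sum.insert) (simp_all del: indicator_simps sum_mult_indicator)
    then show ?thesis using that by (cases "y < c") (auto simp: X_def indicator_def)
  qed
  have mi: "(\<lambda>y. ennreal (h (T j y) * u y)) \<in> borel_measurable lebX" if "j \<in> {1..N}" for j
    using measurable_compose_T[OF that h(1)] um by measurable
  have piece: "(\<Sum>I\<in>sides. \<integral>\<^sup>+z. ennreal (h z * branch_transfer (T j) I u z) \<partial>lebX) = (\<integral>\<^sup>+y. ennreal (h (T j y) * u y) \<partial>lebX)"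
    if j: "j \<in> {1..N}" for j
  proof -
    have "(\<Sum>I\<in>sides. \<integral>\<^sup>+z. ennreal (h z * branch_transfer (T j) I u z) \<partial>lebX) =
        (\<Sum>I\<in>sides. \<integral>\<^sup>+y. ennreal (h (T j y) * u y) * indicator I y \<partial>lebX)"
      by (intro sum.cong refl integral_branch_transfer j u h)
    also have "\<dots> = (\<integral>\<^sup>+y. (\<Sum>I\<in>sides. ennreal (h (T j y) * u y) * indicator I y) \<partial>lebX)"
    proof (rule nn_integral_sum[symmetric])
      fix I assume "I \<in> sides"
      then have "I \<in> sets lebX" using side_open[of I] sides_X[of I] by (auto simp: sets_restrict_space_iff)
      then show "(\<lambda>y. ennreal (h (T j y) * u y) * indicator I y) \<in> borel_measurable lebX"
        using mi[OF j] by measurable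
    qed
    also have "\<dots> = (\<integral>\<^sup>+y. ennreal (h (T j y) * u y) \<partial>lebX)"
      by (intro nn_integral_cong side_ind) simp
    finally show ?thesis .
  qed
  have "(\<integral>\<^sup>+z. ennreal (h z * transfer q u z) \<partial>lebX) =
      (\<integral>\<^sup>+z. (\<Sum>j=1..N. ennreal (q j) * (\<Sum>I\<in>sides. ennreal (h z * branch_transfer (T j) I u z))) \<partial>lebX)"
  proof (rule nn_integral_cong)
    fix z
    have "h z * transfer q u z = (\<Sum>j=1..N. q j * (\<Sum>I\<in>sides. h z * branch_transfer (T j) I u z))"
      by (simp add: transfer_def sum_distrib_left mult_ac)
    also have "ennreal \<dots> = (\<Sum>j=1..N. ennreal (q j * (\<Sum>I\<in>sides. h z * branch_transfer (T j) I u z)))"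
      by (rule sum_ennreal[symmetric]) (intro mult_nonneg_nonneg sum_nonneg q0 b0 h(2), auto)
    also have "\<dots> = (\<Sum>j=1..N. ennreal (q j) * (\<Sum>I\<in>sides. ennreal (h z * branch_transfer (T j) I u z)))"
    proof (rule sum.cong[OF refl])
      fix j assume j: "j \<in> {1..N}"
      have "ennreal (\<Sum>I\<in>sides. h z * branch_transfer (T j) I u z) = (\<Sum>I\<in>sides. ennreal (h z * branch_transfer (T j) I u z))"
        by (rule sum_ennreal[symmetric]) (intro mult_nonneg_nonneg b0 h(2) j)
      then show "ennreal (q j * (\<Sum>I\<in>sides. h z * branch_transfer (T j) I u z)) =
          ennreal (q j) * (\<Sum>I\<in>sides. ennreal (h z * branch_transfer (T j) I u z))"
        using q0[OF j] by (simp add: ennreal_mult')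
    qed
    finally show "ennreal (h z * transfer q u z) = (\<Sum>j=1..N. ennreal (q j) * (\<Sum>I\<in>sides. ennreal (h z * branch_transfer (T j) I u z)))" .
  qed
  also have "\<dots> = (\<Sum>j=1..N. ennreal (q j) * (\<Sum>I\<in>sides. \<integral>\<^sup>+z. ennreal (h z * branch_transfer (T j) I u z) \<partial>lebX))"
  proof -
    have ms: "(\<lambda>z. \<Sum>I\<in>sides. ennreal (h z * branch_transfer (T j) I u z)) \<in> borel_measurable lebX" if "j \<in> {1..N}" for j
      by (intro borel_measurable_sum mb that)
    have "(\<integral>\<^sup>+z. (\<Sum>j=1..N. ennreal (q j) * (\<Sum>I\<in>sides. ennreal (h z * branch_transfer (T j) I u z))) \<partial>lebX)
        = (\<Sum>j=1..N. \<integral>\<^sup>+z. ennreal (q j) * (\<Sum>I\<in>sides. ennreal (h z * branch_transfer (T j) I u z)) \<partial>lebX)"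
      by (intro nn_integral_sum borel_measurable_times_ennreal ms) auto
    also have "\<dots> = (\<Sum>j=1..N. ennreal (q j) * (\<integral>\<^sup>+z. (\<Sum>I\<in>sides. ennreal (h z * branch_transfer (T j) I u z)) \<partial>lebX))"
      by (intro sum.cong refl nn_integral_cmult ms)
    also have "\<dots> = (\<Sum>j=1..N. ennreal (q j) * (\<Sum>I\<in>sides. \<integral>\<^sup>+z. ennreal (h z * branch_transfer (T j) I u z) \<partial>lebX))"
      by (intro sum.cong refl arg_cong2[where f = "(*)"] nn_integral_sum mb)
    finally show ?thesis .
  qed
  also have "\<dots> = (\<Sum>j=1..N. ennreal (q j) * (\<integral>\<^sup>+y. ennreal (h (T j y) * u y) \<partial>lebX))"
    by (simp add: piece)
  also have "\<dots> = (\<integral>\<^sup>+y. (\<Sum>j=1..N. ennreal (q j) * ennreal (h (T j y) * u y)) \<partial>lebX)"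
  proof -
    have "(\<integral>\<^sup>+y. (\<Sum>j=1..N. ennreal (q j) * ennreal (h (T j y) * u y)) \<partial>lebX)
        = (\<Sum>j=1..N. \<integral>\<^sup>+y. ennreal (q j) * ennreal (h (T j y) * u y) \<partial>lebX)"
      by (intro nn_integral_sum borel_measurable_times_ennreal mi) auto
    also have "\<dots> = (\<Sum>j=1..N. ennreal (q j) * (\<integral>\<^sup>+y. ennreal (h (T j y) * u y) \<partial>lebX))"
      by (intro sum.cong refl nn_integral_cmult mi)
    finally show ?thesis ..
  qed
  also have "\<dots> = (\<integral>\<^sup>+y. ennreal (koopman q h y * u y) \<partial>lebX)"
  proof (rule nn_integral_cong)
    fix y assume "y \<in> space lebX"
    then have y: "y \<in> X" by simp
    have "(\<Sum>j=1..N. ennreal (q j) * ennreal (h (T j y) * u y)) = (\<Sum>j=1..N. ennreal (q j * (h (T j y) * u y)))"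
      using q0 by (intro sum.cong refl) (simp add: ennreal_mult')
    also have "\<dots> = ennreal (\<Sum>j=1..N. q j * (h (T j y) * u y))"
      by (rule sum_ennreal) (intro mult_nonneg_nonneg q0 h(2) u(2) y)
    also have "(\<Sum>j=1..N. q j * (h (T j y) * u y)) = koopman q h y * u y"
      using y by (simp add: koopman_def sum_distrib_right mult.assoc)
    finally show "(\<Sum>j=1..N. ennreal (q j) * ennreal (h (T j y) * u y)) = ennreal (koopman q h y * u y)" .
  qed
  finally show ?thesis .
qed

lemma koopman_1: "positive_prob_vector N q \<Longrightarrow> x \<in> X \<Longrightarrow> koopman q (\<lambda>x. 1) x = 1"
  by (simp add: koopman_def sum_prob[unfolded One_nat_def])

lemma transfer_mass:
  assumes q: "positive_prob_vector N q" and u: "continuous_on X u" "\<And>y. y \<in> X \<Longrightarrow> 0 \<le> u y"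
  shows "(\<integral>\<^sup>+z. ennreal (transfer q u z) \<partial>lebX) = (\<integral>\<^sup>+y. ennreal (u y) \<partial>lebX)"
proof -
  have "(\<integral>\<^sup>+z. ennreal (1 * transfer q u z) \<partial>lebX) = (\<integral>\<^sup>+y. ennreal (koopman q (\<lambda>x. 1) y * u y) \<partial>lebX)"
    by (rule integral_transfer[OF q u]) auto
  also have "\<dots> = (\<integral>\<^sup>+y. ennreal (u y) \<partial>lebX)"
    by (intro nn_integral_cong) (simp add: koopman_1[OF q])
  finally show ?thesis by simp
qed

lemma cone_transfer_power: "positive_prob_vector N q \<Longrightarrow> cone u \<Longrightarrow> cone ((transfer q ^^ n) u)"
  by (induction n) (auto intro: cone_transfer)

lemma transfer_power_mass:
  "positive_prob_vector N q \<Longrightarrow> cone u \<Longrightarrow>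
    (\<integral>\<^sup>+z. ennreal ((transfer q ^^ n) u z) \<partial>lebX) = (\<integral>\<^sup>+y. ennreal (u y) \<partial>lebX)"
  by (induction n)
    (simp_all add: transfer_mass cone_transfer_power cone_continuous cone_nonneg)

lemma integral_transfer_power:
  assumes q: "positive_prob_vector N q" and u: "cone u"
    and h: "h \<in> borel_measurable borel" "\<And>z. 0 \<le> h z"
  shows "(\<integral>\<^sup>+z. ennreal (h z * (transfer q ^^ n) u z) \<partial>lebX) = (\<integral>\<^sup>+y. ennreal ((koopman q ^^ n) h y * u y) \<partial>lebX)"
  using h
proof (induction n arbitrary: h)
  case (Suc n)
  note c = cone_transfer_power[OF q u, of n]
  have "(\<integral>\<^sup>+z. ennreal (h z * (transfer q ^^ Suc n) u z) \<partial>lebX) = (\<integral>\<^sup>+z. ennreal (koopman q h z * (transfer q ^^ n) u z) \<partial>lebX)"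
    using integral_transfer[OF q cone_continuous[OF c] cone_nonneg[OF c] Suc.prems] by simp
  also have "\<dots> = (\<integral>\<^sup>+z. ennreal ((koopman q ^^ n) (koopman q h) z * u z) \<partial>lebX)"
    by (rule Suc.IH) (auto intro: koopman_measurable koopman_nonneg[OF q] Suc.prems)
  finally show ?case by (simp add: funpow_swap1)
qed simp

end

section \<open>Tightness\<close>

lemma nn_integral_inverse_sqrt_finite:
  fixes p :: real
  shows "(\<integral>\<^sup>+x. ennreal (\<bar>x - p\<bar> powr (- 1 / 2)) * indicator {p - 1..p + 1} x \<partial>lborel) < \<infinity>"
proof -
  define g :: "real \<Rightarrow> ennreal" where "g y = ennreal (y powr (- 1 / 2)) * indicator {0..1} y" for y
  have [measurable]: "g \<in> borel_measurable borel" unfolding g_def by measurable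
  have "((\<lambda>x::real. x powr (- 1 / 2)) has_integral (1 powr (- 1 / 2 + 1) / (- 1 / 2 + 1))) {0..1}"
    by (rule has_integral_powr_from_0) auto
  then have "(\<integral>\<^sup>+y. g y \<partial>lborel) = ennreal (1 powr (- 1 / 2 + 1) / (- 1 / 2 + 1))"
    unfolding g_def by (intro nn_integral_has_integral_lebesgue') auto
  then have fin: "(\<integral>\<^sup>+y. g y \<partial>lborel) < \<infinity>" by simp
  have "(\<integral>\<^sup>+x. ennreal (\<bar>x - p\<bar> powr (- 1 / 2)) * indicator {p - 1..p + 1} x \<partial>lborel)
      \<le> (\<integral>\<^sup>+x. g (- p + 1 * x) + g (p + (- 1) * x) \<partial>lborel)"
    by (intro nn_integral_mono) (auto simp: g_def indicator_def abs_if split: if_splits)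
  also have "\<dots> = (\<integral>\<^sup>+x. g (- p + 1 * x) \<partial>lborel) + (\<integral>\<^sup>+x. g (p + (- 1) * x) \<partial>lborel)"
    by (rule nn_integral_add) measurable
  also have "\<dots> = (\<integral>\<^sup>+y. g y \<partial>lborel) + (\<integral>\<^sup>+y. g y \<partial>lborel)"
    using nn_integral_real_affine[of g 1 "- p"] nn_integral_real_affine[of g "- 1" p] by simp
  also have "\<dots> < \<infinity>" using fin by simp
  finally show ?thesis .
qed

text \<open>The crude estimate \<open>- ln t \<le> 4 * t powr (- 1 / 4)\<close>, squared, leaves an
  integrable singularity; \<open>s \<le> 2\<close> permits replacing the power \<open>s\<close> by
  the square.\<close>

lemma log_power_bound:
  fixes t :: real
  assumes "0 < t" "t \<le> 1" "0 \<le> D" "1 \<le> s" "s \<le> 2"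
  shows "(D - ln t) powr s \<le> (D + 4)\<^sup>2 * t powr (- 1 / 2)"
proof -
  have "t powr (1 / 4) \<le> 1" using assms by (intro powr_le1) auto
  then have t4: "1 \<le> t powr (- 1 / 4)" using assms powr_minus_divide[of t "1 / 4"] by (simp add: le_divide_eq)
  have lt: "ln t \<le> 0" using assms by simp
  have "ln (t powr (- 1 / 4)) \<le> t powr (- 1 / 4)" using ln_le_minus_one[of "t powr (- 1 / 4)"] assms by simp
  then have "- ln t \<le> 4 * t powr (- 1 / 4)" using assms by (simp add: ln_powr)
  moreover have "D \<le> D * t powr (- 1 / 4)" using t4 assms by (simp add: mult_le_cancel_left1)
  ultimately have a: "D - ln t \<le> (D + 4) * t powr (- 1 / 4)" by (simp add: algebra_simps)
  have a0: "0 \<le> D - ln t" using assms lt by linarith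
  have "(D - ln t) powr s \<le> ((D + 4) * t powr (- 1 / 4)) powr s"
    using a a0 assms by (intro powr_mono2) auto
  \<comment> \<open>Raising the exponent from \<open>s\<close> to \<open>2\<close> increases the
    power because the base is at least \<open>1\<close>.\<close>
  also have "\<dots> \<le> ((D + 4) * t powr (- 1 / 4)) powr 2"
  proof (rule powr_mono)
    have "1 * 1 \<le> (D + 4) * t powr (- 1 / 4)" using t4 assms by (intro mult_mono) auto
    then show "1 \<le> (D + 4) * t powr (- 1 / 4)" by simp
  qed (use assms in auto)
  also have "\<dots> = (D + 4)\<^sup>2 * (t powr (- 1 / 4))\<^sup>2" using assms by (simp add: powr_numeral power_mult_distrib)
  also have "(t powr (- 1 / 4))\<^sup>2 = t powr (- 1 / 2)" using assms by (simp add: powr_power)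
  finally show ?thesis .
qed

context punctured_interval
begin

lemma log_power_integral_finite:
  assumes p: "p \<in> {0..1}" and "0 \<le> D" "1 \<le> s" "s \<le> 2"
  shows "(\<integral>\<^sup>+x. ennreal ((D - ln \<bar>x - p\<bar>) powr s) \<partial>lebX) < \<infinity>"
proof -
  have "(\<integral>\<^sup>+x. ennreal ((D - ln \<bar>x - p\<bar>) powr s) \<partial>lebX) \<le>
      (\<integral>\<^sup>+x. ennreal ((D + 4)\<^sup>2) * (ennreal (\<bar>x - p\<bar> powr (- 1 / 2)) * indicator {p - 1..p + 1} x) \<partial>lborel)"
    unfolding nn_integral_lebX
  proof (rule nn_integral_mono_AE)
    have "AE x in lborel. x \<noteq> p" by (rule AE_lborel_singleton)
    then show "AE x in lborel. ennreal ((D - ln \<bar>x - p\<bar>) powr s) * indicator X x \<le>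
        ennreal ((D + 4)\<^sup>2) * (ennreal (\<bar>x - p\<bar> powr (- 1 / 2)) * indicator {p - 1..p + 1} x)"
    proof eventually_elim
      case (elim x)
      show ?case
      proof (cases "x \<in> X")
        case True
        then have "0 < \<bar>x - p\<bar>" "\<bar>x - p\<bar> \<le> 1" "x \<in> {p - 1..p + 1}" using elim p by (auto simp: X_def)
        then have "ennreal ((D - ln \<bar>x - p\<bar>) powr s) \<le> ennreal ((D + 4)\<^sup>2 * \<bar>x - p\<bar> powr (- 1 / 2))"
          using assms by (intro ennreal_leI log_power_bound) auto
        then show ?thesis using True \<open>x \<in> {p - 1..p + 1}\<close> by (simp add: ennreal_mult)
      qed simp
    qed
  qed
  also have "\<dots> = ennreal ((D + 4)\<^sup>2) * (\<integral>\<^sup>+x. ennreal (\<bar>x - p\<bar> powr (- 1 / 2)) * indicator {p - 1..p + 1} x \<partial>lborel)"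
    by (rule nn_integral_cmult) measurable
  also have "\<dots> < \<infinity>" using nn_integral_inverse_sqrt_finite[of p] by (simp add: ennreal_mult_less_top)
  finally show ?thesis .
qed

end

section \<open>Drift of the logarithmic weights under a single map\<close>

context branch_map
begin

text \<open>The logarithm of \<open>k * \<bar>x - c\<bar> powr r \<le> \<bar>T x - c\<bar>\<close>
  costs an additive \<open>- ln k\<close>, which the shift absorbs as soon as
  \<open>D * (r - 1) \<ge> - ln k\<close>. The eventual form lets one \<open>D\<close> serve
  finitely many maps.\<close>

lemma log_dist_c_drift:
  assumes bad: "\<forall>I\<in>sides. T ` I \<in> sides" and r1: "1 < r"
  shows "\<forall>\<^sub>F D in at_top. \<forall>x\<in>X. D - ln \<bar>T x - c\<bar> \<le> r * (D - ln \<bar>x - c\<bar>)"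
proof -
  obtain k where k: "0 < k" "\<And>x. x \<in> X \<Longrightarrow> k * \<bar>x - c\<bar> powr r \<le> \<bar>T x - c\<bar>"
    using image_dist_c_lower[OF bad] by blast
  have "D - ln \<bar>T x - c\<bar> \<le> r * (D - ln \<bar>x - c\<bar>)" if D: "D \<ge> - ln k / (r - 1)" and x: "x \<in> X" for D x
  proof -
    have xc: "0 < \<bar>x - c\<bar>" using x by (auto simp: X_def)
    then have pos: "0 < k * \<bar>x - c\<bar> powr r" using k(1) by simp
    then have "ln (k * \<bar>x - c\<bar> powr r) \<le> ln \<bar>T x - c\<bar>"
      using k(2)[OF x] less_le_trans[OF pos k(2)[OF x]] by (subst ln_le_cancel_iff)
    then have "ln k + r * ln \<bar>x - c\<bar> \<le> ln \<bar>T x - c\<bar>" using k(1) xc by (simp add: ln_mult ln_powr)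
    moreover have "- ln k \<le> D * (r - 1)" using D r1 pos_divide_le_eq[of "r - 1" "- ln k" D] by linarith
    ultimately show ?thesis by (simp add: algebra_simps)
  qed
  then show ?thesis unfolding eventually_at_top_linorder by blast
qed

text \<open>Close to an endpoint the logarithmic distance falls by at least
  \<open>\<eta> = ln \<beta>\<close>, so its \<open>s\<close>-th power falls by at least \<eta>
  times its \<open>(s - 1)\<close>-th power. Elsewhere \<open>end_dist_middle\<close> bounds the new
  value by a multiple of \<open>D - ln \<bar>x - c\<bar>\<close>.\<close>

lemma log_end_dist_drift:
  assumes D: "1 \<le> D" and s: "1 < s"
  obtains \<eta> H where "0 < \<eta>" "0 \<le> H"
    "\<And>x. x \<in> X \<Longrightarrow> (- ln (end_dist (T x))) powr s + \<eta> * (- ln (end_dist x)) powr (s - 1)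
      \<le> (- ln (end_dist x)) powr s + H * (D - ln \<bar>x - c\<bar>) powr s"
proof -
  obtain \<beta> \<delta> where \<beta>: "1 < \<beta>" and \<delta>: "0 < \<delta>" and exp: "\<And>x. x \<in> X \<Longrightarrow> end_dist x < \<delta> \<Longrightarrow> \<beta> * end_dist x \<le> end_dist (T x)"
    using end_dist_expansion by blast
  obtain k where k: "0 < k" "\<And>x. x \<in> X \<Longrightarrow> \<delta> \<le> end_dist x \<Longrightarrow> k * \<bar>x - c\<bar> powr r \<le> end_dist (T x)"
    using end_dist_middle[OF \<delta>] by blast
  define \<eta> where "\<eta> = ln \<beta>"
  have \<eta>: "\<eta> > 0" using \<beta> by (simp add: \<eta>_def)
  define H1 where "H1 = \<bar>ln k\<bar> + r"
  define H where "H = H1 powr s + \<eta> * \<bar>ln \<delta>\<bar> powr (s - 1)"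
  have H: "0 \<le> H" using \<eta> by (simp add: H_def)
  have ed: "0 < end_dist z \<and> end_dist z \<le> 1 / 2" if "z \<in> {0<..<1}" for z :: real
    using that by (auto simp: end_dist_def min_def)
  have "(- ln (end_dist (T x))) powr s + \<eta> * (- ln (end_dist x)) powr (s - 1)
      \<le> (- ln (end_dist x)) powr s + H * (D - ln \<bar>x - c\<bar>) powr s" if x: "x \<in> X" for x
  proof -
    define E E' a where "E = - ln (end_dist x)" and "E' = - ln (end_dist (T x))" and "a = D - ln \<bar>x - c\<bar>"
    have dx: "0 < end_dist x" "end_dist x \<le> 1 / 2" and dT: "0 < end_dist (T x)" "end_dist (T x) \<le> 1 / 2"
      using end_dist_X[OF x] ed[OF in_01[OF x]] by auto
    have E0: "0 < E" "0 < E'" unfolding E_def E'_def using dx dT by auto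
    have xc: "0 < \<bar>x - c\<bar>" "\<bar>x - c\<bar> \<le> 1" using x c_pos c_less by (auto simp: X_def)
    have "ln \<bar>x - c\<bar> \<le> 0" using xc by simp
    then have a1: "1 \<le> a" "- ln \<bar>x - c\<bar> \<le> a" "0 \<le> - ln \<bar>x - c\<bar>" unfolding a_def using D by linarith+
    have p: "t powr s = t * t powr (s - 1)" if "0 < t" for t :: real
      using that powr_add[of t 1 "s - 1"] by simp
    have "E' powr s + \<eta> * E powr (s - 1) \<le> E powr s + H * a powr s"
    proof (cases "end_dist x < \<delta>")
      case True
      have "ln (\<beta> * end_dist x) \<le> ln (end_dist (T x))"
        using exp[OF x True] dx dT \<beta> by (subst ln_le_cancel_iff) auto
      then have E'E: "E' \<le> E - \<eta>" using \<beta> dx by (simp add: E_def E'_def \<eta>_def ln_mult)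
      \<comment> \<open>One factor \<open>E'\<close> is bounded by \<open>E - \<eta>\<close>, the
        remaining power by that of \<open>E\<close>; this is the source of the gain of order
        \<open>s - 1\<close>.\<close>
      have "E' powr s = E' * E' powr (s - 1)" by (rule p[OF E0(2)])
      also have "\<dots> \<le> (E - \<eta>) * E powr (s - 1)"
        using E'E E0 \<eta> s by (intro mult_mono powr_mono2) auto
      also have "\<dots> = E powr s - \<eta> * E powr (s - 1)" using p[OF E0(1)] by (simp add: algebra_simps)
      finally have "E' powr s + \<eta> * E powr (s - 1) \<le> E powr s" by simp
      then show ?thesis using H by (simp add: add_increasing2)
    next
      case False
      then have d: "\<delta> \<le> end_dist x" by simp
      have "ln (k * \<bar>x - c\<bar> powr r) \<le> ln (end_dist (T x))"
        using k(2)[OF x d] dT k(1) xc by (subst ln_le_cancel_iff) auto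
      then have "E' \<le> - ln k + r * (- ln \<bar>x - c\<bar>)" using k(1) xc by (simp add: E'_def ln_mult ln_powr)
      also have "\<dots> \<le> \<bar>ln k\<bar> * a + r * a"
        using a1 r_ge mult_left_mono[of 1 a "\<bar>ln k\<bar>"] by (intro add_mono mult_left_mono) auto
      finally have "E' \<le> H1 * a" by (simp add: H1_def algebra_simps)
      then have "E' powr s \<le> (H1 * a) powr s" using E0 s by (intro powr_mono2) auto
      also have "\<dots> = H1 powr s * a powr s" by (rule powr_mult)
      finally have 1: "E' powr s \<le> H1 powr s * a powr s" .
      have "E \<le> \<bar>ln \<delta>\<bar>" unfolding E_def using d \<delta> dx by (auto simp: abs_if)
      then have "E powr (s - 1) \<le> \<bar>ln \<delta>\<bar> powr (s - 1)" using E0 s by (intro powr_mono2) auto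
      also have "\<dots> \<le> \<bar>ln \<delta>\<bar> powr (s - 1) * a powr s"
        using a1 s by (simp add: ge_one_powr_ge_zero mult_le_cancel_left1)
      finally have "\<eta> * E powr (s - 1) \<le> \<eta> * (\<bar>ln \<delta>\<bar> powr (s - 1) * a powr s)" using \<eta> by (intro mult_left_mono) auto
      with 1 have "E' powr s + \<eta> * E powr (s - 1) \<le> H * a powr s" by (simp add: H_def algebra_simps)
      then show ?thesis by (simp add: add_increasing)
    qed
    then show ?thesis by (simp add: E_def E'_def a_def)
  qed
  then show ?thesis using that \<eta> H by blast
qed

end

context random_branches
begin

text \<open>A common bound \<theta>, instead of a strict inequality for each vector, makes the
  constants below independent of \<open>q\<close> and persists under limits of probability
  vectors.\<close>

definition admissible :: "real \<Rightarrow> (nat \<Rightarrow> real) \<Rightarrow> bool" where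
  "admissible \<theta> q \<longleftrightarrow> positive_prob_vector N q \<and> (\<Sum>b\<in>Bad. q b * r b) \<le> \<theta>"

lemma finite_Bad [simp]: "finite Bad"
  using Bad_subset finite_subset by blast

lemma admissible_prob: "admissible \<theta> q \<Longrightarrow> positive_prob_vector N q"
  by (simp add: admissible_def)

text \<open>The exponent \<open>s = 1\<close> would suffice near \<open>c\<close>. Near \<open>0\<close> and \<open>1\<close> the maps only decrease the logarithm of the
  distance by a constant, and it is the derivative of the \<open>s\<close>-th power, unbounded for \<open>s > 1\<close>, that gives tightness.\<close>

lemma bad_power_sum:
  assumes \<theta>: "\<theta> < 1"
  obtains s \<alpha> where "1 < s" "s \<le> 2" "0 \<le> \<alpha>" "\<alpha> < 1" "\<And>q. admissible \<theta> q \<Longrightarrow> (\<Sum>b\<in>Bad. q b * r b powr s) \<le> \<alpha>"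
proof -
  define L where "L = (\<Sum>b\<in>Bad. r b)"
  have rL: "r b \<le> L" if "b \<in> Bad" for b
    unfolding L_def using that bad_exponent by (intro member_le_sum) (auto intro: less_imp_le order_trans[OF _ less_imp_le, of 0 1])
  have L: "1 < L" using rL bad_exponent Bad_nonempty by fastforce
  \<comment> \<open>Since every bad exponent is at most \<open>L\<close>,
    \<open>r b powr s \<le> r b * L powr (s - 1)\<close>, and \<open>t * L powr (s - 1)\<close>
    tends to \<open>t < 1\<close> as \<open>s\<close> decreases to \<open>1\<close>. Replacing
    \<theta> by \<open>max \<theta> 0\<close> keeps \<alpha> nonnegative.\<close>
  define t where "t = max \<theta> 0"
  have t: "0 \<le> t" "t < 1" "\<theta> \<le> t" using \<theta> by (auto simp: t_def)
  have "((\<lambda>s. t * L powr (s - 1)) \<longlongrightarrow> t * L powr (1 - 1)) (at_right 1)"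
    using L by (intro tendsto_intros) auto
  then have "\<forall>\<^sub>F s in at_right 1. t * L powr (s - 1) < 1"
    using t L by (intro order_tendstoD(2)) auto
  moreover have "\<forall>\<^sub>F s in at_right (1::real). s \<in> {1<..<2}" by (rule eventually_at_right_real) simp
  ultimately have "\<exists>s. t * L powr (s - 1) < 1 \<and> s \<in> {1<..<2}"
    by (intro eventually_happens'[OF trivial_limit_at_right_real] eventually_conj)
  then obtain s where s: "t * L powr (s - 1) < 1" "s \<in> {1<..<2}" by blast
  have "(\<Sum>b\<in>Bad. q b * r b powr s) \<le> t * L powr (s - 1)" if q: "admissible \<theta> q" for q
  proof -
    have "(\<Sum>b\<in>Bad. q b * r b powr s) \<le> (\<Sum>b\<in>Bad. (q b * r b) * L powr (s - 1))"
    proof (rule sum_mono)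
      fix b assume b: "b \<in> Bad"
      have rb: "1 < r b" by (rule bad_exponent[OF b])
      have q0: "0 \<le> q b" using finite_prob[OF admissible_prob[OF q]] b Bad_subset by (meson less_imp_le subsetD)
      have "r b powr s = r b * r b powr (s - 1)" using rb powr_add[of "r b" 1 "s - 1"] by simp
      also have "\<dots> \<le> r b * L powr (s - 1)" using rb rL[OF b] s by (intro mult_left_mono powr_mono2) auto
      finally show "q b * r b powr s \<le> (q b * r b) * L powr (s - 1)" using q0 by (simp add: mult.assoc mult_left_mono)
    qed
    also have "\<dots> = (\<Sum>b\<in>Bad. q b * r b) * L powr (s - 1)" by (simp add: sum_distrib_right)
    also have "\<dots> \<le> t * L powr (s - 1)" using q t by (intro mult_right_mono) (auto simp: admissible_def)
    finally show ?thesis .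
  qed
  then show ?thesis using that[of s "t * L powr (s - 1)"] s t by auto
qed

text \<open>A good map sends regular points to \<open>c\<close>, where the weight is infinite, so there is no pointwise drift
  inequality; but its transfer operator yields a Koebe function on all of \<open>(0,1)\<close>, which is bounded near \<open>c\<close>.\<close>

lemma good_branch_integral:
  assumes j: "j \<in> {1..N} - Bad" and I: "I \<in> sides" and D: "1 \<le> D" and s: "1 \<le> s" "s \<le> 2"
  obtains C where "0 \<le> C" "\<And>u m. cone u \<Longrightarrow> (\<integral>\<^sup>+x. ennreal (u x) \<partial>lebX) \<le> ennreal m \<Longrightarrow> 0 \<le> m \<Longrightarrow>
    (\<integral>\<^sup>+y. ennreal ((D - ln \<bar>T j y - c\<bar>) powr s * u y) * indicator I y \<partial>lebX) \<le> ennreal (C * m)"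
proof -
  have jN: "j \<in> {1..N}" using j by simp
  \<comment> \<open>With a third of the distance to the endpoints, an interval of radius \<rho>
    around any point within \<rho> of \<open>c\<close> stays inside \<open>(0,1)\<close>, where the
    transferred function is Koebe.\<close>
  define \<rho> where "\<rho> = min c (1 - c) / 3"
  have \<rho>: "0 < \<rho>" "3 * \<rho> \<le> c" "3 * \<rho> \<le> 1 - c" using c_pos c_less by (auto simp: \<rho>_def)
  define w where "w z = (D - ln \<bar>z - c\<bar>) powr s" for z
  have wm: "w \<in> borel_measurable borel" unfolding w_def by measurable
  have w0: "0 \<le> w z" for z by (simp add: w_def)
  obtain W where W: "(\<integral>\<^sup>+x. ennreal (w x) \<partial>lebX) = ennreal W" "0 \<le> W"
    using log_power_integral_finite[of c D s] c_pos c_less D s unfolding w_def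
    by (cases "\<integral>\<^sup>+x. ennreal ((D - ln \<bar>x - c\<bar>) powr s) \<partial>lebX") auto
  define A0 where "A0 = (D - ln \<rho>) powr s"
  define C where "C = 4 / \<rho> * W + A0"
  have "(\<integral>\<^sup>+y. ennreal (w (T j y) * u y) * indicator I y \<partial>lebX) \<le> ennreal (C * m)"
    if u: "cone u" and m: "(\<integral>\<^sup>+x. ennreal (u x) \<partial>lebX) \<le> ennreal m" "0 \<le> m" for u m
  proof -
    define v where "v = branch_transfer (T j) I u"
    note cu = cone_continuous[OF u] cone_nonneg[OF u]
    have kv: "koebe_on {0<..<1} v"
      using koebe_on_branch_transfer[OF branch_facts(1,2,4,5)[OF jN I]] u I
      unfolding v_def good_image[OF j I] cone_def by blast
    have vm: "v \<in> borel_measurable lebX" unfolding v_def by (rule measurable_branch_transfer[OF jN I cu(1)])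
    have mv: "(\<integral>\<^sup>+z. ennreal (v z) \<partial>lebX) \<le> ennreal m"
    proof -
      have "(\<integral>\<^sup>+z. ennreal (1 * v z) \<partial>lebX) = (\<integral>\<^sup>+y. ennreal (1 * u y) * indicator I y \<partial>lebX)"
        unfolding v_def using integral_branch_transfer[OF jN I cu, of "\<lambda>_. 1"] by simp
      also have "\<dots> \<le> (\<integral>\<^sup>+y. ennreal (u y) \<partial>lebX)" by (intro nn_integral_mono) (auto simp: indicator_def)
      finally show ?thesis using m(1) by simp
    qed
    have vb: "v z \<le> 4 / \<rho> * m" if z: "\<bar>z - c\<bar> < \<rho>" for z
    proof -
      have sub: "{z-\<rho>..z+\<rho>} \<subseteq> {0<..<1}" using z \<rho> by (auto simp: abs_less_iff)
      have "ennreal (\<rho> * v z) \<le> 4 * (\<integral>\<^sup>+y. ennreal (v y) \<partial>lebX)"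
        by (rule koebe_on_integral_bound[OF kv sub \<rho>(1) order_refl])
      also have "\<dots> \<le> 4 * ennreal m" by (intro mult_left_mono mv) auto
      also have "\<dots> = ennreal (4 * m)" using m by (simp add: ennreal_mult')
      finally have "\<rho> * v z \<le> 4 * m" using m by (subst (asm) ennreal_le_iff) auto
      then show ?thesis using \<rho> by (simp add: field_simps)
    qed
    \<comment> \<open>Within \<rho> of \<open>c\<close> the density \<open>v\<close> is bounded and
      the weight is integrable; farther away the weight is bounded by \<open>A0\<close> and the
      density has mass at most \<open>m\<close>.\<close>
    have pw: "ennreal (w z * v z) \<le> ennreal (4 / \<rho> * m) * ennreal (w z) + ennreal A0 * ennreal (v z)" if z: "z \<in> X" for z
    proof -
      have v0: "0 \<le> v z" using koebe_on_nonneg[OF kv] z by (auto simp: X_def)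
      have "w z * v z \<le> 4 / \<rho> * m * w z + A0 * v z"
      proof (cases "\<bar>z - c\<bar> < \<rho>")
        case True
        then have "w z * v z \<le> w z * (4 / \<rho> * m)" by (intro mult_left_mono vb w0)
        then show ?thesis using v0 by (simp add: A0_def mult_ac add_increasing2)
      next
        case False
        have xc: "0 < \<bar>z - c\<bar>" "\<bar>z - c\<bar> \<le> 1" using z c_pos c_less by (auto simp: X_def)
        then have "ln \<bar>z - c\<bar> \<le> 0" by simp
        moreover have "ln \<rho> \<le> ln \<bar>z - c\<bar>" using False \<rho> xc by simp
        ultimately have "w z \<le> A0" unfolding w_def A0_def using s D by (intro powr_mono2) auto
        then have "w z * v z \<le> A0 * v z" using v0 by (rule mult_right_mono)
        moreover have "0 \<le> 4 / \<rho> * m * w z" using m \<rho> w0 by auto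
        ultimately show ?thesis by linarith
      qed
      then have "ennreal (w z * v z) \<le> ennreal (4 / \<rho> * m * w z + A0 * v z)" by (rule ennreal_leI)
      also have "\<dots> = ennreal (4 / \<rho> * m) * ennreal (w z) + ennreal A0 * ennreal (v z)"
      proof -
        have nn: "0 \<le> 4 / \<rho> * m" "0 \<le> A0" using m \<rho> by (auto simp: A0_def)
        have "ennreal (4 / \<rho> * m * w z + A0 * v z) = ennreal (4 / \<rho> * m * w z) + ennreal (A0 * v z)"
          using nn(2) mult_nonneg_nonneg[OF nn(1) w0] v0 by (intro ennreal_plus) auto
        then show ?thesis using ennreal_mult[OF nn(1) w0] ennreal_mult[OF nn(2) v0] by simp
      qed
      finally show ?thesis .
    qed
    have "(\<integral>\<^sup>+y. ennreal (w (T j y) * u y) * indicator I y \<partial>lebX) = (\<integral>\<^sup>+z. ennreal (w z * v z) \<partial>lebX)"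
      unfolding v_def by (rule integral_branch_transfer[OF jN I cu wm w0, symmetric])
    also have "\<dots> \<le> (\<integral>\<^sup>+z. ennreal (4 / \<rho> * m) * ennreal (w z) + ennreal A0 * ennreal (v z) \<partial>lebX)"
      by (rule nn_integral_mono, rule pw) simp
    also have "\<dots> = ennreal (4 / \<rho> * m) * ennreal W + ennreal A0 * (\<integral>\<^sup>+z. ennreal (v z) \<partial>lebX)"
      using vm measurable_lebX_borel[OF wm] by (subst nn_integral_add) (auto simp: nn_integral_cmult W)
    also have "\<dots> \<le> ennreal (4 / \<rho> * m) * ennreal W + ennreal A0 * ennreal m"
      by (intro add_mono mult_left_mono mv) auto
    also have "\<dots> = ennreal (C * m)"
    proof -
      have "ennreal (4 / \<rho> * m) * ennreal W = ennreal (4 / \<rho> * m * W)" using m \<rho> W by (intro ennreal_mult[symmetric]) auto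
      moreover have "ennreal A0 * ennreal m = ennreal (A0 * m)" using m by (intro ennreal_mult[symmetric]) (auto simp: A0_def)
      moreover have "0 \<le> 4 / \<rho> * m * W" "0 \<le> A0 * m" using m \<rho> W by (auto simp: A0_def)
      ultimately show ?thesis by (simp add: C_def algebra_simps flip: ennreal_plus)
    qed
    finally show ?thesis .
  qed
  moreover have "0 \<le> C" using \<rho> W by (auto simp: C_def A0_def)
  ultimately show ?thesis using that unfolding w_def by blast
qed

definition average :: "(nat \<Rightarrow> real) \<Rightarrow> (real \<Rightarrow> real) \<Rightarrow> nat \<Rightarrow> real \<Rightarrow> real" where
  "average q u n x = (1 / real (Suc n)) * (\<Sum>k<Suc n. (transfer q ^^ k) u x)"

lemma cone_average: "positive_prob_vector N q \<Longrightarrow> cone u \<Longrightarrow> cone (average q u n)"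
  unfolding average_def by (intro cone_mult cone_sum cone_transfer_power) auto

lemma integral_split_sides:
  assumes "f \<in> borel_measurable lebX"
  shows "(\<integral>\<^sup>+y. f y \<partial>lebX) = (\<Sum>I\<in>sides. \<integral>\<^sup>+y. f y * indicator I y \<partial>lebX)"
proof -
  have "c / 2 \<in> {0<..<c}" "c / 2 \<notin> {c<..<1}" using c_pos by auto
  then have ne: "{0<..<c} \<noteq> {c<..<1}" by metis
  have meas: "I \<in> sets lebX" if "I \<in> sides" for I
    using side_open[OF that] sides_X[OF that] by (auto simp: sets_restrict_space_iff)
  have "(\<integral>\<^sup>+y. f y \<partial>lebX) = (\<integral>\<^sup>+y. f y * indicator {0<..<c} y + f y * indicator {c<..<1} y \<partial>lebX)"
  proof (rule nn_integral_cong)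
    fix y assume "y \<in> space lebX"
    then show "f y = f y * indicator {0<..<c} y + f y * indicator {c<..<1} y"
      by (cases "y < c") (auto simp: X_def indicator_def)
  qed
  also have "\<dots> = (\<integral>\<^sup>+y. f y * indicator {0<..<c} y \<partial>lebX) + (\<integral>\<^sup>+y. f y * indicator {c<..<1} y \<partial>lebX)"
    using assms meas by (intro nn_integral_add) (auto simp: sides_def intro!: borel_measurable_times_ennreal)
  also have "\<dots> = (\<Sum>I\<in>sides. \<integral>\<^sup>+y. f y * indicator I y \<partial>lebX)"
    unfolding sides_def using ne by (subst sum.insert) simp_all
  finally show ?thesis .
qed

definition log_c_weight :: "real \<Rightarrow> real \<Rightarrow> real \<Rightarrow> real" where
  "log_c_weight D s z = (D - ln \<bar>z - c\<bar>) powr s"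

definition log_end_weight :: "real \<Rightarrow> real \<Rightarrow> real" where
  "log_end_weight s z = (- ln (end_dist z)) powr s"

lemma log_c_weight_measurable [measurable]: "log_c_weight D s \<in> borel_measurable borel"
  unfolding log_c_weight_def by measurable

lemma log_end_weight_measurable [measurable]: "log_end_weight s \<in> borel_measurable borel"
  unfolding log_end_weight_def end_dist_def by measurable

lemma log_c_weight_nonneg: "0 \<le> log_c_weight D s z"
  by (simp add: log_c_weight_def)

lemma log_end_weight_nonneg: "0 \<le> log_end_weight s z"
  by (simp add: log_end_weight_def)

text \<open>Bad maps multiply the weight pointwise by at most \<open>r b powr s\<close>, hence by at
  most \<alpha> on average. Good maps contribute integrals controlled by the mass alone; estimating
  their probabilities by \<open>1\<close> keeps \<open>C\<close> independent of
  \<open>q\<close>.\<close>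

lemma log_c_weight_drift:
  assumes \<alpha>: "\<And>q. admissible \<theta> q \<Longrightarrow> (\<Sum>b\<in>Bad. q b * r b powr s) \<le> \<alpha>" "0 \<le> \<alpha>" and s: "1 < s" "s \<le> 2"
    and D: "1 \<le> D" "\<And>b x. b \<in> Bad \<Longrightarrow> x \<in> X \<Longrightarrow> D - ln \<bar>T b x - c\<bar> \<le> r b * (D - ln \<bar>x - c\<bar>)"
  obtains C where "0 \<le> C" "\<And>q u m. admissible \<theta> q \<Longrightarrow> cone u \<Longrightarrow> (\<integral>\<^sup>+x. ennreal (u x) \<partial>lebX) \<le> ennreal m \<Longrightarrow> 0 \<le> m \<Longrightarrow>
     (\<integral>\<^sup>+x. ennreal (log_c_weight D s x * transfer q u x) \<partial>lebX) \<le>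
     ennreal \<alpha> * (\<integral>\<^sup>+x. ennreal (log_c_weight D s x * u x) \<partial>lebX) + ennreal (C * m)"
proof -
  let ?w = "log_c_weight D s"
  let ?G = "{1..N} - Bad"
  define Q where "Q j I C \<longleftrightarrow> 0 \<le> C \<and> (\<forall>u m. cone u \<longrightarrow> (\<integral>\<^sup>+x. ennreal (u x) \<partial>lebX) \<le> ennreal m \<longrightarrow> 0 \<le> m \<longrightarrow>
    (\<integral>\<^sup>+y. ennreal (?w (T j y) * u y) * indicator I y \<partial>lebX) \<le> ennreal (C * m))" for j I C
  have "\<forall>j\<in>?G. \<forall>I\<in>sides. \<exists>C. Q j I C"
  proof (intro ballI)
    fix j I assume j: "j \<in> ?G" and I: "I \<in> sides"
    obtain C where "0 \<le> C" "\<And>u m. cone u \<Longrightarrow> (\<integral>\<^sup>+x. ennreal (u x) \<partial>lebX) \<le> ennreal m \<Longrightarrow> 0 \<le> m \<Longrightarrow>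
      (\<integral>\<^sup>+y. ennreal ((D - ln \<bar>T j y - c\<bar>) powr s * u y) * indicator I y \<partial>lebX) \<le> ennreal (C * m)"
      using good_branch_integral[OF j I D(1) less_imp_le[OF s(1)] s(2)] by blast
    then show "\<exists>C. Q j I C" unfolding Q_def log_c_weight_def by blast
  qed
  then obtain Cf where Cf0: "\<And>j I. j \<in> ?G \<Longrightarrow> I \<in> sides \<Longrightarrow> Q j I (Cf j I)" by metis
  then have Cf: "\<And>j I. j \<in> ?G \<Longrightarrow> I \<in> sides \<Longrightarrow> 0 \<le> Cf j I"
    "\<And>j I u m. j \<in> ?G \<Longrightarrow> I \<in> sides \<Longrightarrow> cone u \<Longrightarrow> (\<integral>\<^sup>+x. ennreal (u x) \<partial>lebX) \<le> ennreal m \<Longrightarrow> 0 \<le> m \<Longrightarrow>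
      (\<integral>\<^sup>+y. ennreal (?w (T j y) * u y) * indicator I y \<partial>lebX) \<le> ennreal (Cf j I * m)"
    unfolding Q_def by blast+
  define C where "C = (\<Sum>j\<in>?G. \<Sum>I\<in>sides. Cf j I)"
  have C0: "0 \<le> C" unfolding C_def by (intro sum_nonneg Cf)
  have "(\<integral>\<^sup>+x. ennreal (?w x * transfer q u x) \<partial>lebX) \<le>
      ennreal \<alpha> * (\<integral>\<^sup>+x. ennreal (?w x * u x) \<partial>lebX) + ennreal (C * m)"
    if q: "admissible \<theta> q" and u: "cone u" and m: "(\<integral>\<^sup>+x. ennreal (u x) \<partial>lebX) \<le> ennreal m" "0 \<le> m" for q u m
  proof -
    note p = admissible_prob[OF q]
    note cu = cone_continuous[OF u] cone_nonneg[OF u]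
    have um: "u \<in> borel_measurable lebX" by (rule cone_measurable[OF u])
    have wl: "?w \<in> borel_measurable lebX" by (intro measurable_lebX_borel) measurable
    have mj: "(\<lambda>y. ennreal (?w (T j y) * u y)) \<in> borel_measurable lebX" if "j \<in> {1..N}" for j
      using measurable_compose_T[OF that log_c_weight_measurable] um by measurable
    have pw: "ennreal (koopman q ?w y * u y) \<le> ennreal \<alpha> * ennreal (?w y * u y) + (\<Sum>j\<in>?G. ennreal (?w (T j y) * u y))"
      if y: "y \<in> X" for y
    proof -
      have u0: "0 \<le> u y" by (rule cu(2)[OF y])
      have "(\<Sum>j\<in>Bad. q j * ?w (T j y)) \<le> (\<Sum>j\<in>Bad. q j * r j powr s) * ?w y"
        unfolding sum_distrib_right
      proof (rule sum_mono)
        fix b assume b: "b \<in> Bad"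
        have bN: "b \<in> {1..N}" using b Bad_subset by blast
        have xc: "0 < \<bar>y - c\<bar>" "\<bar>y - c\<bar> \<le> 1" using y c_pos c_less by (auto simp: X_def)
        have "T b y \<in> X"
          using y bad_image[OF b] sides_X X_side[OF y] by blast
        then have "0 < \<bar>T b y - c\<bar>" "\<bar>T b y - c\<bar> \<le> 1" using c_pos c_less by (auto simp: X_def)
        then have "ln \<bar>T b y - c\<bar> \<le> 0" by simp
        then have "(D - ln \<bar>T b y - c\<bar>) powr s \<le> (r b * (D - ln \<bar>y - c\<bar>)) powr s"
          using D(1) s by (intro powr_mono2 D(2)[OF b y]) auto
        also have "\<dots> = r b powr s * ?w y" unfolding log_c_weight_def by (rule powr_mult)
        finally have "?w (T b y) \<le> r b powr s * ?w y" by (simp add: log_c_weight_def)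
        then show "q b * ?w (T b y) \<le> q b * r b powr s * ?w y"
          using finite_prob[OF p bN] by (simp add: mult.assoc)
      qed
      also have "\<dots> \<le> \<alpha> * ?w y" by (intro mult_right_mono \<alpha>(1) q log_c_weight_nonneg)
      finally have B: "(\<Sum>j\<in>Bad. q j * ?w (T j y)) \<le> \<alpha> * ?w y" .
      have G: "(\<Sum>j\<in>?G. q j * ?w (T j y)) \<le> (\<Sum>j\<in>?G. ?w (T j y))"
        proof (rule sum_mono)
        fix j assume "j \<in> ?G"
        then have "0 \<le> q j" "q j \<le> 1" using prob_le_1[OF p, of j] finite_prob[OF p, of j] by auto
        then show "q j * ?w (T j y) \<le> ?w (T j y)" by (intro mult_left_le_one_le log_c_weight_nonneg)
      qed
      have "koopman q ?w y = (\<Sum>j\<in>Bad. q j * ?w (T j y)) + (\<Sum>j\<in>?G. q j * ?w (T j y))"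
        using y sum.subset_diff[OF Bad_subset, of "\<lambda>j. q j * ?w (T j y)"] by (simp add: koopman_def)
      then have "koopman q ?w y * u y \<le> (\<alpha> * ?w y + (\<Sum>j\<in>?G. ?w (T j y))) * u y"
        using B G u0 by (intro mult_right_mono) auto
      also have "\<dots> = \<alpha> * (?w y * u y) + (\<Sum>j\<in>?G. ?w (T j y) * u y)" by (simp add: algebra_simps sum_distrib_left)
      finally have "ennreal (koopman q ?w y * u y) \<le> ennreal (\<alpha> * (?w y * u y) + (\<Sum>j\<in>?G. ?w (T j y) * u y))"
        by (rule ennreal_leI)
      also have "\<dots> = ennreal (\<alpha> * (?w y * u y)) + ennreal (\<Sum>j\<in>?G. ?w (T j y) * u y)"
        by (intro ennreal_plus sum_nonneg mult_nonneg_nonneg \<alpha>(2) u0 log_c_weight_nonneg)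
      also have "ennreal (\<alpha> * (?w y * u y)) = ennreal \<alpha> * ennreal (?w y * u y)"
        using \<alpha>(2) by (intro ennreal_mult') 
      also have "ennreal (\<Sum>j\<in>?G. ?w (T j y) * u y) = (\<Sum>j\<in>?G. ennreal (?w (T j y) * u y))"
        by (intro sum_ennreal[symmetric] mult_nonneg_nonneg u0 log_c_weight_nonneg)
      finally show ?thesis .
    qed
    have "(\<integral>\<^sup>+x. ennreal (?w x * transfer q u x) \<partial>lebX) = (\<integral>\<^sup>+y. ennreal (koopman q ?w y * u y) \<partial>lebX)"
      by (rule integral_transfer[OF p cu log_c_weight_measurable log_c_weight_nonneg])
    also have "\<dots> \<le> (\<integral>\<^sup>+y. ennreal \<alpha> * ennreal (?w y * u y) + (\<Sum>j\<in>?G. ennreal (?w (T j y) * u y)) \<partial>lebX)"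
      by (rule nn_integral_mono, rule pw) simp
    also have "\<dots> = (\<integral>\<^sup>+y. ennreal \<alpha> * ennreal (?w y * u y) \<partial>lebX) + (\<integral>\<^sup>+y. (\<Sum>j\<in>?G. ennreal (?w (T j y) * u y)) \<partial>lebX)"
      using um wl mj by (intro nn_integral_add) (auto intro!: borel_measurable_sum)
    also have "(\<integral>\<^sup>+y. ennreal \<alpha> * ennreal (?w y * u y) \<partial>lebX) = ennreal \<alpha> * (\<integral>\<^sup>+y. ennreal (?w y * u y) \<partial>lebX)"
      using um wl by (intro nn_integral_cmult) auto
    also have "(\<integral>\<^sup>+y. (\<Sum>j\<in>?G. ennreal (?w (T j y) * u y)) \<partial>lebX) = (\<Sum>j\<in>?G. \<integral>\<^sup>+y. ennreal (?w (T j y) * u y) \<partial>lebX)"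
      using mj by (intro nn_integral_sum) auto
    also have "\<dots> = (\<Sum>j\<in>?G. \<Sum>I\<in>sides. \<integral>\<^sup>+y. ennreal (?w (T j y) * u y) * indicator I y \<partial>lebX)"
      using mj by (intro sum.cong refl integral_split_sides) auto
    also have "\<dots> \<le> (\<Sum>j\<in>?G. \<Sum>I\<in>sides. ennreal (Cf j I * m))"
      by (intro sum_mono Cf u m)
    also have "\<dots> = ennreal (C * m)"
    proof -
      have "(\<Sum>j\<in>?G. \<Sum>I\<in>sides. ennreal (Cf j I * m)) = (\<Sum>j\<in>?G. ennreal (\<Sum>I\<in>sides. Cf j I * m))"
        by (intro sum.cong refl sum_ennreal mult_nonneg_nonneg Cf(1) m(2))
      also have "\<dots> = ennreal (\<Sum>j\<in>?G. \<Sum>I\<in>sides. Cf j I * m)"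
        by (intro sum_ennreal sum_nonneg mult_nonneg_nonneg Cf(1) m(2))
      also have "(\<Sum>j\<in>?G. \<Sum>I\<in>sides. Cf j I * m) = C * m" by (simp add: C_def sum_distrib_right)
      finally show ?thesis .
    qed
    finally show ?thesis by (simp add: add_left_mono)
  qed
  then show ?thesis using that C0 by blast
qed

text \<open>There is no contraction factor here: the gain is \<eta> times the weight of order
  \<open>s - 1\<close>, and the loss is charged to the weight at \<open>c\<close>. Minimum and sum
  over the finitely many maps make \<eta> and \<open>H\<close> independent of
  \<open>q\<close>.\<close>

lemma log_end_weight_drift:
  assumes D: "1 \<le> D" and s: "1 < s"
  obtains \<eta> H where "0 < \<eta>" "0 \<le> H"
    "\<And>q u. positive_prob_vector N q \<Longrightarrow> cone u \<Longrightarrow>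
     (\<integral>\<^sup>+x. ennreal (log_end_weight s x * transfer q u x) \<partial>lebX) + ennreal \<eta> * (\<integral>\<^sup>+x. ennreal (log_end_weight (s - 1) x * u x) \<partial>lebX) \<le>
     (\<integral>\<^sup>+x. ennreal (log_end_weight s x * u x) \<partial>lebX) + ennreal H * (\<integral>\<^sup>+x. ennreal (log_c_weight D s x * u x) \<partial>lebX)"
proof -
  let ?a = "log_c_weight D s" and ?e = "log_end_weight s" and ?f = "log_end_weight (s - 1)"
  have "\<forall>j\<in>{1..N}. \<exists>\<eta> H. 0 < \<eta> \<and> 0 \<le> H \<and> (\<forall>x\<in>X. ?e (T j x) + \<eta> * ?f x \<le> ?e x + H * ?a x)"
  proof
    fix j assume "j \<in> {1..N}"
    then interpret branch_map c "T j" "r j" by (rule branch)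
    from log_end_dist_drift[OF D s]
    show "\<exists>\<eta> H. 0 < \<eta> \<and> 0 \<le> H \<and> (\<forall>x\<in>X. ?e (T j x) + \<eta> * ?f x \<le> ?e x + H * ?a x)"
      unfolding log_end_weight_def log_c_weight_def by metis
  qed
  then obtain \<eta>f Hf where f: "\<And>j. j \<in> {1..N} \<Longrightarrow> 0 < \<eta>f j" "\<And>j. j \<in> {1..N} \<Longrightarrow> 0 \<le> Hf j"
    "\<And>j x. j \<in> {1..N} \<Longrightarrow> x \<in> X \<Longrightarrow> ?e (T j x) + \<eta>f j * ?f x \<le> ?e x + Hf j * ?a x"
    by metis
  have ne: "{1..N} \<noteq> {}" using Good_nonempty by blast
  define \<eta> where "\<eta> = Min (\<eta>f ` {1..N})"
  define H where "H = (\<Sum>j\<in>{1..N}. Hf j)"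
  have \<eta>: "0 < \<eta>" "\<And>j. j \<in> {1..N} \<Longrightarrow> \<eta> \<le> \<eta>f j" using f(1) ne by (auto simp: \<eta>_def)
  have H: "0 \<le> H" "\<And>j. j \<in> {1..N} \<Longrightarrow> Hf j \<le> H"
    unfolding H_def by (auto intro!: sum_nonneg f(2) member_le_sum)
  have step: "?e (T j x) \<le> ?e x + H * ?a x - \<eta> * ?f x" if "j \<in> {1..N}" "x \<in> X" for j x
    using f(3)[OF that] mult_right_mono[OF \<eta>(2)[OF that(1)] log_end_weight_nonneg, of "s - 1" x]
      mult_right_mono[OF H(2)[OF that(1)] log_c_weight_nonneg, of D s x] by linarith
  have "(\<integral>\<^sup>+x. ennreal (?e x * transfer q u x) \<partial>lebX) + ennreal \<eta> * (\<integral>\<^sup>+x. ennreal (?f x * u x) \<partial>lebX) \<le>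
     (\<integral>\<^sup>+x. ennreal (?e x * u x) \<partial>lebX) + ennreal H * (\<integral>\<^sup>+x. ennreal (?a x * u x) \<partial>lebX)"
    if p: "positive_prob_vector N q" and u: "cone u" for q u
  proof -
    note cu = cone_continuous[OF u] cone_nonneg[OF u]
    have um: "u \<in> borel_measurable lebX" by (rule cone_measurable[OF u])
    have [measurable]: "?a \<in> borel_measurable lebX" "?e \<in> borel_measurable lebX" "?f \<in> borel_measurable lebX" "u \<in> borel_measurable lebX"
      using um by (auto intro!: measurable_lebX_borel)
    have [measurable]: "koopman q ?e \<in> borel_measurable lebX"
      by (intro measurable_lebX_borel koopman_measurable) measurable
    have "(\<integral>\<^sup>+x. ennreal (?e x * transfer q u x) \<partial>lebX) + ennreal \<eta> * (\<integral>\<^sup>+x. ennreal (?f x * u x) \<partial>lebX)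
        = (\<integral>\<^sup>+x. ennreal (koopman q ?e x * u x) + ennreal \<eta> * ennreal (?f x * u x) \<partial>lebX)"
      using integral_transfer[OF p cu log_end_weight_measurable log_end_weight_nonneg]
      by (subst nn_integral_add) (auto simp: nn_integral_cmult)
    also have "\<dots> \<le> (\<integral>\<^sup>+x. ennreal (?e x * u x) + ennreal H * ennreal (?a x * u x) \<partial>lebX)"
    proof (rule nn_integral_mono)
      fix x assume "x \<in> space lebX"
      then have x: "x \<in> X" by simp
      have u0: "0 \<le> u x" by (rule cu(2)[OF x])
      have "koopman q ?e x \<le> (\<Sum>j=1..N. q j * (?e x + H * ?a x - \<eta> * ?f x))"
        using x by (simp only: koopman_def if_True) (intro sum_mono mult_left_mono step less_imp_le[OF finite_prob[OF p]])
      also have "\<dots> = ?e x + H * ?a x - \<eta> * ?f x" by (simp only: sum_distrib_right[symmetric] sum_prob[OF p] mult_1)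
      finally have "(koopman q ?e x + \<eta> * ?f x) * u x \<le> (?e x + H * ?a x) * u x"
        using u0 by (intro mult_right_mono) auto
      then have "ennreal (koopman q ?e x * u x + \<eta> * (?f x * u x)) \<le> ennreal (?e x * u x + H * (?a x * u x))"
        by (intro ennreal_leI) (simp add: algebra_simps)
      moreover have "0 \<le> koopman q ?e x" by (rule koopman_nonneg[OF p log_end_weight_nonneg])
      ultimately show "ennreal (koopman q ?e x * u x) + ennreal \<eta> * ennreal (?f x * u x) \<le> ennreal (?e x * u x) + ennreal H * ennreal (?a x * u x)"
        using u0 H \<eta> log_end_weight_nonneg[of s x] log_end_weight_nonneg[of "s - 1" x] log_c_weight_nonneg[of D s x]
        by (simp add: ennreal_plus ennreal_mult')
    qed
    also have "\<dots> = (\<integral>\<^sup>+x. ennreal (?e x * u x) \<partial>lebX) + ennreal H * (\<integral>\<^sup>+x. ennreal (?a x * u x) \<partial>lebX)"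
      by (subst nn_integral_add) (auto simp: nn_integral_cmult)
    finally show ?thesis .
  qed
  then show ?thesis using that \<eta>(1) H(1) by blast
qed

lemma coercive_log_weights:
  assumes s: "1 < s"
  shows "coercive (\<lambda>x. log_c_weight D s x + log_end_weight (s - 1) x)"
  unfolding coercive_def
proof (intro conjI allI ballI)
  show "(\<lambda>x. log_c_weight D s x + log_end_weight (s - 1) x) \<in> borel_measurable lebX"
    by (intro measurable_lebX_borel) measurable
  fix x show "0 \<le> log_c_weight D s x + log_end_weight (s - 1) x"
    by (intro add_nonneg_nonneg log_c_weight_nonneg log_end_weight_nonneg)
next
  fix R :: real
  define R' where "R' = max R 1"
  \<comment> \<open>These are the distances from \<open>c\<close> and from \<open>{0, 1}\<close> at
    which the respective weight alone equals \<open>R'\<close>.\<close>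
  define \<rho>1 \<rho>2 where "\<rho>1 = exp (D - R' powr (1 / s))" and "\<rho>2 = exp (- (R' powr (1 / (s - 1))))"
  define \<rho> where "\<rho> = min \<rho>1 \<rho>2 / 2"
  have \<rho>: "0 < \<rho>" "2 * \<rho> \<le> \<rho>1" "2 * \<rho> \<le> \<rho>2" by (auto simp: \<rho>_def \<rho>1_def \<rho>2_def)
  have root: "a \<le> R' powr (1 / t)" if "a powr t \<le> R'" "0 < t" for a t :: real
  proof (cases "0 < a")
    case True
    have "(a powr t) powr (1 / t) \<le> R' powr (1 / t)" using that by (intro powr_mono2) auto
    then show ?thesis using True that by (simp add: powr_powr)
  next
    case False
    moreover have "0 \<le> R' powr (1 / t)" by simp
    ultimately show ?thesis by linarith
  qed
  have "\<exists>I\<in>sides. {x-\<rho>..x+\<rho>} \<subseteq> I" if x: "x \<in> X" and w: "log_c_weight D s x + log_end_weight (s - 1) x \<le> R" for x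
  proof -
    have "log_c_weight D s x \<le> R'" "log_end_weight (s - 1) x \<le> R'"
      using w log_c_weight_nonneg[of D s x] log_end_weight_nonneg[of "s - 1" x] by (auto simp: R'_def)
    then have "D - ln \<bar>x - c\<bar> \<le> R' powr (1 / s)" "- ln (end_dist x) \<le> R' powr (1 / (s - 1))"
      using root s by (auto simp: log_c_weight_def log_end_weight_def)
    then have l: "D - R' powr (1 / s) \<le> ln \<bar>x - c\<bar>" "- (R' powr (1 / (s - 1))) \<le> ln (end_dist x)" by linarith+
    have p: "0 < \<bar>x - c\<bar>" "0 < end_dist x" using x end_dist_X[OF x] by (auto simp: X_def)
    have "\<rho>1 \<le> \<bar>x - c\<bar>" "\<rho>2 \<le> end_dist x"
      using l p unfolding \<rho>1_def \<rho>2_def by (metis exp_le_cancel_iff exp_ln)+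
    then have d: "2 * \<rho> \<le> \<bar>x - c\<bar>" "2 * \<rho> \<le> x" "2 * \<rho> \<le> 1 - x" using \<rho> by (auto simp: end_dist_def)
    show ?thesis
    proof (cases "x < c")
      case True
      then have "{x-\<rho>..x+\<rho>} \<subseteq> {0<..<c}" using d \<rho> by auto
      then show ?thesis by (auto simp: sides_def)
    next
      case False
      then have "{x-\<rho>..x+\<rho>} \<subseteq> {c<..<1}" using d \<rho> by auto
      then show ?thesis by (auto simp: sides_def)
    qed
  qed
  then show "\<exists>\<rho>>0. \<forall>x\<in>X. log_c_weight D s x + log_end_weight (s - 1) x \<le> R \<longrightarrow> (\<exists>I\<in>sides. {x-\<rho>..x+\<rho>} \<subseteq> I)"
    using \<rho>(1) by blast
qed

lemma log_c_weight_integral: "0 \<le> D \<Longrightarrow> 1 \<le> s \<Longrightarrow> s \<le> 2 \<Longrightarrow> (\<integral>\<^sup>+x. ennreal (log_c_weight D s x) \<partial>lebX) < \<infinity>"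
  unfolding log_c_weight_def by (rule log_power_integral_finite) (use c_pos c_less in auto)

lemma log_end_weight_integral:
  assumes "1 \<le> s" "s \<le> 2"
  shows "(\<integral>\<^sup>+x. ennreal (log_end_weight s x) \<partial>lebX) < \<infinity>"
proof -
  have "(\<integral>\<^sup>+x. ennreal (log_end_weight s x) \<partial>lebX) \<le>
      (\<integral>\<^sup>+x. ennreal ((0 - ln \<bar>x - 0\<bar>) powr s) + ennreal ((0 - ln \<bar>x - 1\<bar>) powr s) \<partial>lebX)"
    by (intro nn_integral_mono) (auto simp: log_end_weight_def end_dist_def X_def min_def)
  also have "\<dots> = (\<integral>\<^sup>+x. ennreal ((0 - ln \<bar>x - 0\<bar>) powr s) \<partial>lebX) + (\<integral>\<^sup>+x. ennreal ((0 - ln \<bar>x - 1\<bar>) powr s) \<partial>lebX)"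
    by (intro nn_integral_add measurable_compose[OF measurable_lebX_borel measurable_ennreal]; measurable)
  also have "\<dots> < \<infinity>"
    using log_power_integral_finite[of 0 0 s] log_power_integral_finite[of 1 0 s] assms by simp
  finally show ?thesis .
qed

lemma bounded_integral:
  assumes w: "w \<in> borel_measurable lebX" "(\<integral>\<^sup>+x. ennreal (w x) \<partial>lebX) < \<infinity>" "\<And>x. 0 \<le> w x"
    and u: "\<And>x. x \<in> X \<Longrightarrow> u x \<le> U" and U: "0 \<le> U"
  obtains A where "0 \<le> A" "(\<integral>\<^sup>+x. ennreal (w x * u x) \<partial>lebX) \<le> ennreal A"
proof -
  have "(\<integral>\<^sup>+x. ennreal (w x * u x) \<partial>lebX) \<le> (\<integral>\<^sup>+x. ennreal U * ennreal (w x) \<partial>lebX)"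
  proof (rule nn_integral_mono)
    fix x assume "x \<in> space lebX"
    then have "w x * u x \<le> U * w x" using u[of x] w(3)[of x] by (simp add: mult.commute mult_right_mono)
    then have "ennreal (w x * u x) \<le> ennreal (U * w x)" by (rule ennreal_leI)
    then show "ennreal (w x * u x) \<le> ennreal U * ennreal (w x)" using U w(3) by (simp add: ennreal_mult)
  qed
  also have "\<dots> = ennreal U * (\<integral>\<^sup>+x. ennreal (w x) \<partial>lebX)" using w(1) by (intro nn_integral_cmult) auto
  also have "\<dots> < \<infinity>" using w(2) by (simp add: ennreal_mult_less_top)
  finally have fin: "(\<integral>\<^sup>+x. ennreal (w x * u x) \<partial>lebX) < \<infinity>" .
  show ?thesis
    by (rule that[of "enn2real (\<integral>\<^sup>+x. ennreal (w x * u x) \<partial>lebX)"]) (use fin in \<open>auto simp: less_top\<close>)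
qed

lemma integral_average:
  assumes w: "w \<in> borel_measurable lebX" "\<And>x. 0 \<le> w x" and q: "positive_prob_vector N q" and u: "cone u"
  shows "(\<integral>\<^sup>+x. ennreal (w x * average q u n x) \<partial>lebX) =
    ennreal (1 / real (Suc n)) * (\<Sum>k<Suc n. \<integral>\<^sup>+x. ennreal (w x * (transfer q ^^ k) u x) \<partial>lebX)"
proof -
  note ck = cone_transfer_power[OF q u]
  have [measurable]: "w \<in> borel_measurable lebX" "\<And>k. (transfer q ^^ k) u \<in> borel_measurable lebX"
    using w cone_measurable[OF ck] by auto
  have "(\<integral>\<^sup>+x. ennreal (w x * average q u n x) \<partial>lebX) =
      (\<integral>\<^sup>+x. ennreal (1 / real (Suc n)) * (\<Sum>k<Suc n. ennreal (w x * (transfer q ^^ k) u x)) \<partial>lebX)"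
  proof (rule nn_integral_cong)
    fix x assume "x \<in> space lebX"
    then have nn: "0 \<le> w x * (transfer q ^^ k) u x" for k using cone_nonneg[OF ck] w by simp
    have "w x * average q u n x = 1 / real (Suc n) * (\<Sum>k<Suc n. w x * (transfer q ^^ k) u x)"
      unfolding average_def by (simp only: sum_distrib_left mult_ac)
    then have "ennreal (w x * average q u n x) = ennreal (1 / real (Suc n)) * ennreal (\<Sum>k<Suc n. w x * (transfer q ^^ k) u x)"
      using nn by (simp only: ennreal_mult' sum_nonneg zero_le_divide_1_iff of_nat_0_le_iff)
    also have "ennreal (\<Sum>k<Suc n. w x * (transfer q ^^ k) u x) = (\<Sum>k<Suc n. ennreal (w x * (transfer q ^^ k) u x))"
      by (intro sum_ennreal[symmetric] nn)
    finally show "ennreal (w x * average q u n x) = ennreal (1 / real (Suc n)) * (\<Sum>k<Suc n. ennreal (w x * (transfer q ^^ k) u x))" .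
  qed
  also have "\<dots> = ennreal (1 / real (Suc n)) * (\<integral>\<^sup>+x. (\<Sum>k<Suc n. ennreal (w x * (transfer q ^^ k) u x)) \<partial>lebX)"
    by (intro nn_integral_cmult borel_measurable_sum) measurable
  also have "(\<integral>\<^sup>+x. (\<Sum>k<Suc n. ennreal (w x * (transfer q ^^ k) u x)) \<partial>lebX) = (\<Sum>k<Suc n. \<integral>\<^sup>+x. ennreal (w x * (transfer q ^^ k) u x) \<partial>lebX)"
    by (intro nn_integral_sum) measurable
  finally show ?thesis .
qed

lemma average_mass:
  assumes q: "positive_prob_vector N q" and u: "cone u"
  shows "(\<integral>\<^sup>+x. ennreal (average q u n x) \<partial>lebX) = (\<integral>\<^sup>+x. ennreal (u x) \<partial>lebX)"
proof -
  have "(\<integral>\<^sup>+x. ennreal (1 * average q u n x) \<partial>lebX) = ennreal (1 / real (Suc n)) * (\<Sum>k<Suc n. \<integral>\<^sup>+x. ennreal (1 * (transfer q ^^ k) u x) \<partial>lebX)"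
    by (rule integral_average[OF _ _ q u]) auto
  also have "\<dots> = ennreal (1 / real (Suc n)) * (of_nat (Suc n) * (\<integral>\<^sup>+x. ennreal (u x) \<partial>lebX))"
    using transfer_power_mass[OF q u] by (simp only: mult_1 sum_constant card_lessThan)
  also have "\<dots> = (ennreal (1 / real (Suc n)) * ennreal (real (Suc n))) * (\<integral>\<^sup>+x. ennreal (u x) \<partial>lebX)"
    by (simp only: ennreal_of_nat_eq_real_of_nat mult.assoc)
  also have "ennreal (1 / real (Suc n)) * ennreal (real (Suc n)) = 1"
    by (subst ennreal_mult[symmetric]) auto
  finally show ?thesis by simp
qed

text \<open>The contraction of the weight at \<open>c\<close> bounds it along all iterates. Summing
  the drift at the endpoints then telescopes: the weight of order \<open>s - 1\<close>, added up
  over the first iterates, grows at most linearly in their number, so its Cesaro means are bounded.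
  The weight \<open>w\<close> combines the order \<open>s\<close> at \<open>c\<close> with the order
  \<open>s - 1\<close> at the endpoints.\<close>

lemma tightness:
  assumes \<theta>: "\<theta> < 1"
  obtains w where "coercive w"
    "\<And>u U. cone u \<Longrightarrow> (\<And>x. x \<in> X \<Longrightarrow> u x \<le> U) \<Longrightarrow>
      \<exists>C. \<forall>q n. admissible \<theta> q \<longrightarrow> (\<integral>\<^sup>+x. ennreal (w x * average q u n x) \<partial>lebX) \<le> ennreal C"
proof -
  obtain s \<alpha> where s: "1 < s" "s \<le> 2" and \<alpha>: "0 \<le> \<alpha>" "\<alpha> < 1" "\<And>q. admissible \<theta> q \<Longrightarrow> (\<Sum>b\<in>Bad. q b * r b powr s) \<le> \<alpha>"
    using bad_power_sum[OF \<theta>] by blast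
  have "\<forall>b\<in>Bad. \<forall>\<^sub>F D in at_top. \<forall>x\<in>X. D - ln \<bar>T b x - c\<bar> \<le> r b * (D - ln \<bar>x - c\<bar>)"
  proof
    fix b assume b: "b \<in> Bad"
    then interpret branch_map c "T b" "r b" using Bad_subset branch by blast
    show "\<forall>\<^sub>F D in at_top. \<forall>x\<in>X. D - ln \<bar>T b x - c\<bar> \<le> r b * (D - ln \<bar>x - c\<bar>)"
      using log_dist_c_drift bad_image bad_exponent b by blast
  qed
  then have "\<forall>\<^sub>F D in at_top. \<forall>b\<in>Bad. \<forall>x\<in>X. D - ln \<bar>T b x - c\<bar> \<le> r b * (D - ln \<bar>x - c\<bar>)"
    by (intro eventually_ball_finite) auto
  then have "\<forall>\<^sub>F D in at_top. 1 \<le> D \<and> (\<forall>b\<in>Bad. \<forall>x\<in>X. D - ln \<bar>T b x - c\<bar> \<le> r b * (D - ln \<bar>x - c\<bar>))"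
    by (intro eventually_conj eventually_ge_at_top)
  then obtain D where D: "1 \<le> D" "\<And>b x. b \<in> Bad \<Longrightarrow> x \<in> X \<Longrightarrow> D - ln \<bar>T b x - c\<bar> \<le> r b * (D - ln \<bar>x - c\<bar>)"
    using eventually_happens'[OF trivial_limit_at_top_linorder] by blast
  let ?a = "log_c_weight D s" and ?e = "log_end_weight s" and ?f = "log_end_weight (s - 1)"
  obtain C1 where C1: "0 \<le> C1" "\<And>q u m. admissible \<theta> q \<Longrightarrow> cone u \<Longrightarrow> (\<integral>\<^sup>+x. ennreal (u x) \<partial>lebX) \<le> ennreal m \<Longrightarrow> 0 \<le> m \<Longrightarrow>
     (\<integral>\<^sup>+x. ennreal (?a x * transfer q u x) \<partial>lebX) \<le> ennreal \<alpha> * (\<integral>\<^sup>+x. ennreal (?a x * u x) \<partial>lebX) + ennreal (C1 * m)"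
    by (rule log_c_weight_drift[OF \<alpha>(3,1) s D]) blast+
  obtain \<eta> H where \<eta>: "0 < \<eta>" and H: "0 \<le> H" and drift: "\<And>q u. positive_prob_vector N q \<Longrightarrow> cone u \<Longrightarrow>
     (\<integral>\<^sup>+x. ennreal (?e x * transfer q u x) \<partial>lebX) + ennreal \<eta> * (\<integral>\<^sup>+x. ennreal (?f x * u x) \<partial>lebX) \<le>
     (\<integral>\<^sup>+x. ennreal (?e x * u x) \<partial>lebX) + ennreal H * (\<integral>\<^sup>+x. ennreal (?a x * u x) \<partial>lebX)"
    by (rule log_end_weight_drift[OF D(1) s(1)]) blast
  have [measurable]: "?a \<in> borel_measurable lebX" "?e \<in> borel_measurable lebX" "?f \<in> borel_measurable lebX"
    by (auto intro!: measurable_lebX_borel)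
  let ?w = "\<lambda>x. ?a x + ?f x"
  have "\<exists>C. \<forall>q n. admissible \<theta> q \<longrightarrow> (\<integral>\<^sup>+x. ennreal (?w x * average q u n x) \<partial>lebX) \<le> ennreal C"
    if u: "cone u" and uU: "\<And>x. x \<in> X \<Longrightarrow> u x \<le> U" for u U
  proof -
    have "c / 2 \<in> X" using c_pos c_less by (auto simp: X_def)
    then have U: "0 \<le> U" using cone_nonneg[OF u] uU by (meson order_trans)
    have mass: "(\<integral>\<^sup>+x. ennreal (u x) \<partial>lebX) \<le> ennreal U"
    proof -
      have "(\<integral>\<^sup>+x. ennreal (u x) \<partial>lebX) \<le> (\<integral>\<^sup>+x. ennreal U \<partial>lebX)"
        by (intro nn_integral_mono ennreal_leI uU) simp
      also have "\<dots> = ennreal U" by (simp add: emeasure_lebX_X)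
      finally show ?thesis .
    qed
    obtain A where A: "0 \<le> A" "(\<integral>\<^sup>+x. ennreal (?a x * u x) \<partial>lebX) \<le> ennreal A"
      using bounded_integral[of ?a u U] log_c_weight_integral[of D s] D(1) s uU U log_c_weight_nonneg by auto
    obtain E where E: "0 \<le> E" "(\<integral>\<^sup>+x. ennreal (?e x * u x) \<partial>lebX) \<le> ennreal E"
      using bounded_integral[of ?e u U] log_end_weight_integral[of s] s uU U log_end_weight_nonneg by auto
    \<comment> \<open>The second summand is the fixed point of
      \<open>t \<mapsto> \<alpha> * t + C1 * U\<close>; adding the initial value \<open>A\<close>
      gives a bound that one step of the drift preserves.\<close>
    define B where "B = A + C1 * U / (1 - \<alpha>)"
    have B: "0 \<le> B" "\<alpha> * B + C1 * U \<le> B" "A \<le> B"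
    proof -
      have nn: "0 \<le> C1 * U / (1 - \<alpha>)" using C1 U \<alpha> by auto
      have "\<alpha> * A \<le> A" using A \<alpha> by (simp add: mult_left_le_one_le)
      moreover have "\<alpha> * (C1 * U / (1 - \<alpha>)) + C1 * U = C1 * U / (1 - \<alpha>)" using \<alpha> by (simp add: field_simps)
      ultimately show "\<alpha> * B + C1 * U \<le> B" by (simp add: B_def distrib_left)
      show "0 \<le> B" "A \<le> B" using A nn by (auto simp: B_def)
    qed
    define C where "C = B + (E + H * B) / \<eta>"
    have "(\<integral>\<^sup>+x. ennreal (?w x * average q u n x) \<partial>lebX) \<le> ennreal C" if q: "admissible \<theta> q" for q n
    proof -
      note p = admissible_prob[OF q]
      note ck = cone_transfer_power[OF p u]
      have [measurable]: "\<And>k. (transfer q ^^ k) u \<in> borel_measurable lebX" using cone_measurable[OF ck] by auto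
      have a: "(\<integral>\<^sup>+x. ennreal (?a x * (transfer q ^^ k) u x) \<partial>lebX) \<le> ennreal B" for k
      proof (induction k)
        case 0
        then show ?case using A(2) B(3) by (simp add: order_trans[OF _ ennreal_leI])
      next
        case (Suc k)
        have "(\<integral>\<^sup>+x. ennreal (?a x * (transfer q ^^ Suc k) u x) \<partial>lebX) \<le> ennreal \<alpha> * (\<integral>\<^sup>+x. ennreal (?a x * (transfer q ^^ k) u x) \<partial>lebX) + ennreal (C1 * U)"
          using C1(2)[OF q ck _ U, of k] mass transfer_power_mass[OF p u, of k] by simp
        also have "\<dots> \<le> ennreal \<alpha> * ennreal B + ennreal (C1 * U)" by (intro add_mono mult_left_mono Suc) auto
        also have "\<dots> = ennreal (\<alpha> * B + C1 * U)" using \<alpha> B C1 U by (simp add: ennreal_mult ennreal_plus)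
        also have "\<dots> \<le> ennreal B" using B by (intro ennreal_leI)
        finally show ?case .
      qed
      \<comment> \<open>Telescoped form of the endpoint drift: each step costs at most
        \<open>H * B\<close>, and the gains collected so far remain on the left.\<close>
      have e: "(\<integral>\<^sup>+x. ennreal (?e x * (transfer q ^^ k) u x) \<partial>lebX) + ennreal \<eta> * (\<Sum>i<k. \<integral>\<^sup>+x. ennreal (?f x * (transfer q ^^ i) u x) \<partial>lebX)
          \<le> ennreal (E + real k * (H * B))" for k
      proof (induction k)
        case 0
        then show ?case using E by simp
      next
        case (Suc k)
        let ?ee = "\<lambda>k. \<integral>\<^sup>+x. ennreal (?e x * (transfer q ^^ k) u x) \<partial>lebX"
        let ?ff = "\<lambda>k. \<integral>\<^sup>+x. ennreal (?f x * (transfer q ^^ k) u x) \<partial>lebX"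
        have "?ee (Suc k) + ennreal \<eta> * (\<Sum>i<Suc k. ?ff i) = (?ee (Suc k) + ennreal \<eta> * ?ff k) + ennreal \<eta> * (\<Sum>i<k. ?ff i)"
          by (simp add: distrib_left add_ac)
        also have "\<dots> \<le> (?ee k + ennreal H * (\<integral>\<^sup>+x. ennreal (?a x * (transfer q ^^ k) u x) \<partial>lebX)) + ennreal \<eta> * (\<Sum>i<k. ?ff i)"
          using drift[OF p ck[of k]] by (intro add_right_mono) simp
        also have "\<dots> \<le> (?ee k + ennreal H * ennreal B) + ennreal \<eta> * (\<Sum>i<k. ?ff i)"
          by (intro add_mono mult_left_mono a) auto
        also have "\<dots> = (?ee k + ennreal \<eta> * (\<Sum>i<k. ?ff i)) + ennreal (H * B)"
          using H B by (simp add: ennreal_mult add_ac)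
        also have "\<dots> \<le> ennreal (E + real k * (H * B)) + ennreal (H * B)" by (intro add_right_mono Suc)
        also have "\<dots> = ennreal (E + real (Suc k) * (H * B))"
          using E H B by (simp add: algebra_simps flip: ennreal_plus)
        finally show ?case .
      qed
      have fsum: "(\<Sum>i<Suc n. \<integral>\<^sup>+x. ennreal (?f x * (transfer q ^^ i) u x) \<partial>lebX) \<le> ennreal ((E + real (Suc n) * (H * B)) / \<eta>)"
      proof -
        let ?S = "\<Sum>i<Suc n. \<integral>\<^sup>+x. ennreal (?f x * (transfer q ^^ i) u x) \<partial>lebX"
        have "ennreal \<eta> * ?S \<le> ennreal (E + real (Suc n) * (H * B))"
          using e[of "Suc n"] by (rule order_trans[rotated]) (simp add: add_increasing)
        then have "ennreal (1 / \<eta>) * (ennreal \<eta> * ?S) \<le> ennreal (1 / \<eta>) * ennreal (E + real (Suc n) * (H * B))"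
          by (rule mult_left_mono) simp
        moreover have "ennreal (1 / \<eta>) * (ennreal \<eta> * ?S) = ?S"
          using \<eta> by (simp add: mult.assoc[symmetric] flip: ennreal_mult)
        moreover have "ennreal (1 / \<eta>) * ennreal (E + real (Suc n) * (H * B)) = ennreal ((E + real (Suc n) * (H * B)) / \<eta>)"
          using \<eta> E H B by (subst ennreal_mult[symmetric]) auto
        ultimately show ?thesis by simp
      qed
      have asum: "(\<Sum>i<Suc n. \<integral>\<^sup>+x. ennreal (?a x * (transfer q ^^ i) u x) \<partial>lebX) \<le> ennreal (real (Suc n) * B)"
      proof -
        have "(\<Sum>i<Suc n. \<integral>\<^sup>+x. ennreal (?a x * (transfer q ^^ i) u x) \<partial>lebX) \<le> (\<Sum>i<Suc n. ennreal B)"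
          by (intro sum_mono a)
        also have "\<dots> = ennreal (real (Suc n) * B)"
          using B by (simp add: ennreal_mult ennreal_of_nat_eq_real_of_nat del: of_nat_Suc sum.lessThan_Suc)
        finally show ?thesis .
      qed
      have "(\<integral>\<^sup>+x. ennreal (?w x * average q u n x) \<partial>lebX) =
          ennreal (1 / real (Suc n)) * (\<Sum>k<Suc n. \<integral>\<^sup>+x. ennreal (?w x * (transfer q ^^ k) u x) \<partial>lebX)"
        by (rule integral_average[OF _ _ p u]) (auto intro!: add_nonneg_nonneg log_c_weight_nonneg log_end_weight_nonneg)
      also have "(\<Sum>k<Suc n. \<integral>\<^sup>+x. ennreal (?w x * (transfer q ^^ k) u x) \<partial>lebX) =
          (\<Sum>k<Suc n. (\<integral>\<^sup>+x. ennreal (?a x * (transfer q ^^ k) u x) \<partial>lebX) + (\<integral>\<^sup>+x. ennreal (?f x * (transfer q ^^ k) u x) \<partial>lebX))"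
      proof (rule sum.cong[OF refl])
        fix k
        have "(\<integral>\<^sup>+x. ennreal (?w x * (transfer q ^^ k) u x) \<partial>lebX) =
            (\<integral>\<^sup>+x. ennreal (?a x * (transfer q ^^ k) u x) + ennreal (?f x * (transfer q ^^ k) u x) \<partial>lebX)"
          using cone_nonneg[OF ck]
          by (intro nn_integral_cong) (simp add: distrib_right ennreal_plus log_c_weight_nonneg log_end_weight_nonneg)
        also have "\<dots> = (\<integral>\<^sup>+x. ennreal (?a x * (transfer q ^^ k) u x) \<partial>lebX) + (\<integral>\<^sup>+x. ennreal (?f x * (transfer q ^^ k) u x) \<partial>lebX)"
          by (rule nn_integral_add) measurable
        finally show "(\<integral>\<^sup>+x. ennreal (?w x * (transfer q ^^ k) u x) \<partial>lebX) =
          (\<integral>\<^sup>+x. ennreal (?a x * (transfer q ^^ k) u x) \<partial>lebX) + (\<integral>\<^sup>+x. ennreal (?f x * (transfer q ^^ k) u x) \<partial>lebX)" .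
      qed
      also have "ennreal (1 / real (Suc n)) * \<dots> \<le> ennreal (1 / real (Suc n)) * (ennreal (real (Suc n) * B) + ennreal ((E + real (Suc n) * (H * B)) / \<eta>))"
        unfolding sum.distrib by (intro mult_left_mono add_mono asum fsum) simp
      also have "\<dots> = ennreal (1 / real (Suc n) * (real (Suc n) * B + (E + real (Suc n) * (H * B)) / \<eta>))"
      proof -
        have nn: "0 \<le> real (Suc n) * B" "0 \<le> (E + real (Suc n) * (H * B)) / \<eta>" using B E H \<eta> by auto
        show ?thesis by (subst ennreal_mult) (use nn in \<open>auto simp: ennreal_plus\<close>)
      qed
      also have "\<dots> \<le> ennreal C"
      proof (rule ennreal_leI)
        have "1 / t * (t * B + (E + t * (H * B)) / \<eta>) = B + (E / t + H * B) / \<eta>" if "0 < t" for t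
          using \<eta> that by (simp add: divide_simps)
        from this[of "real (Suc n)"]
        have "1 / real (Suc n) * (real (Suc n) * B + (E + real (Suc n) * (H * B)) / \<eta>) = B + (E / real (Suc n) + H * B) / \<eta>"
          by simp
        also have "\<dots> \<le> C"
          unfolding C_def using E \<eta> by (intro add_left_mono divide_right_mono add_right_mono) (auto simp: divide_le_eq mult_le_cancel_left1)
        finally show "1 / real (Suc n) * (real (Suc n) * B + (E + real (Suc n) * (H * B)) / \<eta>) \<le> C" .
      qed
      finally show ?thesis .
    qed
    then show ?thesis by blast
  qed
  then show ?thesis using that[of ?w] coercive_log_weights[OF s(1)] by blast
qed

end

section \<open>Existence and uniqueness of fixed densities in the cone\<close>

context random_branches
begin

lemma transfer_zero: "transfer q (\<lambda>x. 0) z = 0"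
  using transfer_linear[of q 0 "\<lambda>x. 0" 0 "\<lambda>x. 0" z] by simp

lemma transfer_scale: "transfer q (\<lambda>x. a * u x) z = a * transfer q u z"
  using transfer_linear[of q a u 0 u z] by simp

lemma transfer_add: "transfer q (\<lambda>x. u x + v x) z = transfer q u z + transfer q v z"
  using transfer_linear[of q 1 u 1 v z] by simp

lemma transfer_sum: "finite A \<Longrightarrow> transfer q (\<lambda>x. \<Sum>k\<in>A. u k x) z = (\<Sum>k\<in>A. transfer q (u k) z)"
  by (induction A rule: finite_induct) (simp_all add: transfer_zero transfer_add)

lemma transfer_average:
  "transfer q (average q u n) z = average q u n z + (1 / real (Suc n)) * ((transfer q ^^ Suc n) u z - u z)"
proof -
  have "transfer q (average q u n) z = (1 / real (Suc n)) * (\<Sum>k<Suc n. (transfer q ^^ Suc k) u z)"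
    unfolding average_def[abs_def] transfer_scale by (subst transfer_sum) simp_all
  also have "(\<Sum>k<Suc n. (transfer q ^^ Suc k) u z) = (\<Sum>k<Suc n. (transfer q ^^ k) u z) + ((transfer q ^^ Suc n) u z - u z)"
    by (induction n) simp_all
  finally show ?thesis unfolding average_def[of q u n z] by (simp only: distrib_left)
qed

lemma transfer_nonneg:
  assumes q: "positive_prob_vector N q" and u: "\<And>x. x \<in> X \<Longrightarrow> 0 \<le> u x"
  shows "0 \<le> transfer q u z"
  unfolding transfer_def
proof (intro sum_nonneg mult_nonneg_nonneg)
  fix j I assume j: "j \<in> {1..N}"
  then show "0 \<le> q j" using finite_prob[OF q] by (meson less_imp_le)
  assume I: "I \<in> sides"
  show "0 \<le> branch_transfer (T j) I u z"
    by (rule branch_transfer_nonneg[OF branch_facts(5)[OF j I]]) (use u sides_X[OF I] in auto)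
qed

lemma transfer_pos:
  assumes q: "positive_prob_vector N q" and u: "\<And>x. x \<in> X \<Longrightarrow> 0 \<le> u x"
    and j: "j \<in> {1..N}" and I: "I \<in> sides" and y: "y \<in> I" "0 < u y"
  shows "0 < transfer q u (T j y)"
proof -
  have nn: "0 \<le> branch_transfer (T i) J u z" if "i \<in> {1..N}" "J \<in> sides" for i J z
    by (rule branch_transfer_nonneg[OF branch_facts(5)[OF that]]) (use u sides_X that in auto)
  have D: "D01 (T j) y \<noteq> 0"
    using nonpos_schwarzian_on_derivs(3)[OF branch_facts(1,2)[OF j I]] y by blast
  then have "0 < branch_transfer (T j) I u (T j y)" using branch_facts(5)[OF j I] y by simp
  then have "0 < (\<Sum>J\<in>sides. branch_transfer (T j) J u (T j y))"
    using nn[OF j] I by (intro sum_pos2[of _ I]) auto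
  then show ?thesis
    unfolding transfer_def using j finite_prob[OF q] nn
    by (intro sum_pos2[of _ j]) (auto intro!: mult_nonneg_nonneg sum_nonneg less_imp_le[of 0 "q _"])
qed

text \<open>Transferring an average changes it by \<open>1 / real (Suc n)\<close> times the
  difference of an iterate and \<open>u\<close>, and iterates are bounded at each point of
  \<open>X\<close> by \<open>cone_bound\<close>; so limits are fixed. The given sequence
  \<open>s\<close> permits later use along arbitrary subsequences.\<close>

lemma average_limit:
  assumes q: "admissible \<theta> q" and w: "coercive w"
    and mass: "(\<integral>\<^sup>+x. ennreal (u x) \<partial>lebX) = ennreal m" and m: "0 \<le> m" and cu: "cone u"
    and C: "\<And>n. (\<integral>\<^sup>+x. ennreal (w x * average q u n x) \<partial>lebX) \<le> ennreal C" and s: "strict_mono (s :: nat \<Rightarrow> nat)"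
  obtains k v where "strict_mono (k :: nat \<Rightarrow> nat)" "cone v" "\<And>x. x \<in> X \<Longrightarrow> transfer q v x = v x"
    "(\<integral>\<^sup>+x. ennreal (v x) \<partial>lebX) = ennreal m" "(\<integral>\<^sup>+x. ennreal (w x * v x) \<partial>lebX) \<le> ennreal C"
    "(\<lambda>n. \<integral>\<^sup>+x. norm (average q u (s (k n)) x - v x) \<partial>lebX) \<longlonglongrightarrow> 0"
proof -
  note p = admissible_prob[OF q]
  obtain k v where k: "strict_mono (k :: nat \<Rightarrow> nat)" and v: "cone v" "\<And>x. x \<in> X \<Longrightarrow> (\<lambda>n. average q u (s (k n)) x) \<longlonglongrightarrow> v x"
    "(\<integral>\<^sup>+x. ennreal (v x) \<partial>lebX) = ennreal m" "(\<integral>\<^sup>+x. ennreal (w x * v x) \<partial>lebX) \<le> ennreal C"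
    "(\<lambda>n. \<integral>\<^sup>+x. norm (average q u (s (k n)) x - v x) \<partial>lebX) \<longlonglongrightarrow> 0"
    using cone_compact[of "\<lambda>n. average q u (s n)" w m C] cone_average[OF p cu] w average_mass[OF p cu] mass m C
    by (auto simp: o_def)
  have "transfer q v x = v x" if x: "x \<in> X" for x
  proof -
    have 1: "(\<lambda>n. transfer q (average q u (s (k n))) x) \<longlonglongrightarrow> transfer q v x"
      by (rule transfer_tendsto) (auto intro: v(2))
    obtain I \<rho> where I: "I \<in> sides" "\<rho> > 0" "{x-\<rho>..x+\<rho>} \<subseteq> I" using side_neighbourhood[OF x] .
    have b: "\<bar>(transfer q ^^ n) u x\<bar> \<le> 4 * m / \<rho>" for n
      using cone_bound[OF cone_transfer_power[OF p cu] I(1,3,2) _ m, of n] cone_nonneg[OF cone_transfer_power[OF p cu] x, of n]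
        transfer_power_mass[OF p cu, of n] mass by simp
    have sr: "strict_mono (\<lambda>n. s (k n))" using strict_mono_o[OF s k] by (simp add: o_def)
    have "(\<lambda>n. (1 / real (Suc n)) * ((transfer q ^^ Suc n) u x - u x)) \<longlonglongrightarrow> 0"
    proof (rule Lim_null_comparison)
      show "(\<lambda>n. (1 / real (Suc n)) * (8 * m / \<rho>)) \<longlonglongrightarrow> 0" by real_asymp
      show "\<forall>\<^sub>F n in sequentially. norm ((1 / real (Suc n)) * ((transfer q ^^ Suc n) u x - u x)) \<le> (1 / real (Suc n)) * (8 * m / \<rho>)"
      proof (intro always_eventually allI)
        fix n
        have "\<bar>(transfer q ^^ Suc n) u x - u x\<bar> \<le> 8 * m / \<rho>" using b[of "Suc n"] b[of 0] by simp
        then show "norm ((1 / real (Suc n)) * ((transfer q ^^ Suc n) u x - u x)) \<le> (1 / real (Suc n)) * (8 * m / \<rho>)"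
          unfolding real_norm_def abs_mult by (intro mult_mono) auto
      qed
    qed
    then have "(\<lambda>n. (1 / real (Suc (s (k n)))) * ((transfer q ^^ Suc (s (k n))) u x - u x)) \<longlonglongrightarrow> 0"
      using LIMSEQ_subseq_LIMSEQ[OF _ sr] by (fastforce simp: o_def)
    from tendsto_add[OF v(2)[OF x] this]
    have "(\<lambda>n. transfer q (average q u (s (k n))) x) \<longlonglongrightarrow> v x" by (simp only: transfer_average add_0_right)
    then show ?thesis using 1 LIMSEQ_unique by blast
  qed
  then show ?thesis using that[OF k v(1) _ v(3,4,5)] by blast
qed

section \<open>Signs of fixed functions and uniqueness of the fixed density\<close>

lemma continuous_eq_of_integral_eq:
  assumes f: "continuous_on X f" and g: "continuous_on X g" and le: "\<And>x. x \<in> X \<Longrightarrow> 0 \<le> f x \<and> f x \<le> g x"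
    and int: "(\<integral>\<^sup>+x. ennreal (g x) \<partial>lebX) \<le> (\<integral>\<^sup>+x. ennreal (f x) \<partial>lebX)" and fin: "(\<integral>\<^sup>+x. ennreal (f x) \<partial>lebX) < \<infinity>"
    and x: "x \<in> X"
  shows "f x = (g x :: real)"
proof (rule ccontr)
  assume "f x \<noteq> g x"
  then have lt: "0 < g x - f x" using le[OF x] by simp
  have [measurable]: "f \<in> borel_measurable lebX" "g \<in> borel_measurable lebX"
    using f g measurable_lebX_continuous by auto
  have "(\<integral>\<^sup>+x. ennreal (g x) \<partial>lebX) = (\<integral>\<^sup>+x. ennreal (f x) + ennreal (g x - f x) \<partial>lebX)"
    by (intro nn_integral_cong) (use le in \<open>simp flip: ennreal_plus\<close>)
  also have "\<dots> = (\<integral>\<^sup>+x. ennreal (f x) \<partial>lebX) + (\<integral>\<^sup>+x. ennreal (g x - f x) \<partial>lebX)"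
    by (rule nn_integral_add) measurable
  finally have "(\<integral>\<^sup>+x. ennreal (f x) \<partial>lebX) + (\<integral>\<^sup>+x. ennreal (g x - f x) \<partial>lebX) \<le> (\<integral>\<^sup>+x. ennreal (f x) \<partial>lebX) + 0"
    using int by simp
  then have zero: "(\<integral>\<^sup>+x. ennreal (g x - f x) \<partial>lebX) = 0"
    using fin by (auto simp: ennreal_add_left_cancel_le)
  define d where "d = (g x - f x) / 2"
  have "open {y \<in> X. d < g y - f y}"
    using continuous_open_preimage[OF continuous_on_diff[OF g f] open_X open_greaterThan, of d]
    by (simp add: vimage_def Int_def)
  moreover have "x \<in> {y \<in> X. d < g y - f y}" using x lt by (simp add: d_def)
  ultimately obtain \<rho> where \<rho>: "\<rho> > 0" "{x-\<rho>..x+\<rho>} \<subseteq> {y \<in> X. d < g y - f y}"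
    using open_contains_symmetric_interval by metis
  have "ennreal d * ennreal (2 * \<rho>) = ennreal d * emeasure lebX {x-\<rho>..x+\<rho>}"
    using \<rho> by (subst emeasure_lebX) (auto simp: subset_iff)
  also have "\<dots> = (\<integral>\<^sup>+y. ennreal d * indicator {x-\<rho>..x+\<rho>} y \<partial>lebX)"
    using \<rho> by (intro nn_integral_cmult_indicator[symmetric]) (auto simp: sets_restrict_space_iff subset_iff)
  also have "\<dots> \<le> (\<integral>\<^sup>+y. ennreal (g y - f y) \<partial>lebX)"
    using \<rho> by (intro nn_integral_mono) (fastforce simp: indicator_def subset_iff intro!: ennreal_leI)
  finally have "ennreal d * ennreal (2 * \<rho>) = 0" using zero by simp
  then show False using lt \<rho> by (simp add: d_def ennreal_eq_0_iff)
qed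

text \<open>Positivity of the operator gives
  \<open>\<bar>G\<bar> \<le> transfer q \<bar>G\<bar>\<close>, preservation of mass makes the
  integrals equal, and continuity turns this into equality at every point of
  \<open>X\<close>.\<close>

lemma fixed_abs:
  assumes q: "positive_prob_vector N q" and G: "continuous_on X G" "\<And>x. x \<in> X \<Longrightarrow> transfer q G x = G x"
    and fin: "(\<integral>\<^sup>+x. ennreal \<bar>G x\<bar> \<partial>lebX) < \<infinity>" and x: "x \<in> X"
  shows "transfer q (\<lambda>x. \<bar>G x\<bar>) x = \<bar>G x\<bar>"
proof (rule continuous_eq_of_integral_eq[symmetric, OF _ _ _ _ fin x])
  have cG: "continuous_on X (\<lambda>x. \<bar>G x\<bar>)" using G(1) by (intro continuous_intros)
  then show "continuous_on X (\<lambda>x. \<bar>G x\<bar>)" "continuous_on X (transfer q (\<lambda>x. \<bar>G x\<bar>))"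
    by (auto intro: continuous_transfer)
  show "(\<integral>\<^sup>+x. ennreal (transfer q (\<lambda>x. \<bar>G x\<bar>) x) \<partial>lebX) \<le> (\<integral>\<^sup>+x. ennreal \<bar>G x\<bar> \<partial>lebX)"
    using transfer_mass[OF q cG] by simp
  fix z assume z: "z \<in> X"
  have "0 \<le> transfer q (\<lambda>x. \<bar>G x\<bar> + - 1 * G x) z" "0 \<le> transfer q (\<lambda>x. \<bar>G x\<bar> + G x) z"
    by (rule transfer_nonneg[OF q], simp)+
  then have "\<bar>G z\<bar> \<le> transfer q (\<lambda>x. \<bar>G x\<bar>) z"
    unfolding transfer_add transfer_scale using G(2)[OF z] by linarith
  then show "0 \<le> \<bar>G z\<bar> \<and> \<bar>G z\<bar> \<le> transfer q (\<lambda>x. \<bar>G x\<bar>) z" by simp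
qed

text \<open>The function \<open>\<bar>G\<bar> + G\<close> is fixed as well. It would vanish at
  \<open>T j y\<close> if \<open>G\<close> were not positive there, yet its positive value at the
  preimage \<open>y\<close> makes its transfer positive at \<open>T j y\<close>.\<close>

lemma fixed_sign_propagates:
  assumes q: "positive_prob_vector N q" and G: "continuous_on X G" "\<And>x. x \<in> X \<Longrightarrow> transfer q G x = G x"
    and fin: "(\<integral>\<^sup>+x. ennreal \<bar>G x\<bar> \<partial>lebX) < \<infinity>" and j: "j \<in> {1..N}" and y: "y \<in> X" "T j y \<in> X" "0 < G y"
  shows "0 < G (T j y)"
proof (rule ccontr)
  assume n: "\<not> 0 < G (T j y)"
  obtain I where I: "I \<in> sides" "y \<in> I" using X_side[OF y(1)] by blast
  have "0 < transfer q (\<lambda>x. \<bar>G x\<bar> + G x) (T j y)"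
    by (rule transfer_pos[OF q _ j I]) (use y in auto)
  then show False
    unfolding transfer_add using fixed_abs[OF q G fin y(2)] G(2)[OF y(2)] n by simp
qed

lemma bad_orbit:
  assumes b: "b \<in> Bad" and x: "x \<in> X"
  shows "\<And>n. (T b ^^ n) x \<in> X" "(\<lambda>n. (T b ^^ n) x) \<longlonglongrightarrow> c"
proof -
  have bN: "b \<in> {1..N}" using b Bad_subset by blast
  interpret branch_map c "T b" "r b" by (rule branch[OF bN])
  have step: "T b z \<in> X" if "z \<in> X" for z
    using that bad_image[OF b] sides_X X_side[OF that] by blast
  show X: "(T b ^^ n) x \<in> X" for n by (induction n) (auto simp: x step)
  obtain \<beta> where \<beta>: "1 < \<beta>" "\<And>x. x \<in> X \<Longrightarrow> recip_dist (T b x) \<le> recip_dist x / \<beta>"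
    using recip_dist_contraction bad_image[OF b] by blast
  have rec: "recip_dist ((T b ^^ n) x) \<le> recip_dist x / \<beta> ^ n" for n
  proof (induction n)
    case (Suc n)
    have "recip_dist ((T b ^^ Suc n) x) \<le> recip_dist ((T b ^^ n) x) / \<beta>" using \<beta>(2)[OF X] by simp
    also have "\<dots> \<le> recip_dist x / \<beta> ^ n / \<beta>" using Suc \<beta>(1) by (intro divide_right_mono) auto
    finally show ?case by (simp add: mult.commute)
  qed simp
  \<comment> \<open>For \<open>z < c\<close> the coordinate is \<open>(c - z) / (z * c)\<close> with
    \<open>z * c \<le> 1\<close>; on the other side \<open>1 - z\<close> and \<open>1 - c\<close>
    take these places.\<close>
  have dist: "\<bar>z - c\<bar> \<le> recip_dist z" if z: "z \<in> X" for z
  proof (cases "z < c")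
    case True
    then have "z * c \<le> 1" "0 < z * c" using z c_pos c_less by (auto simp: X_def mult_le_one)
    then have "(c - z) * 1 \<le> (c - z) * (1 / (z * c))" using True by (intro mult_left_mono) auto
    also have "\<dots> = 1 / z - 1 / c" using True z c_pos by (simp add: X_def field_simps)
    finally show ?thesis using True by (simp add: recip_dist_def)
  next
    case False
    then have p: "(1 - z) * (1 - c) \<le> 1" "0 < (1 - z) * (1 - c)" using z c_pos c_less by (auto simp: X_def mult_le_one)
    then have "(z - c) * 1 \<le> (z - c) * (1 / ((1 - z) * (1 - c)))" using False by (intro mult_left_mono) auto
    also have "\<dots> = 1 / (1 - z) - 1 / (1 - c)" using p z c_less by (simp add: X_def field_simps)
    finally show ?thesis using False by (simp add: recip_dist_def)
  qed
  have "(\<lambda>n. (T b ^^ n) x - c) \<longlonglongrightarrow> 0"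
  proof (rule Lim_null_comparison)
    have "(\<lambda>n. recip_dist x * (1 / \<beta>) ^ n) \<longlonglongrightarrow> recip_dist x * 0"
      using \<beta>(1) by (intro tendsto_intros LIMSEQ_realpow_zero) auto
    then show "(\<lambda>n. recip_dist x / \<beta> ^ n) \<longlonglongrightarrow> 0" by (simp add: power_divide)
    show "\<forall>\<^sub>F n in sequentially. norm ((T b ^^ n) x - c) \<le> recip_dist x / \<beta> ^ n"
      using dist[OF X] rec by (auto intro!: always_eventually intro: order_trans)
  qed
  then show "(\<lambda>n. (T b ^^ n) x) \<longlonglongrightarrow> c" by (simp add: LIM_zero_iff)
qed

text \<open>The critical point attracts every point under a bad map, while a good map pulls a neighbourhood of it back
  to a neighbourhood of the regular point \<open>y\<close>. So the sign of a fixed function anywhere shows at \<open>y\<close>.\<close>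

lemma fixed_sign_at_preimage:
  assumes q: "positive_prob_vector N q"
  obtains y where "y \<in> X" "\<And>G x. continuous_on X G \<Longrightarrow> (\<And>x. x \<in> X \<Longrightarrow> transfer q G x = G x) \<Longrightarrow>
     (\<integral>\<^sup>+x. ennreal \<bar>G x\<bar> \<partial>lebX) < \<infinity> \<Longrightarrow> x \<in> X \<Longrightarrow> 0 < G x \<Longrightarrow> 0 \<le> G y"
proof -
  obtain j where j: "j \<in> {1..N} - Bad" using Good_nonempty by blast
  then have jN: "j \<in> {1..N}" by simp
  obtain b where b: "b \<in> Bad" using Bad_nonempty by blast
  have bN: "b \<in> {1..N}" using b Bad_subset by blast
  define I where "I = {0<..<c}"
  have I: "I \<in> sides" by (simp add: I_def sides_def)
  have im: "T j ` I = {0<..<1}" by (rule good_image[OF j I])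
  define \<psi> where "\<psi> = the_inv_into I (T j)"
  note bf = branch_facts[OF jN I]
  have \<psi>: "\<psi> z \<in> I" "T j (\<psi> z) = z" if "z \<in> {0<..<1}" for z
    using that im bf(5) by (auto simp: \<psi>_def intro!: the_inv_into_into f_the_inv_into_f)
  have c\<psi>: "continuous_on {0<..<1} \<psi>"
    unfolding im[symmetric] \<psi>_def
    by (rule continuous_on_inverse_open[OF bf(3) nonpos_schwarzian_on_derivs(4)[OF bf(1,2)]])
      (auto simp: bf(5) the_inv_into_f_f)
  define y where "y = \<psi> c"
  have c01: "c \<in> {0<..<1}" using c_pos c_less by simp
  have yX: "y \<in> X" using \<psi>(1)[OF c01] sides_X[OF I] by (auto simp: y_def)
  have "0 \<le> G y" if G: "continuous_on X G" "\<And>x. x \<in> X \<Longrightarrow> transfer q G x = G x"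
    and fin: "(\<integral>\<^sup>+x. ennreal \<bar>G x\<bar> \<partial>lebX) < \<infinity>" and x: "x \<in> X" "0 < G x" for G x
  proof (rule ccontr)
    assume n: "\<not> 0 \<le> G y"
    define z where "z n = (T b ^^ n) x" for n
    have zX: "z n \<in> X" for n unfolding z_def by (rule bad_orbit(1)[OF b x(1)])
    have zl: "z \<longlonglongrightarrow> c" unfolding z_def by (rule bad_orbit(2)[OF b x(1)])
    have zpos: "0 < G (z n)" for n
    proof (induction n)
      case (Suc n)
      then show ?case
        using fixed_sign_propagates[OF q G fin bN zX[of n]] zX[of "Suc n"] by (simp add: z_def)
    qed (simp add: z_def x)
    have z01: "z n \<in> {0<..<1}" for n using zX[of n] by (simp add: X_def)
    have "(\<lambda>n. \<psi> (z n)) \<longlonglongrightarrow> y"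
      unfolding y_def by (rule continuous_on_tendsto_compose[OF c\<psi> zl c01]) (simp add: z01 del: greaterThanLessThan_iff)
    then have "(\<lambda>n. G (\<psi> (z n))) \<longlonglongrightarrow> G y"
      by (rule continuous_on_tendsto_compose[OF G(1) _ yX]) (intro always_eventually allI, use \<psi>(1)[OF z01] sides_X[OF I] in blast)
    then have "\<forall>\<^sub>F n in sequentially. G (\<psi> (z n)) < 0" using n by (intro order_tendstoD(2)) auto
    then obtain n where neg: "G (\<psi> (z n)) < 0" using eventually_happens' sequentially_bot by blast
    have G': "continuous_on X (\<lambda>x. - 1 * G x)" "\<And>x. x \<in> X \<Longrightarrow> transfer q (\<lambda>x. - 1 * G x) x = - 1 * G x"
      using G by (auto intro!: continuous_intros simp only: transfer_scale)
    \<comment> \<open>A negative sign at the preimage of \<open>z n\<close> would be carried by the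
      good map to \<open>z n\<close> itself, where the bad orbit has made \<open>G\<close>
      positive.\<close>
    have "0 < - 1 * G (T j (\<psi> (z n)))"
      by (rule fixed_sign_propagates[OF q G' _ jN])
        (use fin \<psi>[OF z01] sides_X[OF I] zX neg in auto)
    then show False using zpos[of n] \<psi>(2)[OF z01] by simp
  qed
  then show ?thesis using that yX by blast
qed

text \<open>A Koebe function that is positive at one point is positive on that whole side, and a
  good map sends the side onto all of \<open>(0,1)\<close>.\<close>

lemma fixed_positive:
  assumes q: "positive_prob_vector N q" and \<phi>: "cone \<phi>" "\<And>x. x \<in> X \<Longrightarrow> transfer q \<phi> x = \<phi> x"
    and ne: "(\<integral>\<^sup>+x. ennreal (\<phi> x) \<partial>lebX) \<noteq> 0" and z: "z \<in> X"
  shows "0 < \<phi> z"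
proof -
  have "\<exists>x\<in>X. 0 < \<phi> x"
  proof (rule ccontr)
    assume "\<not> ?thesis"
    then have "(\<integral>\<^sup>+x. ennreal (\<phi> x) \<partial>lebX) = (\<integral>\<^sup>+x. 0 \<partial>lebX)"
      by (intro nn_integral_cong) (auto simp: not_less ennreal_neg)
    then show False using ne by simp
  qed
  then obtain x I where x: "x \<in> X" "0 < \<phi> x" "I \<in> sides" "x \<in> I" using X_side by blast
  obtain j where j: "j \<in> {1..N} - Bad" using Good_nonempty by blast
  have "z \<in> T j ` I" using good_image[OF j x(3)] z by (auto simp: X_def)
  then obtain y where y: "y \<in> I" "z = T j y" by blast
  have "0 < \<phi> y"
    using x y \<phi>(1) koebe_on_pos[of _ _ \<phi> x y] by (auto simp: cone_def sides_def)
  then have "0 < transfer q \<phi> z"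
    unfolding y(2) using j x(3) y(1) by (intro transfer_pos[OF q cone_nonneg[OF \<phi>(1)]]) auto
  then show ?thesis using \<phi>(2)[OF z] by simp
qed

lemma fixed_unique:
  assumes q: "positive_prob_vector N q"
    and \<phi>: "cone \<phi>" "\<And>x. x \<in> X \<Longrightarrow> transfer q \<phi> x = \<phi> x" "(\<integral>\<^sup>+x. ennreal (\<phi> x) \<partial>lebX) = 1"
    and \<xi>: "cone \<xi>" "\<And>x. x \<in> X \<Longrightarrow> transfer q \<xi> x = \<xi> x" "(\<integral>\<^sup>+x. ennreal (\<xi> x) \<partial>lebX) = 1"
    and x: "x \<in> X"
  shows "\<phi> x = \<xi> x"
proof -
  obtain y where y: "y \<in> X" and sign: "\<And>G x. continuous_on X G \<Longrightarrow> (\<And>x. x \<in> X \<Longrightarrow> transfer q G x = G x) \<Longrightarrow>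
     (\<integral>\<^sup>+x. ennreal \<bar>G x\<bar> \<partial>lebX) < \<infinity> \<Longrightarrow> x \<in> X \<Longrightarrow> 0 < G x \<Longrightarrow> 0 \<le> G y"
    using fixed_sign_at_preimage[OF q] by blast
  have \<xi>pos: "0 < \<xi> z" if "z \<in> X" for z by (rule fixed_positive[OF q \<xi>(1,2) _ that]) (simp_all add: \<xi>(3))
  have [measurable]: "\<phi> \<in> borel_measurable lebX" "\<xi> \<in> borel_measurable lebX"
    using \<phi>(1) \<xi>(1) cone_measurable by auto
  \<comment> \<open>The restriction \<open>t < 1\<close> selects the sign: were the difference
    negative somewhere, it would be nonpositive everywhere, since it does not vanish at
    \<open>y\<close>; then mass one would be at most \<open>t\<close>.\<close>
  have ge: "t * \<xi> z \<le> \<phi> z" if t: "0 < t" "t < 1" "t \<noteq> \<phi> y / \<xi> y" and z: "z \<in> X" for t z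
  proof (rule ccontr)
    assume neg: "\<not> t * \<xi> z \<le> \<phi> z"
    define G where "G x = 1 * \<phi> x + (- t) * \<xi> x" for x
    have cG: "continuous_on X G" unfolding G_def by (intro continuous_intros cone_continuous \<phi>(1) \<xi>(1))
    have fG: "transfer q G x = G x" if "x \<in> X" for x
      unfolding G_def transfer_linear using \<phi>(2)[OF that] \<xi>(2)[OF that] by simp
    have fin: "(\<integral>\<^sup>+x. ennreal \<bar>G x\<bar> \<partial>lebX) < \<infinity>"
    proof -
      have "(\<integral>\<^sup>+x. ennreal \<bar>G x\<bar> \<partial>lebX) \<le> (\<integral>\<^sup>+x. ennreal (\<phi> x) + ennreal (\<xi> x) \<partial>lebX)"
      proof (rule nn_integral_mono)
        fix x assume "x \<in> space lebX"
        then have nn: "0 \<le> \<phi> x" "0 \<le> \<xi> x" using cone_nonneg \<phi>(1) \<xi>(1) by auto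
        then have "0 \<le> t * \<xi> x" "t * \<xi> x \<le> \<xi> x" using t by (auto simp: mult_left_le_one_le)
        then have "\<bar>G x\<bar> \<le> \<phi> x + \<xi> x" using nn unfolding G_def by (simp add: abs_le_iff)
        then show "ennreal \<bar>G x\<bar> \<le> ennreal (\<phi> x) + ennreal (\<xi> x)" using nn by (simp flip: ennreal_plus add: ennreal_leI)
      qed
      also have "\<dots> = (\<integral>\<^sup>+x. ennreal (\<phi> x) \<partial>lebX) + (\<integral>\<^sup>+x. ennreal (\<xi> x) \<partial>lebX)" by (rule nn_integral_add) measurable
      also have "\<dots> < \<infinity>" by (simp add: \<phi>(3) \<xi>(3))
      finally show ?thesis .
    qed
    have "(\<lambda>x. - 1 * G x) z > 0" using neg by (simp add: G_def)
    then have "0 \<le> - 1 * G y"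
    proof (intro sign[of "\<lambda>x. - 1 * G x" z] z)
      show "transfer q (\<lambda>x. - 1 * G x) v = - 1 * G v" if "v \<in> X" for v
        by (simp only: transfer_scale fG[OF that])
    qed (use cG fin in \<open>auto intro!: continuous_intros\<close>)
    moreover have "G y \<noteq> 0" using t(3) \<xi>pos[OF y] by (auto simp: G_def)
    ultimately have Gy: "G y < 0" by simp
    have "G v \<le> 0" if "v \<in> X" for v
      using sign[of G v] cG fG fin that Gy by fastforce
    then have le: "\<phi> v \<le> t * \<xi> v" if "v \<in> X" for v using that by (simp add: G_def)
    have "1 = (\<integral>\<^sup>+x. ennreal (\<phi> x) \<partial>lebX)" by (simp add: \<phi>(3))
    also have "\<dots> \<le> (\<integral>\<^sup>+x. ennreal t * ennreal (\<xi> x) \<partial>lebX)"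
      by (intro nn_integral_mono) (use le t cone_nonneg[OF \<xi>(1)] in \<open>auto simp: ennreal_leI simp flip: ennreal_mult\<close>)
    also have "\<dots> = ennreal t" by (subst nn_integral_cmult) (auto simp: \<xi>(3))
    also have "\<dots> < 1" using t by simp
    finally show False by simp
  qed
  have ge1: "\<xi> z \<le> \<phi> z" if z: "z \<in> X" for z
  proof (rule ccontr)
    assume "\<not> \<xi> z \<le> \<phi> z"
    then have lt: "\<phi> z / \<xi> z < 1" "0 \<le> \<phi> z / \<xi> z" using \<xi>pos[OF z] cone_nonneg[OF \<phi>(1) z] by auto
    define a where "a = \<phi> z / \<xi> z"
    \<comment> \<open>Two different candidates between \<open>a\<close> and \<open>1\<close> are
      offered, so one of them misses the single exceptional value \<open>k\<close>.\<close>
    have avoid: "\<exists>t. a < t \<and> t < 1 \<and> t \<noteq> k" if "a < 1" for a k :: real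
    proof (cases "(a + 1) / 2 = k")
      case True
      then show ?thesis using that by (intro exI[of _ "(a + 3) / 4"]) auto
    next
      case False
      then show ?thesis using that by (intro exI[of _ "(a + 1) / 2"]) auto
    qed
    have "\<exists>t. a < t \<and> t < 1 \<and> t \<noteq> \<phi> y / \<xi> y" using avoid lt(1) by (simp add: a_def)
    then obtain t where t: "a < t" "t < 1" "t \<noteq> \<phi> y / \<xi> y" by blast
    then have "t * \<xi> z \<le> \<phi> z" using ge[of t z] lt z by (auto simp: a_def)
    then show False using t(1) \<xi>pos[OF z] by (simp add: a_def field_simps)
  qed
  have "\<xi> x = \<phi> x"
    by (rule continuous_eq_of_integral_eq[OF cone_continuous[OF \<xi>(1)] cone_continuous[OF \<phi>(1)] _ _ _ x])
      (use ge1 cone_nonneg[OF \<xi>(1)] \<phi>(3) \<xi>(3) in auto)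
  then show ?thesis ..
qed

end

section \<open>Stationary measures and weak convergence\<close>

context punctured_interval
begin

lemma finite_measure_lebX: "finite_measure lebX"
  by (rule finite_measureI) (simp add: emeasure_lebX_X)

lemma AE_lebX_I: "AE x in lborel. P x \<Longrightarrow> AE x in lebX. P x"
  unfolding lebX_def by (subst AE_restrict_space_iff) auto

lemma bounded_measurable_approx_continuous:
  fixes g :: "real \<Rightarrow> real"
  assumes g: "g \<in> borel_measurable borel" "\<And>x. 0 \<le> g x" "\<And>x. g x \<le> M" and e: "0 < e"
  obtains f where "continuous_on UNIV f" "(\<integral>\<^sup>+x. ennreal \<bar>g x - f x\<bar> \<partial>lebX) < ennreal e"
proof -
  have "g \<in> borel_measurable lebesgue" using measurable_completion[of g lborel borel] g(1) by simp
  then have "g measurable_on UNIV" by (intro lebesgue_measurable_imp_measurable_on) auto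
  then obtain Z h where Z: "negligible Z" and h: "\<And>n. continuous_on UNIV (h n)" "\<And>x. x \<notin> Z \<Longrightarrow> (\<lambda>n. h n x) \<longlonglongrightarrow> g x"
    unfolding measurable_on_def by auto
  \<comment> \<open>Truncation to \<open>[0, M]\<close> provides a dominating constant and does not
    disturb the limit, as \<open>g\<close> takes its values in this interval.\<close>
  define f where "f n x = max 0 (min M (h n x))" for n x
  have cf: "continuous_on UNIV (f n)" for n unfolding f_def by (intro continuous_intros h)
  have M: "0 \<le> M" using g(2,3) order_trans by blast
  have "(\<lambda>n. \<integral>\<^sup>+x. norm (g x - f n x) \<partial>lebX) \<longlonglongrightarrow> 0"
  proof (rule nn_integral_dominated_convergence_norm[where w = "\<lambda>x. M"])
    show "f n \<in> borel_measurable lebX" for n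
      by (intro measurable_lebX_borel borel_measurable_continuous_onI cf)
    show "g \<in> borel_measurable lebX" by (intro measurable_lebX_borel g)
    show "AE x in lebX. norm (f n x) \<le> M" for n using M by (simp add: f_def)
    show "(\<integral>\<^sup>+x. ennreal M \<partial>lebX) < \<infinity>" by (simp add: emeasure_lebX_X)
    have "AE x in lebesgue. x \<notin> Z" using Z by (simp add: AE_not_in negligible_iff_null_sets)
    then have "AE x in lborel. x \<notin> Z" by (simp add: AE_completion_iff)
    then have "AE x in lebX. x \<notin> Z" by (rule AE_lebX_I)
    then show "AE x in lebX. (\<lambda>n. f n x) \<longlonglongrightarrow> g x"
    proof eventually_elim
      case (elim x)
      have "(\<lambda>n. f n x) \<longlonglongrightarrow> max 0 (min M (g x))" unfolding f_def by (intro tendsto_intros h elim)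
      moreover have "max 0 (min M (g x)) = g x" using g(2,3)[of x] by simp
      ultimately show ?case by simp
    qed
  qed simp
  then have "\<forall>\<^sub>F n in sequentially. (\<integral>\<^sup>+x. norm (g x - f n x) \<partial>lebX) < ennreal e"
    by (rule order_tendstoD) (use e in simp)
  then obtain n where "(\<integral>\<^sup>+x. norm (g x - f n x) \<partial>lebX) < ennreal e"
    using eventually_happens' sequentially_bot by blast
  then show ?thesis using that[OF cf, of n] by simp
qed

text \<open>Three errors of \<open>e / 3\<close>: cutting \<open>g\<close> off at a height
  \<open>n\<close>, replacing the bounded function by a continuous one, and Weierstrass
  approximation on \<open>[0,1]\<close>, where Lebesgue measure has mass one.\<close>

lemma integrable_approx_polynomial:
  fixes g :: "real \<Rightarrow> real"
  assumes g: "g \<in> borel_measurable borel" "\<And>x. 0 \<le> g x" and fin: "(\<integral>\<^sup>+x. ennreal (g x) \<partial>lebX) < \<infinity>" and e: "0 < e"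
  obtains v where "real_polynomial_function v" "(\<integral>\<^sup>+x. ennreal \<bar>g x - v x\<bar> \<partial>lebX) \<le> ennreal e"
proof -
  have [measurable]: "g \<in> borel_measurable lebX" by (intro measurable_lebX_borel g)
  have "(\<lambda>n. \<integral>\<^sup>+x. norm (g x - min (g x) (real n)) \<partial>lebX) \<longlonglongrightarrow> 0"
  proof (rule nn_integral_dominated_convergence_norm[where w = g])
    show "AE x in lebX. norm (min (g x) (real n)) \<le> g x" for n using g(2) by simp
    show "AE x in lebX. (\<lambda>n. min (g x) (real n)) \<longlonglongrightarrow> g x"
    proof (rule AE_I2)
      fix x
      obtain m where "g x \<le> real m" using real_arch_simple by blast
      then have "\<forall>\<^sub>F n in sequentially. min (g x) (real n) = g x"
        unfolding eventually_sequentially by (intro exI[of _ m]) (auto simp: min_def)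
      then show "(\<lambda>n. min (g x) (real n)) \<longlonglongrightarrow> g x" by (rule tendsto_eventually)
    qed
  qed (use fin in auto)
  then have "\<forall>\<^sub>F n in sequentially. (\<integral>\<^sup>+x. norm (g x - min (g x) (real n)) \<partial>lebX) < ennreal (e / 3)"
    by (rule order_tendstoD) (use e in simp)
  then obtain n where n: "(\<integral>\<^sup>+x. norm (g x - min (g x) (real n)) \<partial>lebX) < ennreal (e / 3)"
    using eventually_happens' sequentially_bot by blast
  obtain f where f: "continuous_on UNIV f" "(\<integral>\<^sup>+x. ennreal \<bar>min (g x) (real n) - f x\<bar> \<partial>lebX) < ennreal (e / 3)"
  proof (rule bounded_measurable_approx_continuous[of "\<lambda>x. min (g x) (real n)" "real n" "e / 3"])
    show "(\<lambda>x. min (g x) (real n)) \<in> borel_measurable borel" using g(1) by measurable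
  qed (use g(2) e in auto)
  obtain v where v: "real_polynomial_function v" "\<And>x. x \<in> {0..1} \<Longrightarrow> \<bar>f x - v x\<bar> < e / 3"
  proof (rule Stone_Weierstrass_real_polynomial_function[of "{0..1}" f "e / 3"])
    show "continuous_on {0..1} f" using f(1) continuous_on_subset by blast
  qed (use e in auto)
  have [measurable]: "f \<in> borel_measurable lebX" by (intro measurable_lebX_borel borel_measurable_continuous_onI f)
  have "(\<integral>\<^sup>+x. ennreal \<bar>g x - v x\<bar> \<partial>lebX) \<le>
      (\<integral>\<^sup>+x. (ennreal (norm (g x - min (g x) (real n))) + ennreal \<bar>min (g x) (real n) - f x\<bar>) + ennreal (e / 3) \<partial>lebX)"
  proof (rule nn_integral_mono)
    fix x assume "x \<in> space lebX"
    then have "\<bar>f x - v x\<bar> \<le> e / 3" using v(2)[of x] by (auto simp: X_def)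
    then have "\<bar>g x - v x\<bar> \<le> (norm (g x - min (g x) (real n)) + \<bar>min (g x) (real n) - f x\<bar>) + e / 3"
      unfolding real_norm_def by linarith
    then have "ennreal \<bar>g x - v x\<bar> \<le> ennreal ((norm (g x - min (g x) (real n)) + \<bar>min (g x) (real n) - f x\<bar>) + e / 3)"
      by (rule ennreal_leI)
    then show "ennreal \<bar>g x - v x\<bar> \<le> (ennreal (norm (g x - min (g x) (real n))) + ennreal \<bar>min (g x) (real n) - f x\<bar>) + ennreal (e / 3)"
      using e by (simp add: ennreal_plus)
  qed
  also have "\<dots> = ((\<integral>\<^sup>+x. norm (g x - min (g x) (real n)) \<partial>lebX) + (\<integral>\<^sup>+x. ennreal \<bar>min (g x) (real n) - f x\<bar> \<partial>lebX)) + ennreal (e / 3)"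
  proof -
    have [measurable]: "(\<lambda>x. ennreal (norm (g x - min (g x) (real n)))) \<in> borel_measurable lebX"
      "(\<lambda>x. ennreal \<bar>min (g x) (real n) - f x\<bar>) \<in> borel_measurable lebX" by measurable
    have "(\<integral>\<^sup>+x. ennreal (e / 3) \<partial>lebX) = ennreal (e / 3)" by (simp add: emeasure_lebX_X)
    then show ?thesis by (simp add: nn_integral_add)
  qed
  also have "\<dots> \<le> ennreal (e / 3) + ennreal (e / 3) + ennreal (e / 3)"
    by (intro add_mono less_imp_le[OF n] less_imp_le[OF f(2)] order_refl)
  also have "\<dots> = ennreal e" using e by (simp flip: ennreal_plus)
  finally show ?thesis using that v(1) by blast
qed

text \<open>A polynomial is the difference of \<open>C + v\<close> and the constant
  \<open>C\<close>, both in the cone. The summands \<open>B + L\<close> of \<open>C\<close> secure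
  the Koebe property; the extra \<open>1\<close> keeps \<open>C + v\<close> away from zero, so that
  it has positive mass.\<close>

lemma polynomial_cone:
  assumes v: "real_polynomial_function v"
  obtains C U where "1 \<le> C" "cone (\<lambda>x. C + v x)" "\<And>x. x \<in> X \<Longrightarrow> 1 \<le> C + v x" "\<And>x. x \<in> X \<Longrightarrow> C + v x \<le> U"
proof -
  obtain v' where v': "real_polynomial_function v'" "\<And>x. (v has_real_derivative v' x) (at x)"
    using has_real_derivative_polynomial_function[OF v] by blast
  have cont: "continuous_on {0..1} v" "continuous_on {0..1} v'"
    using continuous_real_polymonial_function[OF v] continuous_real_polymonial_function[OF v'(1)]
    by (auto intro: continuous_at_imp_continuous_on)
  have bd: "\<exists>B\<ge>0. \<forall>x\<in>{0..1}. \<bar>f x\<bar> \<le> B" if "continuous_on {0..1} f" for f :: "real \<Rightarrow> real"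
  proof -
    have "bounded (f ` {0..1})" using that by (intro compact_imp_bounded compact_continuous_image) auto
    then obtain B where B: "\<forall>y\<in>f ` {0..1}. norm y \<le> B" unfolding bounded_iff by blast
    have "\<bar>f x\<bar> \<le> max B 0" if "x \<in> {0..1}" for x using bspec[OF B imageI[OF that]] by (simp add: le_max_iff_disj)
    then show ?thesis by (intro exI[of _ "max B 0"]) simp
  qed
  obtain B where B: "0 \<le> B" "\<And>x. x \<in> {0..1} \<Longrightarrow> \<bar>v x\<bar> \<le> B" using bd[OF cont(1)] by blast
  obtain L where L: "0 \<le> L" "\<And>x. x \<in> {0..1} \<Longrightarrow> \<bar>v' x\<bar> \<le> L" using bd[OF cont(2)] by blast
  have lip: "\<bar>v x - v y\<bar> \<le> L * \<bar>x - y\<bar>" if "x \<in> {0..1}" "y \<in> {0..1}" for x y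
    using field_differentiable_bound[of "{0..1}" v v' L x y] that v'(2) L(2) by (auto intro: DERIV_subset)
  define C where "C = B + L + 1"
  have k: "koebe_on I (\<lambda>x. C + v x)" if "I \<subseteq> {0..1}" for I
    by (rule koebe_on_add_const[OF that lip B(2) _ L(1)]) (auto simp: C_def)
  have "cone (\<lambda>x. C + v x)" unfolding cone_def using k side_01 by blast
  moreover have "1 \<le> C + v x" "C + v x \<le> C + B" if "x \<in> X" for x
    using B(2)[of x] L(1) that by (auto simp: C_def X_def abs_le_iff)
  moreover have "1 \<le> C" using B L by (simp add: C_def)
  ultimately show ?thesis using that by blast
qed

lemma cone_const: "0 \<le> C \<Longrightarrow> cone (\<lambda>x. C)"
  unfolding cone_def using koebe_on_add_const[OF side_01, of _ "\<lambda>x. 0" 0 0 C] by auto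

lemma cone_integrable:
  assumes "cone u" "(\<integral>\<^sup>+x. ennreal (u x) \<partial>lebX) < \<infinity>"
  shows "integrable lebX u"
  using assms cone_nonneg by (intro integrableI_nonneg cone_measurable) (auto intro!: AE_I2)

lemma integrable_bounded_mult:
  fixes h u :: "real \<Rightarrow> real"
  assumes "integrable lebX u" "h \<in> borel_measurable lebX" "\<And>x. x \<in> X \<Longrightarrow> \<bar>h x\<bar> \<le> B"
  shows "integrable lebX (\<lambda>x. h x * u x)"
proof (rule Bochner_Integration.integrable_bound[of _ "\<lambda>x. B * u x"])
  show "integrable lebX (\<lambda>x. B * u x)" using assms(1) by simp
  show "(\<lambda>x. h x * u x) \<in> borel_measurable lebX" using assms by measurable
  show "AE x in lebX. norm (h x * u x) \<le> norm (B * u x)"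
  proof (rule AE_I2)
    fix x assume "x \<in> space lebX"
    then have "\<bar>h x\<bar> \<le> \<bar>B\<bar>" using assms(3)[of x] by simp
    then show "norm (h x * u x) \<le> norm (B * u x)" by (simp add: abs_mult mult_right_mono)
  qed
qed

lemma L1_convergence_bounded_mult:
  fixes u :: "nat \<Rightarrow> real \<Rightarrow> real"
  assumes u: "\<And>n. integrable lebX (u n)" and v: "integrable lebX v"
    and h: "h \<in> borel_measurable lebX" "\<And>x. x \<in> X \<Longrightarrow> \<bar>h x\<bar> \<le> B"
    and lim: "(\<lambda>n. \<integral>\<^sup>+x. norm (u n x - v x) \<partial>lebX) \<longlonglongrightarrow> 0"
  shows "(\<lambda>n. \<integral>x. h x * u n x \<partial>lebX) \<longlonglongrightarrow> (\<integral>x. h x * v x \<partial>lebX)"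
proof -
  have eq: "(\<integral>\<^sup>+x. norm (u n x - v x) \<partial>lebX) = ennreal (\<integral>x. \<bar>u n x - v x\<bar> \<partial>lebX)" for n
    using u v by (simp add: nn_integral_eq_integral)
  have "(\<lambda>n. \<integral>x. \<bar>u n x - v x\<bar> \<partial>lebX) \<longlonglongrightarrow> 0"
    using lim unfolding eq by (subst (asm) ennreal_0[symmetric], subst (asm) tendsto_ennreal_iff) auto
  then have 0: "(\<lambda>n. B * (\<integral>x. \<bar>u n x - v x\<bar> \<partial>lebX)) \<longlonglongrightarrow> 0" by (rule tendsto_mult_right_zero)
  have "(\<lambda>n. (\<integral>x. h x * u n x \<partial>lebX) - (\<integral>x. h x * v x \<partial>lebX)) \<longlonglongrightarrow> 0"
  proof (rule Lim_null_comparison[OF _ 0], intro always_eventually allI)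
    fix n
    have "(\<integral>x. h x * u n x \<partial>lebX) - (\<integral>x. h x * v x \<partial>lebX) = (\<integral>x. h x * (u n x - v x) \<partial>lebX)"
      by (simp add: right_diff_distrib Bochner_Integration.integral_diff integrable_bounded_mult[OF u h] integrable_bounded_mult[OF v h])
    also have "norm \<dots> \<le> (\<integral>x. norm (h x * (u n x - v x)) \<partial>lebX)" by (rule integral_norm_bound)
    also have "\<dots> \<le> (\<integral>x. B * \<bar>u n x - v x\<bar> \<partial>lebX)"
    proof (rule integral_mono)
      show "integrable lebX (\<lambda>x. norm (h x * (u n x - v x)))"
        by (intro integrable_norm integrable_bounded_mult[OF _ h] Bochner_Integration.integrable_diff u v)
      show "integrable lebX (\<lambda>x. B * \<bar>u n x - v x\<bar>)" using u v by simp
      show "norm (h x * (u n x - v x)) \<le> B * \<bar>u n x - v x\<bar>" if "x \<in> space lebX" for x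
        using h(2)[of x] that by (simp add: abs_mult mult_right_mono)
    qed
    finally show "norm ((\<integral>x. h x * u n x \<partial>lebX) - (\<integral>x. h x * v x \<partial>lebX)) \<le> B * (\<integral>x. \<bar>u n x - v x\<bar> \<partial>lebX)" by simp
  qed
  then show ?thesis by (simp add: LIM_zero_iff)
qed

lemma cone_integral_eq:
  assumes "cone u" "(\<integral>\<^sup>+x. ennreal (u x) \<partial>lebX) = ennreal m" "0 \<le> m"
  shows "(\<integral>x. u x \<partial>lebX) = m"
  using assms cone_nonneg by (subst integral_eq_nn_integral) (auto intro!: AE_I2 cone_measurable)

end

section \<open>Absolutely continuous stationary measures and their densities\<close>

context random_branches
begin

lemma T_measurable01:
  assumes j: "j \<in> {1..N}"
  shows "T j \<in> borel01 \<rightarrow>\<^sub>M borel01"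
proof (rule measurable_restrict_space2)
  interpret branch_map c "T j" "r j" by (rule branch[OF j])
  show "T j \<in> space borel01 \<rightarrow> {0..1}" using maps by (auto simp: space_restrict_space)
  \<comment> \<open>Continuity of the map is known only on \<open>X\<close>; its values at
    \<open>0\<close>, \<open>1\<close> and \<open>c\<close> are patched in, giving a Borel function
    that agrees with it on \<open>[0,1]\<close>.\<close>
  define F where "F x = (if x \<in> X then indicator X x *\<^sub>R T j x else if x = 0 then T j 0 else if x = 1 then T j 1 else T j c)" for x
  have "(\<lambda>x. indicator X x *\<^sub>R T j x) \<in> borel_measurable borel"
    by (rule borel_measurable_continuous_on_indicator[OF X_borel continuous_T[OF j]])
  then have "F \<in> borel_measurable borel" unfolding F_def by measurable
  then have "F \<in> borel_measurable borel01" by (rule measurable_restrict_space1)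
  then show "T j \<in> borel_measurable borel01"
    by (rule measurable_cong[THEN iffD1, rotated]) (auto simp: F_def X_def space_restrict_space indicator_def)
qed

lemma stationary_nn_integral:
  assumes st: "stationary N T q \<mu>" and h: "h \<in> borel_measurable borel01"
  shows "(\<Sum>j=1..N. ennreal (q j) * (\<integral>\<^sup>+x. h (T j x) \<partial>\<mu>)) = (\<integral>\<^sup>+x. h x \<partial>\<mu>)"
proof -
  have s [measurable_cong]: "sets \<mu> = sets borel01" using st by (simp add: stationary_def)
  have sp: "space \<mu> = {0..1}" using sets_eq_imp_space_eq[OF s] by (simp add: space_restrict_space)
  have Tm: "T j \<in> \<mu> \<rightarrow>\<^sub>M borel01" if "j \<in> {1..N}" for j
    using T_measurable01[OF that] by (subst measurable_cong_sets[OF s refl])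
  have cm: "(\<lambda>x. k (T j x)) \<in> borel_measurable \<mu>" if "k \<in> borel_measurable borel01" "j \<in> {1..N}" for k :: "real \<Rightarrow> ennreal" and j
    using measurable_compose[OF Tm[OF that(2)] that(1)] .
  have km: "k \<in> borel_measurable \<mu>" if "k \<in> borel_measurable borel01" for k :: "real \<Rightarrow> ennreal"
    using that by (subst measurable_cong_sets[OF s refl])
  show ?thesis
    using h
  proof (induct rule: borel_measurable_induct)
    case (cong f g)
    have "(\<integral>\<^sup>+x. f (T j x) \<partial>\<mu>) = (\<integral>\<^sup>+x. g (T j x) \<partial>\<mu>)" if "j \<in> {1..N}" for j
      using measurable_space[OF Tm[OF that]] cong(3) by (intro nn_integral_cong) simp
    moreover have "(\<integral>\<^sup>+x. f x \<partial>\<mu>) = (\<integral>\<^sup>+x. g x \<partial>\<mu>)"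
      using cong(3) sets_eq_imp_space_eq[OF s] by (intro nn_integral_cong) simp
    ultimately show ?case using cong(4) by simp
  next
    case (set A)
    have A: "A \<in> sets \<mu>" using set s by simp
    have "(\<integral>\<^sup>+x. indicator A (T j x) \<partial>\<mu>) = emeasure \<mu> (T j -` A \<inter> {0..1})" if "j \<in> {1..N}" for j
    proof -
      have "T j -` A \<inter> {0..1} \<in> sets \<mu>" using measurable_sets[OF Tm[OF that] set] sp by simp
      moreover have "(\<integral>\<^sup>+x. indicator A (T j x) \<partial>\<mu>) = (\<integral>\<^sup>+x. indicator (T j -` A \<inter> {0..1}) x \<partial>\<mu>)"
        by (intro nn_integral_cong) (auto simp: indicator_def sp)
      ultimately show ?thesis by simp
    qed
    then show ?case using st set A by (simp add: stationary_def)
  next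
    case (mult u k)
    have "(\<Sum>j=1..N. ennreal (q j) * (\<integral>\<^sup>+x. k * u (T j x) \<partial>\<mu>)) = k * (\<Sum>j=1..N. ennreal (q j) * (\<integral>\<^sup>+x. u (T j x) \<partial>\<mu>))"
      unfolding sum_distrib_left
      by (intro sum.cong refl) (simp add: nn_integral_cmult cm[OF mult(2)] mult.left_commute)
    then show ?case using mult(4) by (simp add: nn_integral_cmult km[OF mult(2)])
  next
    case (add u v)
    have "(\<Sum>j=1..N. ennreal (q j) * (\<integral>\<^sup>+x. v (T j x) + u (T j x) \<partial>\<mu>)) =
        (\<Sum>j=1..N. ennreal (q j) * (\<integral>\<^sup>+x. v (T j x) \<partial>\<mu>)) + (\<Sum>j=1..N. ennreal (q j) * (\<integral>\<^sup>+x. u (T j x) \<partial>\<mu>))"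
      unfolding sum.distrib[symmetric]
      by (intro sum.cong refl) (simp add: nn_integral_add cm[OF add(1)] cm[OF add(4)] distrib_left)
    then show ?case using add(3,7) by (simp add: nn_integral_add km[OF add(1)] km[OF add(4)])
  next
    case (seq U)
    have lim: "(\<lambda>i. U i x) \<longlonglongrightarrow> (SUP i. U i) x" for x
    proof -
      have "incseq (\<lambda>i. U i x)" using seq(4) unfolding incseq_def le_fun_def by blast
      then have "(\<lambda>i. U i x) \<longlonglongrightarrow> (SUP i. U i x)" by (rule LIMSEQ_SUP)
      then show ?thesis by (simp only: SUP_apply)
    qed
    have 1: "(\<lambda>i. \<integral>\<^sup>+x. U i x \<partial>\<mu>) \<longlonglongrightarrow> (\<integral>\<^sup>+x. (SUP i. U i) x \<partial>\<mu>)"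
      by (rule nn_integral_LIMSEQ[OF seq(4) km[OF seq(1)] lim])
    have 2: "(\<lambda>i. \<integral>\<^sup>+x. U i (T j x) \<partial>\<mu>) \<longlonglongrightarrow> (\<integral>\<^sup>+x. (SUP i. U i) (T j x) \<partial>\<mu>)" if "j \<in> {1..N}" for j
      by (rule nn_integral_LIMSEQ[OF _ cm[OF seq(1) that] lim]) (use seq(4) in \<open>unfold incseq_def le_fun_def, blast\<close>)
    have "(\<lambda>i. \<Sum>j=1..N. ennreal (q j) * (\<integral>\<^sup>+x. U i (T j x) \<partial>\<mu>)) \<longlonglongrightarrow> (\<Sum>j=1..N. ennreal (q j) * (\<integral>\<^sup>+x. (SUP i. U i) (T j x) \<partial>\<mu>))"
      by (intro tendsto_sum ennreal_tendsto_cmult 2) auto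
    then have "(\<lambda>i. \<integral>\<^sup>+x. U i x \<partial>\<mu>) \<longlonglongrightarrow> (\<Sum>j=1..N. ennreal (q j) * (\<integral>\<^sup>+x. (SUP i. U i) (T j x) \<partial>\<mu>))"
      by (simp only: seq(3))
    then show ?case using 1 LIMSEQ_unique by blast
  qed
qed

lemma ac_density:
  assumes ac: "ac_stationary_prob N T q \<mu>"
  obtains g where "g \<in> borel_measurable borel" "\<And>x. 0 \<le> g x" "(\<integral>\<^sup>+x. ennreal (g x) \<partial>lebX) = 1"
    "\<And>h. h \<in> borel_measurable borel \<Longrightarrow> (\<And>x. 0 \<le> h x) \<Longrightarrow> (\<integral>\<^sup>+x. ennreal (h x) \<partial>\<mu>) = (\<integral>\<^sup>+x. ennreal (h x * g x) \<partial>lebX)"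
proof -
  define M where "M = restrict_space lborel {0..1::real}"
  interpret \<mu>: prob_space \<mu> using ac by (simp add: ac_stationary_prob_def)
  have s: "sets \<mu> = sets borel01" using ac by (simp add: ac_stationary_prob_def stationary_def)
  have sM: "sets M = sets borel01" unfolding M_def by (intro sets_restrict_space_cong) simp
  have spM: "space M = {0..1}" by (simp add: M_def space_restrict_space)
  have "emeasure M (space M) = 1" unfolding spM unfolding M_def by (subst emeasure_restrict_space) auto
  then interpret M: finite_measure M by (intro finite_measureI) simp
  obtain f where f: "f \<in> borel_measurable M" "density M f = \<mu>"
    using M.Radon_Nikodym[of \<mu>] ac s sM by (auto simp: ac_stationary_prob_def M_def)
  have "(\<integral>\<^sup>+x. 1 \<partial>density M f) = (\<integral>\<^sup>+x. f x * 1 \<partial>M)"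
    by (rule nn_integral_density[OF f(1)]) simp
  then have fin: "(\<integral>\<^sup>+x. f x \<partial>M) = 1" unfolding f(2) using \<mu>.emeasure_space_1 by simp
  have "AE x in M. f x \<noteq> \<infinity>" by (rule nn_integral_PInf_AE[OF f(1)]) (simp add: fin)
  then have AEf: "AE x in lborel. x \<in> {0..1} \<longrightarrow> f x \<noteq> \<infinity>" unfolding M_def by (subst (asm) AE_restrict_space_iff) auto
  \<comment> \<open>The Radon-Nikodym density is finite almost everywhere because its integral is
    one, so a real version represents the same measure; the indicator makes it Borel on the whole
    line.\<close>
  define g where "g x = enn2real (f x * indicator {0..1} x)" for x
  have fi: "(\<lambda>x. f x * indicator {0..1} x) \<in> borel_measurable borel"
    using f(1) by (subst (asm) measurable_cong_sets[OF sM refl], subst (asm) borel_measurable_restrict_space_iff_ennreal) (auto simp: mult.commute)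
  then have g: "g \<in> borel_measurable borel" unfolding g_def by measurable
  have key: "(\<integral>\<^sup>+x. ennreal (h x) \<partial>\<mu>) = (\<integral>\<^sup>+x. ennreal (h x * g x) \<partial>lebX)"
    if h: "h \<in> borel_measurable borel" "\<And>x. 0 \<le> h x" for h
  proof -
    have "(\<lambda>x. ennreal (h x)) \<in> borel_measurable M"
      using measurable_restrict_space1[of h borel borel "{0..1}"] h(1) by (subst measurable_cong_sets[OF sM refl]) measurable
    then have "(\<integral>\<^sup>+x. ennreal (h x) \<partial>\<mu>) = (\<integral>\<^sup>+x. f x * ennreal (h x) \<partial>M)"
      unfolding f(2)[symmetric] by (rule nn_integral_density[OF f(1)])
    also have "\<dots> = (\<integral>\<^sup>+x. f x * ennreal (h x) * indicator {0..1} x \<partial>lborel)"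
      unfolding M_def by (rule nn_integral_restrict_space) simp
    also have "\<dots> = (\<integral>\<^sup>+x. ennreal (h x * g x) * indicator X x \<partial>lborel)"
    proof (rule nn_integral_cong_AE)
      have "AE x in lborel. x \<noteq> c" "AE x in lborel. x \<noteq> (0::real)" "AE x in lborel. x \<noteq> (1::real)"
        by (rule AE_lborel_singleton)+
      with AEf show "AE x in lborel. f x * ennreal (h x) * indicator {0..1} x = ennreal (h x * g x) * indicator X x"
      proof eventually_elim
        case (elim x)
        show ?case
        proof (cases "x \<in> {0..1}")
          case True
          then have "x \<in> X" using elim by (auto simp: X_def)
          have eq: "f x = ennreal (g x)" using elim True by (simp add: g_def ennreal_enn2real less_top)
          have "f x * ennreal (h x) = ennreal (h x) * ennreal (g x)" unfolding eq by (rule mult.commute)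
          also have "\<dots> = ennreal (h x * g x)" by (rule ennreal_mult'[OF h(2), symmetric])
          finally have "f x * ennreal (h x) = ennreal (h x * g x)" .
          then show ?thesis using True \<open>x \<in> X\<close> by simp
        qed (auto simp: X_def)
      qed
    qed
    finally show ?thesis unfolding nn_integral_lebX .
  qed
  have "(\<integral>\<^sup>+x. ennreal (g x) \<partial>lebX) = 1"
  proof -
    have "(\<integral>\<^sup>+x. ennreal 1 \<partial>\<mu>) = (\<integral>\<^sup>+x. ennreal (1 * g x) \<partial>lebX)" by (rule key) auto
    then show ?thesis using \<mu>.emeasure_space_1 by simp
  qed
  moreover have "0 \<le> g x" for x by (simp add: g_def)
  ultimately show ?thesis by (intro that[OF g _ _ key])
qed

end

lemma tendsto_of_subsequences:
  fixes a :: "nat \<Rightarrow> 'a::metric_space"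
  assumes "\<And>s. strict_mono (s :: nat \<Rightarrow> nat) \<Longrightarrow> \<exists>k. strict_mono (k :: nat \<Rightarrow> nat) \<and> (\<lambda>n. a (s (k n))) \<longlonglongrightarrow> l"
  shows "a \<longlonglongrightarrow> l"
proof (rule ccontr)
  assume "\<not> a \<longlonglongrightarrow> l"
  then obtain e where e: "e > 0" "\<And>n. \<exists>m\<ge>n. \<not> dist (a m) l < e"
    unfolding lim_sequentially by blast
  then have "infinite {m. \<not> dist (a m) l < e}" unfolding infinite_nat_iff_unbounded_le by blast
  then obtain s where s: "strict_mono (s :: nat \<Rightarrow> nat)" "\<And>n. s n \<in> {m. \<not> dist (a m) l < e}"
    using infinite_enumerate by blast
  obtain k where "(\<lambda>n. a (s (k n))) \<longlonglongrightarrow> l" using assms[OF s(1)] by blast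
  then obtain n where "dist (a (s (k n))) l < e" using e(1) unfolding lim_sequentially by blast
  then show False using s(2) by blast
qed

lemma abs_mean_le:
  fixes f :: "nat \<Rightarrow> real"
  assumes "\<And>k. \<bar>f k\<bar> \<le> e"
  shows "\<bar>(1 / real (Suc n)) * (\<Sum>k<Suc n. f k)\<bar> \<le> e"
proof -
  have "\<bar>\<Sum>k<Suc n. f k\<bar> \<le> (\<Sum>k<Suc n. \<bar>f k\<bar>)" by (rule sum_abs)
  also have "\<dots> \<le> real (card {..<Suc n}) * e" by (rule sum_bounded_above) (rule assms)
  finally have "\<bar>\<Sum>k<Suc n. f k\<bar> \<le> real (Suc n) * e" by (simp only: card_lessThan)
  then show ?thesis by (simp add: abs_mult field_simps del: sum.lessThan_Suc)
qed

context random_branches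
begin

lemma koopman_le_1:
  assumes q: "positive_prob_vector N q" and h: "\<And>z. h z \<le> 1"
  shows "koopman q h x \<le> 1"
proof -
  have "(\<Sum>j=1..N. q j * h (T j x)) \<le> (\<Sum>j=1..N. q j * 1)"
    by (intro sum_mono mult_left_mono h less_imp_le[OF finite_prob[OF q]])
  also have "\<dots> = 1" using sum_prob[OF q] by simp
  finally show ?thesis by (simp add: koopman_def)
qed

lemma koopman_power:
  assumes q: "positive_prob_vector N q" and h: "h \<in> borel_measurable borel" "\<And>z. 0 \<le> h z" "\<And>z. h z \<le> 1"
  shows "(koopman q ^^ n) h \<in> borel_measurable borel" "0 \<le> (koopman q ^^ n) h x" "(koopman q ^^ n) h x \<le> 1"
proof -
  have "(koopman q ^^ n) h \<in> borel_measurable borel \<and> (\<forall>x. 0 \<le> (koopman q ^^ n) h x \<and> (koopman q ^^ n) h x \<le> 1)"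
    by (induction n) (simp_all add: h koopman_measurable koopman_nonneg[OF q] koopman_le_1[OF q])
  then show "(koopman q ^^ n) h \<in> borel_measurable borel" "0 \<le> (koopman q ^^ n) h x" "(koopman q ^^ n) h x \<le> 1" by auto
qed

lemma density_koopman:
  assumes q: "positive_prob_vector N q" and st: "stationary N T q \<mu>" 
    and g: "\<And>h. h \<in> borel_measurable borel \<Longrightarrow> (\<And>x. 0 \<le> h x) \<Longrightarrow> (\<integral>\<^sup>+x. ennreal (h x) \<partial>\<mu>) = (\<integral>\<^sup>+x. ennreal (h x * g x) \<partial>lebX)"
    and h: "h \<in> borel_measurable borel" "\<And>z. 0 \<le> h z"
  shows "(\<integral>\<^sup>+x. ennreal (koopman q h x * g x) \<partial>lebX) = (\<integral>\<^sup>+x. ennreal (h x * g x) \<partial>lebX)"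
proof -
  have s: "sets \<mu> = sets borel01" using st by (simp add: stationary_def)
  have sp: "space \<mu> = {0..1}" using sets_eq_imp_space_eq[OF s] by (simp add: space_restrict_space)
  have hm: "(\<lambda>x. ennreal (h x)) \<in> borel_measurable borel01" using measurable_restrict_space1[OF h(1)] by measurable
  have Tm: "T j \<in> \<mu> \<rightarrow>\<^sub>M borel01" if "j \<in> {1..N}" for j
    using T_measurable01[OF that] by (subst measurable_cong_sets[OF s refl])
  have cm: "(\<lambda>x. ennreal (h (T j x))) \<in> borel_measurable \<mu>" if "j \<in> {1..N}" for j
    using measurable_compose[OF Tm[OF that] hm] .
  have "(\<integral>\<^sup>+x. ennreal (indicator (- X) x) \<partial>\<mu>) = (\<integral>\<^sup>+x. ennreal (indicator (- X) x * g x) \<partial>lebX)"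
    by (rule g) auto
  also have "\<dots> = (\<integral>\<^sup>+x. 0 \<partial>lebX)" by (rule nn_integral_cong) simp
  \<comment> \<open>The operator \<open>koopman\<close> averages over the maps only on
    \<open>X\<close>. Since the measure has a density with respect to \<open>lebX\<close>, the
    complement of \<open>X\<close> is null and the default value there is invisible.\<close>
  finally have null: "(\<integral>\<^sup>+x. ennreal (indicator (- X) x) \<partial>\<mu>) = 0" by simp
  have im: "(\<lambda>x. ennreal (indicator (- X) x)) \<in> borel_measurable \<mu>"
    unfolding measurable_cong_sets[OF s refl]
    by (intro measurable_compose[OF _ measurable_ennreal] measurable_restrict_space1) simp
  have AE: "AE x in \<mu>. x \<in> X"
    using null unfolding nn_integral_0_iff_AE[OF im] by eventually_elim (auto simp: indicator_def split: if_splits)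
  have "(\<integral>\<^sup>+x. ennreal (koopman q h x * g x) \<partial>lebX) = (\<integral>\<^sup>+x. ennreal (koopman q h x) \<partial>\<mu>)"
    by (rule g[symmetric]) (auto intro: koopman_measurable h koopman_nonneg[OF q])
  also have "\<dots> = (\<integral>\<^sup>+x. (\<Sum>j=1..N. ennreal (q j) * ennreal (h (T j x))) \<partial>\<mu>)"
  proof (rule nn_integral_cong_AE)
    show "AE x in \<mu>. ennreal (koopman q h x) = (\<Sum>j=1..N. ennreal (q j) * ennreal (h (T j x)))"
      using AE
    proof eventually_elim
      case (elim x)
      have "(\<Sum>j=1..N. ennreal (q j) * ennreal (h (T j x))) = (\<Sum>j=1..N. ennreal (q j * h (T j x)))"
        by (intro sum.cong refl ennreal_mult'[symmetric] less_imp_le[OF finite_prob[OF q]])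
      also have "\<dots> = ennreal (\<Sum>j=1..N. q j * h (T j x))"
        by (intro sum_ennreal mult_nonneg_nonneg less_imp_le[OF finite_prob[OF q]] h(2))
      finally show ?case using elim by (simp add: koopman_def)
    qed
  qed
  also have "\<dots> = (\<Sum>j=1..N. \<integral>\<^sup>+x. ennreal (q j) * ennreal (h (T j x)) \<partial>\<mu>)"
    by (intro nn_integral_sum borel_measurable_times_ennreal cm) auto
  also have "\<dots> = (\<Sum>j=1..N. ennreal (q j) * (\<integral>\<^sup>+x. ennreal (h (T j x)) \<partial>\<mu>))"
    by (intro sum.cong refl nn_integral_cmult cm)
  also have "\<dots> = (\<integral>\<^sup>+x. ennreal (h x) \<partial>\<mu>)" by (rule stationary_nn_integral[OF st hm])
  also have "\<dots> = (\<integral>\<^sup>+x. ennreal (h x * g x) \<partial>lebX)" by (rule g[OF h])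
  finally show ?thesis .
qed

lemma integral_eq_of_nn_integral_eq:
  assumes "integrable lebX u" "\<And>x. x \<in> X \<Longrightarrow> 0 \<le> u x" "integrable lebX v" "\<And>x. x \<in> X \<Longrightarrow> 0 \<le> v x"
    and "(\<integral>\<^sup>+x. ennreal (u x) \<partial>lebX) = (\<integral>\<^sup>+x. ennreal (v x) \<partial>lebX)"
  shows "(\<integral>x. u x \<partial>lebX) = (\<integral>x. v x \<partial>lebX)"
  using assms by (subst (1 2) integral_eq_nn_integral) (auto intro!: AE_I2)

text \<open>Every subsequence of the averages has a further one that converges in the mean to a
  fixed cone element of mass \<open>m\<close>. Uniqueness identifies this with \<open>m\<close>
  times \<phi>, so the whole sequence converges.\<close>

lemma average_tendsto_fixed:
  assumes q: "admissible \<theta> q" and w: "coercive w" and u: "cone u" 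
    and mass: "(\<integral>\<^sup>+x. ennreal (u x) \<partial>lebX) = ennreal m" and m: "0 < m"
    and C: "\<And>n. (\<integral>\<^sup>+x. ennreal (w x * average q u n x) \<partial>lebX) \<le> ennreal C"
    and \<phi>: "cone \<phi>" "\<And>x. x \<in> X \<Longrightarrow> transfer q \<phi> x = \<phi> x" "(\<integral>\<^sup>+x. ennreal (\<phi> x) \<partial>lebX) = 1"
    and h: "h \<in> borel_measurable lebX" "\<And>x. x \<in> X \<Longrightarrow> \<bar>h x\<bar> \<le> B"
  shows "(\<lambda>n. \<integral>x. h x * average q u n x \<partial>lebX) \<longlonglongrightarrow> m * (\<integral>x. h x * \<phi> x \<partial>lebX)"
proof (rule tendsto_of_subsequences)
  fix s :: "nat \<Rightarrow> nat" assume s: "strict_mono s"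
  note p = admissible_prob[OF q]
  obtain k v where k: "strict_mono (k :: nat \<Rightarrow> nat)" and v: "cone v" "\<And>x. x \<in> X \<Longrightarrow> transfer q v x = v x"
    "(\<integral>\<^sup>+x. ennreal (v x) \<partial>lebX) = ennreal m" and lim: "(\<lambda>n. \<integral>\<^sup>+x. norm (average q u (s (k n)) x - v x) \<partial>lebX) \<longlonglongrightarrow> 0"
    by (rule average_limit[OF q w mass less_imp_le[OF m] u C s]) blast
  have v\<phi>: "(1 / m) * v x = \<phi> x" if x: "x \<in> X" for x
  proof (rule fixed_unique[OF p _ _ _ \<phi> x])
    show "cone (\<lambda>x. (1 / m) * v x)" using m by (intro cone_mult v(1)) simp
    show "transfer q (\<lambda>x. (1 / m) * v x) y = (1 / m) * v y" if "y \<in> X" for y by (simp only: transfer_scale v(2)[OF that])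
    have "(\<integral>\<^sup>+x. ennreal ((1 / m) * v x) \<partial>lebX) = (\<integral>\<^sup>+x. ennreal (1 / m) * ennreal (v x) \<partial>lebX)"
      using m by (intro nn_integral_cong ennreal_mult') simp
    also have "\<dots> = ennreal (1 / m) * ennreal m"
      unfolding v(3)[symmetric]
    by (intro nn_integral_cmult measurable_compose[OF cone_measurable[OF v(1)] measurable_ennreal])
    also have "\<dots> = 1" using m by (simp flip: ennreal_mult)
    finally show "(\<integral>\<^sup>+x. ennreal ((1 / m) * v x) \<partial>lebX) = 1" .
  qed
  have "integrable lebX (average q u n)" for n
    by (rule cone_integrable[OF cone_average[OF p u]]) (simp add: average_mass[OF p u] mass)
  moreover have "integrable lebX v" by (rule cone_integrable[OF v(1)]) (simp add: v(3))
  ultimately have "(\<lambda>n. \<integral>x. h x * average q u (s (k n)) x \<partial>lebX) \<longlonglongrightarrow> (\<integral>x. h x * v x \<partial>lebX)"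
    by (intro L1_convergence_bounded_mult[OF _ _ h lim]) auto
  also have "(\<integral>x. h x * v x \<partial>lebX) = (\<integral>x. m * (h x * \<phi> x) \<partial>lebX)"
    by (intro Bochner_Integration.integral_cong refl) (use m in \<open>simp add: v\<phi>[symmetric]\<close>)
  also have "\<dots> = m * (\<integral>x. h x * \<phi> x \<partial>lebX)" by simp
  finally show "\<exists>k. strict_mono k \<and> (\<lambda>n. \<integral>x. h x * average q u (s (k n)) x \<partial>lebX) \<longlonglongrightarrow> m * (\<integral>x. h x * \<phi> x \<partial>lebX)"
    using k by blast
qed

lemma integral_average_koopman:
  assumes q: "positive_prob_vector N q" and u: "cone u" "(\<integral>\<^sup>+x. ennreal (u x) \<partial>lebX) < \<infinity>"
    and h: "h \<in> borel_measurable borel" "\<And>z. 0 \<le> h z" "\<And>z. h z \<le> 1"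
  shows "(\<integral>x. h x * average q u n x \<partial>lebX) = (1 / real (Suc n)) * (\<Sum>k<Suc n. \<integral>x. (koopman q ^^ k) h x * u x \<partial>lebX)"
proof -
  note ck = cone_transfer_power[OF q u(1)]
  have ik: "integrable lebX ((transfer q ^^ k) u)" for k
    by (rule cone_integrable[OF ck]) (simp add: transfer_power_mass[OF q u(1)] u(2)[unfolded infinity_ennreal_def])
  have hl: "g \<in> borel_measurable lebX" if "g \<in> borel_measurable borel" for g :: "real \<Rightarrow> real"
    by (rule measurable_lebX_borel[OF that])
  have ih: "integrable lebX (\<lambda>x. h x * (transfer q ^^ k) u x)" for k
    by (rule integrable_bounded_mult[OF ik hl[OF h(1)], of 1]) (use h in auto)
  have ik': "integrable lebX (\<lambda>x. (koopman q ^^ k) h x * u x)" for k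
    by (rule integrable_bounded_mult[OF cone_integrable[OF u] hl, of _ 1]) (simp_all add: koopman_power[OF q h])
  have "(\<integral>x. h x * average q u n x \<partial>lebX) = (\<integral>x. (1 / real (Suc n)) * (\<Sum>k<Suc n. h x * (transfer q ^^ k) u x) \<partial>lebX)"
    by (intro Bochner_Integration.integral_cong refl) (simp only: average_def sum_distrib_left mult_ac)
  also have "\<dots> = (1 / real (Suc n)) * (\<Sum>k<Suc n. \<integral>x. h x * (transfer q ^^ k) u x \<partial>lebX)"
    by (simp only: integral_mult_right_zero Bochner_Integration.integral_sum ih)
  also have "(\<Sum>k<Suc n. \<integral>x. h x * (transfer q ^^ k) u x \<partial>lebX) = (\<Sum>k<Suc n. \<integral>x. (koopman q ^^ k) h x * u x \<partial>lebX)"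
  proof (intro sum.cong refl integral_eq_of_nn_integral_eq ih ik')
    fix k
    show "(\<integral>\<^sup>+x. ennreal (h x * (transfer q ^^ k) u x) \<partial>lebX) = (\<integral>\<^sup>+x. ennreal ((koopman q ^^ k) h x * u x) \<partial>lebX)"
      by (rule integral_transfer_power[OF q u(1) h(1,2)])
  qed (use h koopman_power[OF q h] cone_nonneg[OF ck] cone_nonneg[OF u(1)] in auto)
  finally show ?thesis .
qed

text \<open>The density \<open>g\<close> is merely integrable, so the cone theory reaches it through
  a polynomial \<open>v\<close> close to it in the mean. Stationarity leaves the integral of
  \<open>h\<close> against \<open>g\<close> unchanged under powers of \<open>koopman\<close>, and
  these keep \<open>h\<close> between \<open>0\<close> and \<open>1\<close>, so the approximation
  error is not amplified. For \<open>C + v\<close> and \<open>C\<close> the averages converge to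
  multiples of \<phi>.\<close>

lemma ac_stationary_density:
  assumes \<theta>: "\<theta> < 1" and q: "admissible \<theta> q" and ac: "ac_stationary_prob N T q \<mu>"
    and \<phi>: "cone \<phi>" "\<And>x. x \<in> X \<Longrightarrow> transfer q \<phi> x = \<phi> x" "(\<integral>\<^sup>+x. ennreal (\<phi> x) \<partial>lebX) = 1"
    and h: "h \<in> borel_measurable borel" "\<And>z. 0 \<le> h z" "\<And>z. h z \<le> 1"
  shows "(\<integral>\<^sup>+x. ennreal (h x) \<partial>\<mu>) = ennreal (\<integral>x. h x * \<phi> x \<partial>lebX)"
proof -
  note p = admissible_prob[OF q]
  obtain w where w: "coercive w" and tight: "\<And>u U. cone u \<Longrightarrow> (\<And>x. x \<in> X \<Longrightarrow> u x \<le> U) \<Longrightarrow>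
      \<exists>C. \<forall>q n. admissible \<theta> q \<longrightarrow> (\<integral>\<^sup>+x. ennreal (w x * average q u n x) \<partial>lebX) \<le> ennreal C"
    using tightness[OF \<theta>] by blast
  have st: "stationary N T q \<mu>" using ac by (simp add: ac_stationary_prob_def)
  obtain g where g: "g \<in> borel_measurable borel" "\<And>x. 0 \<le> g x" "(\<integral>\<^sup>+x. ennreal (g x) \<partial>lebX) = 1"
    "\<And>h. h \<in> borel_measurable borel \<Longrightarrow> (\<And>x. 0 \<le> h x) \<Longrightarrow> (\<integral>\<^sup>+x. ennreal (h x) \<partial>\<mu>) = (\<integral>\<^sup>+x. ennreal (h x * g x) \<partial>lebX)"
    using ac_density[OF ac] by blast
  have hl: "g \<in> borel_measurable lebX" if "g \<in> borel_measurable borel" for g :: "real \<Rightarrow> real"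
    by (rule measurable_lebX_borel[OF that])
  have ig: "integrable lebX g" by (rule integrableI_nonneg[OF hl[OF g(1)]]) (simp_all add: g(2,3))
  have g1: "(\<integral>x. g x \<partial>lebX) = 1" by (subst integral_eq_nn_integral[OF hl[OF g(1)]]) (simp_all add: g(2,3))
  have i\<phi>: "integrable lebX \<phi>" by (rule cone_integrable[OF \<phi>(1)]) (simp add: \<phi>(3))
  have \<phi>1: "(\<integral>x. \<phi> x \<partial>lebX) = 1" by (rule cone_integral_eq[OF \<phi>(1)]) (simp_all add: \<phi>(3))
  define a where "a = (\<integral>x. h x * g x \<partial>lebX)"
  define b where "b = (\<integral>x. h x * \<phi> x \<partial>lebX)"
  have bm: "integrable lebX (\<lambda>x. f x * u x)" if "integrable lebX u" "f \<in> borel_measurable borel" "\<And>z. 0 \<le> f z" "\<And>z. f z \<le> 1" for f u :: "real \<Rightarrow> real"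
    by (rule integrable_bounded_mult[OF that(1) hl[OF that(2)], of 1]) (simp add: that(3,4))
  note kp = koopman_power[OF p h]
  have ak: "(\<integral>x. (koopman q ^^ k) h x * g x \<partial>lebX) = a" for k
    unfolding a_def
  proof (intro integral_eq_of_nn_integral_eq bm ig kp h)
    show "(\<integral>\<^sup>+x. ennreal ((koopman q ^^ k) h x * g x) \<partial>lebX) = (\<integral>\<^sup>+x. ennreal (h x * g x) \<partial>lebX)"
    proof (induction k)
      case (Suc k)
      have "(\<integral>\<^sup>+x. ennreal (koopman q ((koopman q ^^ k) h) x * g x) \<partial>lebX) = (\<integral>\<^sup>+x. ennreal ((koopman q ^^ k) h x * g x) \<partial>lebX)"
        by (rule density_koopman[OF p st g(4) kp(1,2)])
      then show ?case using Suc by simp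
    qed simp
  qed (simp_all add: h(2) kp(2) g(2))
  have b01: "0 \<le> b" "b \<le> 1"
  proof -
    show "0 \<le> b" unfolding b_def by (rule integral_nonneg_AE) (intro AE_I2, simp add: h(2) cone_nonneg[OF \<phi>(1)])
    have "b \<le> (\<integral>x. \<phi> x \<partial>lebX)" unfolding b_def
      by (rule integral_mono[OF bm[OF i\<phi> h] i\<phi>]) (simp add: mult_left_le_one_le h(2,3) cone_nonneg[OF \<phi>(1)])
    then show "b \<le> 1" by (simp add: \<phi>1)
  qed
  have est: "\<bar>a - b\<bar> \<le> 2 * e" if e: "0 < e" for e
  proof -
    obtain v where v: "real_polynomial_function v" "(\<integral>\<^sup>+x. ennreal \<bar>g x - v x\<bar> \<partial>lebX) \<le> ennreal e"
      by (rule integrable_approx_polynomial[OF g(1,2) _ e]) (simp add: g(3), blast)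
    obtain C U where C: "1 \<le> C" and u1: "cone (\<lambda>x. C + v x)" "\<And>x. x \<in> X \<Longrightarrow> 1 \<le> C + v x" "\<And>x. x \<in> X \<Longrightarrow> C + v x \<le> U"
      by (rule polynomial_cone[OF v(1)]) blast
    have u2: "cone (\<lambda>x. C)" using C by (intro cone_const) simp
    have c2: "c / 2 \<in> X" using c_pos c_less by (auto simp: X_def)
    have U: "1 \<le> U" using u1(2,3)[OF c2] by simp
    have iC: "integrable lebX (\<lambda>x. C)"
      by (rule cone_integrable[OF u2]) (simp add: emeasure_lebX_X)
    have f1: "(\<integral>\<^sup>+x. ennreal (C + v x) \<partial>lebX) < \<infinity>"
    proof -
      have "(\<integral>\<^sup>+x. ennreal (C + v x) \<partial>lebX) \<le> (\<integral>\<^sup>+x. ennreal U \<partial>lebX)"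
        by (intro nn_integral_mono ennreal_leI) (use u1(3) in auto)
      also have "\<dots> < \<infinity>" by (simp add: emeasure_lebX_X)
      finally show ?thesis .
    qed
    have i1: "integrable lebX (\<lambda>x. C + v x)" by (rule cone_integrable[OF u1(1) f1])
    define m1 where "m1 = (\<integral>x. C + v x \<partial>lebX)"
    have mass1: "(\<integral>\<^sup>+x. ennreal (C + v x) \<partial>lebX) = ennreal m1"
      unfolding m1_def by (rule nn_integral_eq_integral[OF i1]) (use cone_nonneg[OF u1(1)] in \<open>auto intro!: AE_I2\<close>)
    have mass2: "(\<integral>\<^sup>+x. ennreal C \<partial>lebX) = ennreal C" by (simp add: emeasure_lebX_X)
    have Ci: "(\<integral>x. C \<partial>lebX) = C" by (rule cone_integral_eq[OF u2 mass2]) (use C in simp)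
    have m1: "0 < m1"
    proof -
      have "(\<integral>x. 1 \<partial>lebX) \<le> m1" unfolding m1_def
        by (rule integral_mono[OF _ i1]) (use u1(2) finite_measure.integrable_const[OF finite_measure_lebX] in auto)
      moreover have "(\<integral>x. 1 \<partial>lebX) = (1::real)" by (rule cone_integral_eq[OF cone_const]) (simp_all add: emeasure_lebX_X)
      ultimately show ?thesis by simp
    qed
    obtain C1 where C1: "\<And>n. (\<integral>\<^sup>+x. ennreal (w x * average q (\<lambda>x. C + v x) n x) \<partial>lebX) \<le> ennreal C1"
      using tight[OF u1(1,3)] q by blast
    obtain C2 where C2: "\<And>n. (\<integral>\<^sup>+x. ennreal (w x * average q (\<lambda>x. C) n x) \<partial>lebX) \<le> ennreal C2"
      using tight[OF u2, of C] q by blast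
    have habs: "\<bar>h x\<bar> \<le> 1" for x using h(2,3) by simp
    have l1: "(\<lambda>n. \<integral>x. h x * average q (\<lambda>x. C + v x) n x \<partial>lebX) \<longlonglongrightarrow> m1 * b"
      unfolding b_def by (rule average_tendsto_fixed[OF q w u1(1) mass1 m1 C1 \<phi> hl[OF h(1)] habs])
    have l2: "(\<lambda>n. \<integral>x. h x * average q (\<lambda>x. C) n x \<partial>lebX) \<longlonglongrightarrow> C * b"
      unfolding b_def by (rule average_tendsto_fixed[OF q w u2 mass2 _ C2 \<phi> hl[OF h(1)] habs]) (use C in simp)
    have vi: "integrable lebX v" using Bochner_Integration.integrable_diff[OF i1 iC] by simp
    have dv: "(\<integral>x. \<bar>g x - v x\<bar> \<partial>lebX) \<le> e"
    proof -
      have "ennreal (\<integral>x. \<bar>g x - v x\<bar> \<partial>lebX) \<le> ennreal e"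
        using v(2) ig vi by (subst (asm) nn_integral_eq_integral) auto
      then show ?thesis using e by simp
    qed
    \<comment> \<open>Replacing \<open>g\<close> by \<open>v = (C + v) - C\<close> costs at most
      \<open>e\<close>, uniformly over test functions with values in \<open>[0,1]\<close>; this is
      applied to all powers of \<open>koopman\<close> at once.\<close>
    have step: "\<bar>a - ((\<integral>x. f x * (C + v x) \<partial>lebX) - (\<integral>x. f x * C \<partial>lebX))\<bar> \<le> e"
      if f: "f \<in> borel_measurable borel" "\<And>z. 0 \<le> f z" "\<And>z. f z \<le> 1" and fa: "(\<integral>x. f x * g x \<partial>lebX) = a" for f
    proof -
      have "(\<integral>x. f x * (g x - v x) \<partial>lebX) = (\<integral>x. f x * g x - (f x * (C + v x) - f x * C) \<partial>lebX)"
        by (intro Bochner_Integration.integral_cong refl) (simp add: algebra_simps)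
      also have "\<dots> = a - ((\<integral>x. f x * (C + v x) \<partial>lebX) - (\<integral>x. f x * C \<partial>lebX))"
        using bm[OF ig f] bm[OF i1 f] bm[OF iC f] fa by simp
      finally have "\<bar>a - ((\<integral>x. f x * (C + v x) \<partial>lebX) - (\<integral>x. f x * C \<partial>lebX))\<bar> = norm (\<integral>x. f x * (g x - v x) \<partial>lebX)" by simp
      also have "\<dots> \<le> (\<integral>x. norm (f x * (g x - v x)) \<partial>lebX)" by (rule integral_norm_bound)
      also have "\<dots> \<le> (\<integral>x. \<bar>g x - v x\<bar> \<partial>lebX)"
      proof (rule integral_mono)
        show "integrable lebX (\<lambda>x. norm (f x * (g x - v x)))"
          by (intro integrable_norm bm f Bochner_Integration.integrable_diff ig vi)
        show "integrable lebX (\<lambda>x. \<bar>g x - v x\<bar>)" using ig vi by simp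
        show "norm (f x * (g x - v x)) \<le> \<bar>g x - v x\<bar>" for x
          using f(2,3)[of x] by (simp add: abs_mult mult_left_le_one_le)
      qed
      finally show ?thesis using dv by simp
    qed
    have avg: "\<bar>a - ((\<integral>x. h x * average q (\<lambda>x. C + v x) n x \<partial>lebX) - (\<integral>x. h x * average q (\<lambda>x. C) n x \<partial>lebX))\<bar> \<le> e" for n
    proof -
      let ?d = "\<lambda>k. (\<integral>x. (koopman q ^^ k) h x * (C + v x) \<partial>lebX) - (\<integral>x. (koopman q ^^ k) h x * C \<partial>lebX)"
      have const: "(1 / real (Suc n)) * (\<Sum>k<Suc n. t) = t" for t :: real
        by (simp only: sum_constant card_lessThan) (simp del: of_nat_Suc)
      have A1: "(\<integral>x. h x * average q (\<lambda>x. C + v x) n x \<partial>lebX) = (1 / real (Suc n)) * (\<Sum>k<Suc n. \<integral>x. (koopman q ^^ k) h x * (C + v x) \<partial>lebX)"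
        by (rule integral_average_koopman[OF p u1(1) f1 h])
      have A2: "(\<integral>x. h x * average q (\<lambda>x. C) n x \<partial>lebX) = (1 / real (Suc n)) * (\<Sum>k<Suc n. \<integral>x. (koopman q ^^ k) h x * C \<partial>lebX)"
        by (rule integral_average_koopman[OF p u2 _ h]) (simp add: emeasure_lebX_X)
      have "a - ((\<integral>x. h x * average q (\<lambda>x. C + v x) n x \<partial>lebX) - (\<integral>x. h x * average q (\<lambda>x. C) n x \<partial>lebX)) =
          (1 / real (Suc n)) * (\<Sum>k<Suc n. a - ?d k)"
        unfolding A1 A2 using const[of a] by (simp only: sum_subtractf right_diff_distrib)
      moreover have "\<bar>(1 / real (Suc n)) * (\<Sum>k<Suc n. a - ?d k)\<bar> \<le> e"
        by (rule abs_mean_le) (rule step[OF kp ak])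
      ultimately show ?thesis by presburger
    qed
    have first: "\<bar>a - (m1 * b - C * b)\<bar> \<le> e"
      by (rule LIMSEQ_le_const2[OF tendsto_rabs[OF tendsto_diff[OF tendsto_const tendsto_diff[OF l1 l2]]]])
        (intro exI allI impI avg)
    \<comment> \<open>The number \<open>m1 - C\<close> is the integral of \<open>v\<close>, hence
      within \<open>e\<close> of the mass of \<open>g\<close>. This is the second of the two errors
      in \<open>2 * e\<close>.\<close>
    have "\<bar>1 - (m1 - C)\<bar> \<le> e"
    proof -
      have "1 - (m1 - C) = (\<integral>x. g x - v x \<partial>lebX)"
      proof -
        have "(\<integral>x. C + v x \<partial>lebX) = (\<integral>x. C \<partial>lebX) + (\<integral>x. v x \<partial>lebX)" by (rule Bochner_Integration.integral_add[OF iC vi])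
        moreover have "(\<integral>x. g x - v x \<partial>lebX) = (\<integral>x. g x \<partial>lebX) - (\<integral>x. v x \<partial>lebX)" by (rule Bochner_Integration.integral_diff[OF ig vi])
        ultimately show ?thesis unfolding m1_def g1 Ci by linarith
      qed
      also have "\<bar>\<dots>\<bar> \<le> (\<integral>x. \<bar>g x - v x\<bar> \<partial>lebX)" using integral_norm_bound[of lebX "\<lambda>x. g x - v x"] by simp
      finally show ?thesis using dv by simp
    qed
    then have "\<bar>1 - (m1 - C)\<bar> * \<bar>b\<bar> \<le> e * 1"
      using b01 e by (intro mult_mono) simp_all
    then have second: "\<bar>(1 - (m1 - C)) * b\<bar> \<le> e" by (simp only: abs_mult mult_1_right)
    have "a - b = (a - (m1 * b - C * b)) - (1 - (m1 - C)) * b" by (simp add: algebra_simps)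
    then have "\<bar>a - b\<bar> \<le> \<bar>a - (m1 * b - C * b)\<bar> + \<bar>(1 - (m1 - C)) * b\<bar>" by (simp only: abs_triangle_ineq4)
    then show ?thesis using first second by linarith
  qed
  have "\<bar>a - b\<bar> \<le> 0 + e" if "0 < e" for e using est[of "e / 2"] that by simp
  then have "\<bar>a - b\<bar> \<le> 0" by (rule field_le_epsilon)
  then have ab: "a = b" by simp
  have "(\<integral>\<^sup>+x. ennreal (h x) \<partial>\<mu>) = (\<integral>\<^sup>+x. ennreal (h x * g x) \<partial>lebX)" by (rule g(4)[OF h(1,2)])
  also have "\<dots> = ennreal a" unfolding a_def
    by (rule nn_integral_eq_integral[OF bm[OF ig h]]) (simp add: h(2) g(2))
  finally show ?thesis using ab by (simp add: b_def)
qed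

text \<open>Starting every average from the constant \<open>1\<close> yields one bound
  \<open>C\<close> for all admissible vectors; compactness for a varying sequence of vectors relies
  on this uniformity.\<close>

lemma fixed_density_exists:
  assumes \<theta>: "\<theta> < 1"
  obtains w C where "coercive w"
    "\<And>q. admissible \<theta> q \<Longrightarrow> \<exists>\<phi>. cone \<phi> \<and> (\<forall>x\<in>X. transfer q \<phi> x = \<phi> x) \<and>
      (\<integral>\<^sup>+x. ennreal (\<phi> x) \<partial>lebX) = ennreal 1 \<and> (\<integral>\<^sup>+x. ennreal (w x * \<phi> x) \<partial>lebX) \<le> ennreal C"
proof -
  obtain w where w: "coercive w" and tight: "\<And>u U. cone u \<Longrightarrow> (\<And>x. x \<in> X \<Longrightarrow> u x \<le> U) \<Longrightarrow>
      \<exists>C. \<forall>q n. admissible \<theta> q \<longrightarrow> (\<integral>\<^sup>+x. ennreal (w x * average q u n x) \<partial>lebX) \<le> ennreal C"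
    using tightness[OF \<theta>] by blast
  have c1: "cone (\<lambda>x. 1)" by (rule cone_const) simp
  obtain C where C: "\<And>q n. admissible \<theta> q \<Longrightarrow> (\<integral>\<^sup>+x. ennreal (w x * average q (\<lambda>x. 1) n x) \<partial>lebX) \<le> ennreal C"
    using tight[OF c1, of 1] by auto
  have "\<exists>\<phi>. cone \<phi> \<and> (\<forall>x\<in>X. transfer q \<phi> x = \<phi> x) \<and>
      (\<integral>\<^sup>+x. ennreal (\<phi> x) \<partial>lebX) = ennreal 1 \<and> (\<integral>\<^sup>+x. ennreal (w x * \<phi> x) \<partial>lebX) \<le> ennreal C" if q: "admissible \<theta> q" for q
  proof -
    have m: "(\<integral>\<^sup>+x. ennreal 1 \<partial>lebX) = ennreal 1" by (simp add: emeasure_lebX_X)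
    obtain v where "cone v" "\<And>x. x \<in> X \<Longrightarrow> transfer q v x = v x"
      "(\<integral>\<^sup>+x. ennreal (v x) \<partial>lebX) = ennreal 1" "(\<integral>\<^sup>+x. ennreal (w x * v x) \<partial>lebX) \<le> ennreal C"
      by (rule average_limit[OF q w m _ c1 C[OF q], of id]) (simp_all add: strict_mono_id)
    then show ?thesis by blast
  qed
  then show ?thesis using that w by blast
qed

lemma ac_stationary_integral:
  assumes \<theta>: "\<theta> < 1" and q: "admissible \<theta> q" and ac: "ac_stationary_prob N T q \<mu>"
    and \<phi>: "cone \<phi>" "\<And>x. x \<in> X \<Longrightarrow> transfer q \<phi> x = \<phi> x" "(\<integral>\<^sup>+x. ennreal (\<phi> x) \<partial>lebX) = 1"
    and f: "continuous_on {0..1} f" and F: "\<And>x. x \<in> {0..1} \<Longrightarrow> \<bar>f x\<bar> \<le> F" "0 < F"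
  shows "(\<integral>x. f x \<partial>\<mu>) = (\<integral>x. f x * \<phi> x \<partial>lebX)"
proof -
  interpret \<mu>: prob_space \<mu> using ac by (simp add: ac_stationary_prob_def)
  have s: "sets \<mu> = sets borel01" using ac by (simp add: ac_stationary_prob_def stationary_def)
  have sp: "space \<mu> = {0..1}" using sets_eq_imp_space_eq[OF s] by (simp add: space_restrict_space)
  \<comment> \<open>An affine change brings the test function into \<open>[0,1]\<close>, and
    extension by zero makes it Borel; since both measures have total mass one, the change is undone
    exactly.\<close>
  define h where "h x = (if x \<in> {0..1} then (f x + F) / (2 * F) else 0)" for x
  have hm: "h \<in> borel_measurable borel"
  proof -
    have "(\<lambda>x. indicator {0..1} x *\<^sub>R ((f x + F) / (2 * F))) \<in> borel_measurable borel"
      by (rule borel_measurable_continuous_on_indicator) (use f F in \<open>auto intro!: continuous_intros\<close>)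
    moreover have "h = (\<lambda>x. indicator {0..1} x *\<^sub>R ((f x + F) / (2 * F)))" by (auto simp: h_def indicator_def)
    ultimately show ?thesis by (simp only:)
  qed
  have h0: "0 \<le> h x" and h1: "h x \<le> 1" for x
    using F(1)[of x] F(2) by (auto simp: h_def abs_le_iff divide_le_eq)
  have fh: "f x = 2 * F * h x - F" if "x \<in> {0..1}" for x using that F(2) by (simp add: h_def field_simps)
  have hl: "h \<in> borel_measurable lebX" by (rule measurable_lebX_borel[OF hm])
  have i\<phi>: "integrable lebX \<phi>" by (rule cone_integrable[OF \<phi>(1)]) (simp add: \<phi>(3))
  have \<phi>1: "(\<integral>x. \<phi> x \<partial>lebX) = 1" by (rule cone_integral_eq[OF \<phi>(1)]) (simp_all add: \<phi>(3))
  have ih\<phi>: "integrable lebX (\<lambda>x. h x * \<phi> x)"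
    by (rule integrable_bounded_mult[OF i\<phi> hl, of 1]) (use h0 h1 in \<open>simp\<close>)
  have hmu: "h \<in> borel_measurable \<mu>"
    using measurable_restrict_space1[OF hm] by (subst measurable_cong_sets[OF s refl])
  have ihmu: "integrable \<mu> h"
    by (rule \<mu>.integrable_const_bound[of _ 1]) (use h0 h1 hmu in auto)
  have b0: "0 \<le> (\<integral>x. h x * \<phi> x \<partial>lebX)"
    by (rule integral_nonneg_AE, rule AE_I2) (simp add: h0 cone_nonneg[OF \<phi>(1)])
  have "(\<integral>x. h x \<partial>\<mu>) = enn2real (\<integral>\<^sup>+x. ennreal (h x) \<partial>\<mu>)"
    by (rule integral_eq_nn_integral[OF hmu]) (simp add: h0)
  also have "(\<integral>\<^sup>+x. ennreal (h x) \<partial>\<mu>) = ennreal (\<integral>x. h x * \<phi> x \<partial>lebX)"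
    by (rule ac_stationary_density[OF \<theta> q ac \<phi> hm h0 h1])
  also have "enn2real \<dots> = (\<integral>x. h x * \<phi> x \<partial>lebX)" using b0 by simp
  finally have eq: "(\<integral>x. h x \<partial>\<mu>) = (\<integral>x. h x * \<phi> x \<partial>lebX)" .
  have "(\<integral>x. f x \<partial>\<mu>) = (\<integral>x. 2 * F * h x - F \<partial>\<mu>)"
    by (rule Bochner_Integration.integral_cong[OF refl]) (simp add: sp fh)
  also have "\<dots> = 2 * F * (\<integral>x. h x \<partial>\<mu>) - F" using ihmu by (simp add: \<mu>.prob_space)
  also have "\<dots> = (\<integral>x. 2 * F * (h x * \<phi> x) - F * \<phi> x \<partial>lebX)"
    using ih\<phi> i\<phi> by (simp add: eq \<phi>1)
  also have "\<dots> = (\<integral>x. f x * \<phi> x \<partial>lebX)"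
  proof (rule Bochner_Integration.integral_cong[OF refl])
    fix x assume "x \<in> space lebX"
    then have "x \<in> {0..1}" by (auto simp: X_def)
    then show "2 * F * (h x * \<phi> x) - F * \<phi> x = f x * \<phi> x" by (simp only: fh) (simp add: algebra_simps)
  qed
  finally show ?thesis .
qed

theorem weak_convergence:
  assumes \<theta>: "\<theta> < 1" and p: "\<And>n. admissible \<theta> (p n)" and p_lim: "admissible \<theta> p_lim"
    and lim: "\<And>j. j \<in> {1..N} \<Longrightarrow> (\<lambda>n. p n j) \<longlonglongrightarrow> p_lim j"
    and ac: "\<And>n. ac_stationary_prob N T (p n) (\<mu> n)" and ac_lim: "ac_stationary_prob N T p_lim \<mu>_lim"
  shows "weak_conv01 \<mu> \<mu>_lim"
  unfolding weak_conv01_def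
proof (intro allI impI)
  fix f :: "real \<Rightarrow> real" assume f: "continuous_on {0..1} f"
  obtain F where F: "\<And>x. x \<in> {0..1} \<Longrightarrow> \<bar>f x\<bar> \<le> F" "0 < F"
  proof -
    have "bounded (f ` {0..1})" using f by (intro compact_imp_bounded compact_continuous_image) auto
    then obtain B where B: "0 < B" "\<forall>y\<in>f ` {0..1}. norm y \<le> B" unfolding bounded_pos by blast
    then show ?thesis using that[of B] by simp
  qed
  obtain w C where w: "coercive w" and ex: "\<And>q. admissible \<theta> q \<Longrightarrow> \<exists>\<phi>. cone \<phi> \<and> (\<forall>x\<in>X. transfer q \<phi> x = \<phi> x) \<and>
      (\<integral>\<^sup>+x. ennreal (\<phi> x) \<partial>lebX) = ennreal 1 \<and> (\<integral>\<^sup>+x. ennreal (w x * \<phi> x) \<partial>lebX) \<le> ennreal C"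
    by (rule fixed_density_exists[OF \<theta>]) blast
  have "\<forall>n. \<exists>\<phi>. cone \<phi> \<and> (\<forall>x\<in>X. transfer (p n) \<phi> x = \<phi> x) \<and>
      (\<integral>\<^sup>+x. ennreal (\<phi> x) \<partial>lebX) = ennreal 1 \<and> (\<integral>\<^sup>+x. ennreal (w x * \<phi> x) \<partial>lebX) \<le> ennreal C"
    using ex[OF p] by blast
  from choice[OF this] obtain \<phi> where \<phi>: "\<And>n. cone (\<phi> n)" "\<And>n x. x \<in> X \<Longrightarrow> transfer (p n) (\<phi> n) x = \<phi> n x"
    "\<And>n. (\<integral>\<^sup>+x. ennreal (\<phi> n x) \<partial>lebX) = ennreal 1" "\<And>n. (\<integral>\<^sup>+x. ennreal (w x * \<phi> n x) \<partial>lebX) \<le> ennreal C"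
    by blast
  obtain \<psi> where \<psi>: "cone \<psi>" "\<And>x. x \<in> X \<Longrightarrow> transfer p_lim \<psi> x = \<psi> x" "(\<integral>\<^sup>+x. ennreal (\<psi> x) \<partial>lebX) = 1"
    using ex[OF p_lim] by auto
  have fm: "f \<in> borel_measurable lebX" by (intro measurable_lebX_continuous continuous_on_subset[OF f]) (auto simp: X_def)
  have fF: "\<bar>f x\<bar> \<le> F" if "x \<in> X" for x using F(1)[of x] that by (auto simp: X_def)
  have int: "integrable lebX (\<phi> n)" for n by (rule cone_integrable[OF \<phi>(1)]) (simp add: \<phi>(3))
  have "(\<lambda>n. \<integral>x. f x * \<phi> n x \<partial>lebX) \<longlonglongrightarrow> (\<integral>x. f x * \<psi> x \<partial>lebX)"
  proof (rule tendsto_of_subsequences)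
    fix s :: "nat \<Rightarrow> nat" assume s: "strict_mono s"
    obtain k v where k: "strict_mono (k :: nat \<Rightarrow> nat)" and v: "cone v" "\<And>x. x \<in> X \<Longrightarrow> (\<lambda>n. \<phi> (s (k n)) x) \<longlonglongrightarrow> v x"
      "(\<integral>\<^sup>+x. ennreal (v x) \<partial>lebX) = ennreal 1" "(\<lambda>n. \<integral>\<^sup>+x. norm (\<phi> (s (k n)) x - v x) \<partial>lebX) \<longlonglongrightarrow> 0"
      by (rule cone_compact[of "\<lambda>n. \<phi> (s n)" w 1 C, OF \<phi>(1) w \<phi>(3) _ \<phi>(4)]) simp_all
    have sk: "strict_mono (\<lambda>n. s (k n))" using strict_mono_o[OF s k] by (simp add: o_def)
    \<comment> \<open>Densities and probability vectors pass to the limit together, so the limit is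
      fixed under the operator of the limit vector.\<close>
    have v_fixed: "transfer p_lim v x = v x" if x: "x \<in> X" for x
    proof (rule LIMSEQ_unique)
      show "(\<lambda>n. transfer (p (s (k n))) (\<phi> (s (k n))) x) \<longlonglongrightarrow> transfer p_lim v x"
        by (rule transfer_tendsto[OF v(2)]) (use LIMSEQ_subseq_LIMSEQ[OF lim sk] in \<open>simp_all add: o_def\<close>)
      show "(\<lambda>n. transfer (p (s (k n))) (\<phi> (s (k n))) x) \<longlonglongrightarrow> v x" using v(2)[OF x] by (simp add: \<phi>(2)[OF x])
    qed
    have v\<psi>: "v x = \<psi> x" if "x \<in> X" for x
      by (rule fixed_unique[OF admissible_prob[OF p_lim] v(1) v_fixed _ \<psi> that]) (simp_all add: v(3))
    have "integrable lebX v" by (rule cone_integrable[OF v(1)]) (simp add: v(3))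
    from L1_convergence_bounded_mult[OF int this fm fF v(4)]
    have "(\<lambda>n. \<integral>x. f x * \<phi> (s (k n)) x \<partial>lebX) \<longlonglongrightarrow> (\<integral>x. f x * v x \<partial>lebX)" .
    also have "(\<integral>x. f x * v x \<partial>lebX) = (\<integral>x. f x * \<psi> x \<partial>lebX)"
      by (rule Bochner_Integration.integral_cong[OF refl]) (simp add: v\<psi>)
    finally show "\<exists>k. strict_mono k \<and> (\<lambda>n. \<integral>x. f x * \<phi> (s (k n)) x \<partial>lebX) \<longlonglongrightarrow> (\<integral>x. f x * \<psi> x \<partial>lebX)"
      using k by blast
  qed
  moreover have "(\<integral>x. f x \<partial>\<mu> n) = (\<integral>x. f x * \<phi> n x \<partial>lebX)" for n
    by (rule ac_stationary_integral[OF \<theta> p ac \<phi>(1,2) _ f F]) (simp_all add: \<phi>(3))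
  moreover have "(\<integral>x. f x \<partial>\<mu>_lim) = (\<integral>x. f x * \<psi> x \<partial>lebX)"
    by (rule ac_stationary_integral[OF \<theta> p_lim ac_lim \<psi> f F])
  ultimately show "(\<lambda>n. \<integral>x. f x \<partial>\<mu> n) \<longlonglongrightarrow> (\<integral>x. f x \<partial>\<mu>_lim)" by simp
qed

end

section \<open>From the classes of good and bad maps to the abstract setting\<close>

lemma C3_diffeo01_bij: "C3_diffeo01 f I J \<Longrightarrow> bij_betw f I J"
  by (simp add: C3_diffeo01_def)

lemma good_map_image:
  assumes "good_map c T"
  shows "bij_betw T {0<..<c} {0<..<1}" "bij_betw T {c<..<1} {0<..<1}"
  using assms C3_diffeo01_bij unfolding good_map_def by blast+

lemma bad_map_image:
  assumes "bad_map_exponent c T l"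
  shows "bij_betw T {0<..<c} {0<..<c} \<or> bij_betw T {0<..<c} {c<..<1}"
    and "bij_betw T {c<..<1} {0<..<c} \<or> bij_betw T {c<..<1} {c<..<1}"
  using assms C3_diffeo01_bij unfolding bad_map_exponent_def by blast+

lemma good_map_branch_map:
  assumes c: "0 < c" "c < 1" and T: "good_map c T"
  obtains r where "branch_map c T r"
proof -
  interpret punctured_interval c using c by unfold_locales
  have maps: "T \<in> {0..1} \<rightarrow> {0..1}" and ends: "T ` {0, c, 1} \<subseteq> {0, 1}"
    and ns: "nonpos_schwarzian_on T {0..<c}" "nonpos_schwarzian_on T {c<..1}"
    and rep: "1 < \<bar>D01 T 0\<bar>" "1 < \<bar>D01 T 1\<bar>"
    and ex: "\<exists>r K M. r \<ge> 1 \<and> 0 < K \<and> K < 1 \<and> M > r \<and>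
        (\<forall>x\<in>{0..1} - {c}. K * \<bar>x - c\<bar> powr (r - 1) \<le> \<bar>D01 T x\<bar> \<and>
                           \<bar>D01 T x\<bar> \<le> M * \<bar>x - c\<bar> powr (r - 1))"
    using T unfolding good_map_def by blast+
  obtain r K where r: "1 \<le> r" "0 < K" "\<forall>x\<in>{0..1} - {c}. K * \<bar>x - c\<bar> powr (r - 1) \<le> \<bar>D01 T x\<bar>"
    using ex by blast
  have b: "bij_betw T I {0<..<1}" if "I \<in> sides" for I
    using good_map_image[OF T] that unfolding sides_def by blast
  have "branch_map c T r"
  proof
    show "T x \<in> {0..1}" if "x \<in> {0..1}" for x using funcset_mem[OF maps that] .
    show "T ` {0, 1} \<subseteq> {0, 1}" using ends by blast
    show "inj_on T I" if "I \<in> sides" for I using b[OF that] by (rule bij_betw_imp_inj_on)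
    show "(\<forall>I\<in>sides. T ` I = {0<..<1}) \<or> (\<forall>I\<in>sides. T ` I \<in> sides)" using b bij_betw_imp_surj_on by blast
    show "\<exists>K>0. \<forall>x\<in>{0..1} - {c}. K * \<bar>x - c\<bar> powr (r - 1) \<le> \<bar>D01 T x\<bar>" using r(2,3) by blast
  qed (fact ns rep r(1))+
  then show ?thesis by (rule that)
qed

lemma bad_map_branch_map:
  assumes c: "0 < c" "c < 1" and T: "bad_map_exponent c T l"
  shows "branch_map c T l"
proof -
  interpret punctured_interval c using c by unfold_locales
  have maps: "T \<in> {0..1} \<rightarrow> {0..1}" and ends: "T ` {0, 1} \<subseteq> {0, 1}" and l: "1 < l"
    and ns: "nonpos_schwarzian_on T {0..<c}" "nonpos_schwarzian_on T {c<..1}"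
    and rep: "1 < \<bar>D01 T 0\<bar>" "1 < \<bar>D01 T 1\<bar>"
    and ex: "\<exists>K M. 0 < K \<and> K < 1 \<and> M > l \<and>
        (\<forall>x\<in>{0..1} - {c}. K * \<bar>x - c\<bar> powr (l - 1) \<le> \<bar>D01 T x\<bar> \<and>
                           \<bar>D01 T x\<bar> \<le> M * \<bar>x - c\<bar> powr (l - 1))"
    using T unfolding bad_map_exponent_def by blast+
  obtain K where K: "0 < K" "\<forall>x\<in>{0..1} - {c}. K * \<bar>x - c\<bar> powr (l - 1) \<le> \<bar>D01 T x\<bar>"
    using ex by blast
  have b: "\<exists>J\<in>sides. bij_betw T I J" if "I \<in> sides" for I
    using bad_map_image[OF T] that unfolding sides_def by blast
  show ?thesis
  proof
    show "T x \<in> {0..1}" if "x \<in> {0..1}" for x using funcset_mem[OF maps that] .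
    show "inj_on T I" if "I \<in> sides" for I using b[OF that] bij_betw_imp_inj_on by blast
    have "T ` I \<in> sides" if "I \<in> sides" for I using b[OF that] bij_betw_imp_surj_on by blast
    then show "(\<forall>I\<in>sides. T ` I = {0<..<1}) \<or> (\<forall>I\<in>sides. T ` I \<in> sides)" by blast
    show "\<exists>K>0. \<forall>x\<in>{0..1} - {c}. K * \<bar>x - c\<bar> powr (l - 1) \<le> \<bar>D01 T x\<bar>" using K by blast
    show "1 \<le> l" using l by simp
  qed (fact ns rep ends)+
qed

theorem corollary1p2:
  fixes c :: real and N :: nat and T :: "nat \<Rightarrow> real \<Rightarrow> real" and l :: "nat \<Rightarrow> real"
    and p :: "nat \<Rightarrow> nat \<Rightarrow> real" and p_lim :: "nat \<Rightarrow> real"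
    and \<mu> :: "nat \<Rightarrow> real measure" and \<mu>_lim :: "real measure"
  assumes "0 < c" and "c < 1"
    and "\<And>j. j \<in> {1..N} \<Longrightarrow> good_map c (T j) \<or> bad_map c (T j)"
    and "good_indices c N T \<noteq> {}" and "bad_indices c N T \<noteq> {}"
    and "\<And>b. b \<in> bad_indices c N T \<Longrightarrow> bad_map_exponent c (T b) (l b)"
    and "\<And>n. positive_prob_vector N (p n)"
    and "(SUP n. \<Sum>b\<in>bad_indices c N T. p n b * l b) < 1"
    and "positive_prob_vector N p_lim"
    and "\<And>j. j \<in> {1..N} \<Longrightarrow> (\<lambda>n. p n j) \<longlonglongrightarrow> p_lim j"
    and "\<And>n. ac_stationary_prob N T (p n) (\<mu> n)"
    and "ac_stationary_prob N T p_lim \<mu>_lim"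
  shows "weak_conv01 \<mu> \<mu>_lim"
proof -
  define Bad where "Bad = bad_indices c N T"
  \<comment> \<open>For bad maps the exponent must be the prescribed \<open>l\<close>, because it
    enters the averaging condition; for good maps some exponent is chosen.\<close>
  define r where "r j = (if j \<in> Bad then l j else (SOME r. branch_map c (T j) r))" for j
  have Bad: "Bad \<subseteq> {1..N}" by (auto simp: Bad_def bad_indices_def)
  have bad: "bad_map_exponent c (T j) (l j)" if "j \<in> Bad" for j using assms(6) that by (simp add: Bad_def)
  have good: "good_map c (T j)" if "j \<in> {1..N} - Bad" for j
    using assms(3)[of j] that by (auto simp: Bad_def bad_indices_def)
  have rBad: "r j = l j" if "j \<in> Bad" for j using that by (simp add: r_def)
  interpret random_branches c N T r Bad
  proof (intro random_branches.intro random_branches_axioms.intro)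
    show "punctured_interval c" using assms(1,2) by unfold_locales
    then interpret punctured_interval c .
    show "branch_map c (T j) (r j)" if j: "j \<in> {1..N}" for j
    proof (cases "j \<in> Bad")
      case True
      then show ?thesis using bad_map_branch_map[OF assms(1,2) bad[OF True]] by (simp add: rBad)
    next
      case False
      then obtain r' where "branch_map c (T j) r'" using good_map_branch_map[OF assms(1,2) good] j by blast
      then have "branch_map c (T j) (SOME r. branch_map c (T j) r)" by (rule someI)
      then show ?thesis using False by (simp add: r_def)
    qed
    show "Bad \<subseteq> {1..N}" "Bad \<noteq> {}" using Bad assms(5) by (simp_all add: Bad_def)
    obtain j where j: "j \<in> {1..N}" "good_map c (T j)" using assms(4) by (auto simp: good_indices_def)
    \<comment> \<open>No map is both good and bad: \<open>c\<close> lies in the image of each branch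
      of a good map, but in neither side.\<close>
    have "j \<notin> Bad"
    proof
      assume "j \<in> Bad"
      moreover have "c \<in> {0<..<1}" "c \<notin> {0<..<c}" "c \<notin> {c<..<1}" using assms(1,2) by auto
      ultimately show False
        using bad_map_image(1)[OF bad] good_map_image(1)[OF j(2)] bij_betw_imp_surj_on by metis
    qed
    then show "{1..N} - Bad \<noteq> {}" using j by blast
    show "T j ` I \<in> sides" if "j \<in> Bad" "I \<in> sides" for j I
      using bad_map_image[OF bad[OF that(1)]] that(2) bij_betw_imp_surj_on unfolding sides_def by blast
    show "T j ` I = {0<..<1}" if "j \<in> {1..N} - Bad" "I \<in> sides" for j I
      using good_map_image[OF good[OF that(1)]] that(2) bij_betw_imp_surj_on unfolding sides_def by blast
    show "1 < r j" if "j \<in> Bad" for j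
      using bad[OF that] by (simp add: rBad[OF that] bad_map_exponent_def)
  qed
  define S where "S n = (\<Sum>b\<in>Bad. p n b * r b)" for n
  define \<theta> where "\<theta> = (SUP n. S n)"
  have S_eq: "S n = (\<Sum>b\<in>bad_indices c N T. p n b * l b)" for n
    unfolding S_def Bad_def[symmetric] by (intro sum.cong refl) (simp add: rBad)
  have \<theta>: "\<theta> < 1" using assms(8) by (simp add: \<theta>_def S_eq)
  \<comment> \<open>On the reals \<open>SUP\<close> is an upper bound only for families that are
    bounded above; here the bound comes from probabilities being at most \<open>1\<close>.\<close>
  have "S n \<le> (\<Sum>b\<in>Bad. r b)" for n
    unfolding S_def
  proof (intro sum_mono)
    fix b assume b: "b \<in> Bad"
    then have "p n b \<le> 1" "1 < r b" using prob_le_1[OF assms(7), of b n] Bad bad_exponent by auto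
    then show "p n b * r b \<le> r b" by simp
  qed
  then have "bdd_above (range S)" by (intro bdd_aboveI2)
  then have S\<theta>: "S n \<le> \<theta>" for n unfolding \<theta>_def by (intro cSUP_upper) simp_all
  have p: "admissible \<theta> (p n)" for n using assms(7) S\<theta>[of n] by (simp add: admissible_def S_def)
  \<comment> \<open>The averaged exponent is continuous in the vector, so the limit vector inherits
    the bound \<theta> and lies in the same class as all the \<open>p n\<close>.\<close>
  have "S \<longlonglongrightarrow> (\<Sum>b\<in>Bad. p_lim b * r b)"
    unfolding S_def[abs_def] using Bad by (intro tendsto_intros assms(10)) auto
  then have "(\<Sum>b\<in>Bad. p_lim b * r b) \<le> \<theta>" by (rule LIMSEQ_le_const2) (use S\<theta> in blast)
  then have "admissible \<theta> p_lim" using assms(9) by (simp add: admissible_def)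
  then show ?thesis by (rule weak_convergence[OF \<theta> p _ assms(10,11,12)])
qed

end
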